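(* Let $\Omega$ be an infinite procyclic group and $T:\Omega\to\Omega$ a minimal translation. There is a dense set of $f\in C(\Omega,\mathbb{R})$ such that for every $\omega\in\Omega$ the spectrum of $H_\omega$ is a Cantor set of positive Lebesgue measure and $H_\omega$ has purely absolutely continuous spectrum. Here $H_\omega$ is the operator on $\ell^2(\mathbb{Z})$ given by $(H_\omega\psi)(n)=\psi(n+1)+\psi(n-1)+f(T^n\omega)\psi(n)$.
   Context: A procyclic group is a compact Hausdorff topological group that is an inverse limit of finite cyclic (discrete) groups; infinite procyclic groups have no isolated points. A translation of $\Omega$ is a map $T(\omega)=\omega\cdot\omega_0$ for some fixed $\omega_0\in\Omega$; it is minimal if the orbit $\{T^n\omega:n\in\mathbb{Z}\}$ of every $\omega\in\Omega$ is dense in $\Omega$. $C(\Omega,\mathbb{R})$ carries the sup norm. A Cantor set is a closed subset of $\mathbb{R}$ with empty interior and no isolated points. $H_\omega$ has purely absolutely continuous spectrum if all its spectral measures are absolutely continuous with respect to Lebesgue measure. *)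

theory Defs
  imports
    "HOL-Analysis.Analysis"
    "HOL-Algebra.Product_Groups"
begin

definition topological_group :: "('a, 'm) monoid_scheme \<Rightarrow> 'a topology \<Rightarrow> bool" where
  "topological_group G X \<longleftrightarrow>
     group G \<and> topspace X = carrier G \<and>
     continuous_map (prod_topology X X) X (\<lambda>(x, y). x \<otimes>\<^bsub>G\<^esub> y) \<and>
     continuous_map X X (\<lambda>x. inv\<^bsub>G\<^esub> x)"

text \<open>
  An inverse system indexed by a directed set: \<open>lei i j\<close> is the order \<open>i \<le> j\<close>, and
  \<open>\<phi> i j\<close> is the bonding map from \<open>A j\<close> to \<open>A i\<close>.
\<close>

definition inverse_system ::
  "'i set \<Rightarrow> ('i \<Rightarrow> 'i \<Rightarrow> bool) \<Rightarrow> ('i \<Rightarrow> 'b monoid) \<Rightarrow> ('i \<Rightarrow> 'i \<Rightarrow> 'b \<Rightarrow> 'b) \<Rightarrow> bool" where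
  "inverse_system I lei A \<phi> \<longleftrightarrow>
     I \<noteq> {} \<and>
     (\<forall>i\<in>I. lei i i) \<and>
     (\<forall>i\<in>I. \<forall>j\<in>I. lei i j \<longrightarrow> lei j i \<longrightarrow> i = j) \<and>
     (\<forall>i\<in>I. \<forall>j\<in>I. \<forall>k\<in>I. lei i j \<longrightarrow> lei j k \<longrightarrow> lei i k) \<and>
     (\<forall>i\<in>I. \<forall>j\<in>I. \<exists>k\<in>I. lei i k \<and> lei j k) \<and>
     (\<forall>i\<in>I. group (A i)) \<and>
     (\<forall>i\<in>I. \<forall>j\<in>I. lei i j \<longrightarrow> \<phi> i j \<in> hom (A j) (A i)) \<and>
     (\<forall>i\<in>I. \<forall>x\<in>carrier (A i). \<phi> i i x = x) \<and>
     (\<forall>i\<in>I. \<forall>j\<in>I. \<forall>k\<in>I. lei i j \<longrightarrow> lei j k \<longrightarrow>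
        (\<forall>x\<in>carrier (A k). \<phi> i j (\<phi> j k x) = \<phi> i k x))"

definition inverse_limit_group ::
  "'i set \<Rightarrow> ('i \<Rightarrow> 'i \<Rightarrow> bool) \<Rightarrow> ('i \<Rightarrow> 'b monoid) \<Rightarrow> ('i \<Rightarrow> 'i \<Rightarrow> 'b \<Rightarrow> 'b) \<Rightarrow> ('i \<Rightarrow> 'b) monoid" where
  "inverse_limit_group I lei A \<phi> =
     (product_group I A)\<lparr>carrier :=
        {x \<in> \<Pi>\<^sub>E i\<in>I. carrier (A i). \<forall>i\<in>I. \<forall>j\<in>I. lei i j \<longrightarrow> \<phi> i j (x j) = x i}\<rparr>"

definition inverse_limit_topology ::
  "'i set \<Rightarrow> ('i \<Rightarrow> 'i \<Rightarrow> bool) \<Rightarrow> ('i \<Rightarrow> 'b monoid) \<Rightarrow> ('i \<Rightarrow> 'i \<Rightarrow> 'b \<Rightarrow> 'b) \<Rightarrow> ('i \<Rightarrow> 'b) topology" where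
  "inverse_limit_topology I lei A \<phi> =
     subtopology (product_topology (\<lambda>i. discrete_topology (carrier (A i))) I)
       (carrier (inverse_limit_group I lei A \<phi>))"

text \<open>
  HOL has no existential quantifier over types, so the inverse system that exhibits \<open>G\<close> as
  procyclic is a parameter of the predicate. Assuming the predicate for arbitrary parameters
  amounts to assuming that some such system exists, over arbitrary index and element types.
\<close>

definition procyclic_group ::
  "('a, 'm) monoid_scheme \<Rightarrow> 'a topology \<Rightarrow>
   'i set \<Rightarrow> ('i \<Rightarrow> 'i \<Rightarrow> bool) \<Rightarrow> ('i \<Rightarrow> 'b monoid) \<Rightarrow> ('i \<Rightarrow> 'i \<Rightarrow> 'b \<Rightarrow> 'b) \<Rightarrow> bool" where
  "procyclic_group G X I lei A \<phi> \<longleftrightarrow>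
     topological_group G X \<and> compact_space X \<and> Hausdorff_space X \<and>
     inverse_system I lei A \<phi> \<and>
     (\<forall>i\<in>I. finite (carrier (A i)) \<and> cyclic_group (A i)) \<and>
     (\<exists>h. h \<in> iso G (inverse_limit_group I lei A \<phi>) \<and>
          homeomorphic_map X (inverse_limit_topology I lei A \<phi>) h)"

definition translation :: "('a, 'm) monoid_scheme \<Rightarrow> ('a \<Rightarrow> 'a) \<Rightarrow> bool" where
  "translation G T \<longleftrightarrow> (\<exists>\<omega>0\<in>carrier G. \<forall>\<omega>\<in>carrier G. T \<omega> = \<omega> \<otimes>\<^bsub>G\<^esub> \<omega>0)"

text \<open>Integer iterates of a bijection \<open>T\<close> of the set \<open>S\<close>.\<close>

definition int_iterate :: "'a set \<Rightarrow> ('a \<Rightarrow> 'a) \<Rightarrow> int \<Rightarrow> 'a \<Rightarrow> 'a" where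
  "int_iterate S T n =
     (if 0 \<le> n then T ^^ nat n else (inv_into S T) ^^ nat (- n))"

definition minimal :: "'a topology \<Rightarrow> ('a \<Rightarrow> 'a) \<Rightarrow> bool" where
  "minimal X T \<longleftrightarrow>
     (\<forall>\<omega>\<in>topspace X. X closure_of (range (\<lambda>n. int_iterate (topspace X) T n \<omega>)) = topspace X)"

text \<open>\<open>C(\<Omega>, \<real>)\<close> with the sup metric; its elements are extensional on \<open>topspace X\<close>.\<close>

abbreviation C_real :: "'a topology \<Rightarrow> ('a \<Rightarrow> real) metric" where
  "C_real X \<equiv> cfunspace X euclidean_metric"

definition dense_in_C :: "'a topology \<Rightarrow> ('a \<Rightarrow> real) set \<Rightarrow> bool" where
  "dense_in_C X D \<longleftrightarrow>
     D \<subseteq> mspace (C_real X) \<and>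
     (mtopology_of (C_real X)) closure_of D = mspace (C_real X)"

definition ell2 :: "(int \<Rightarrow> complex) set" where
  "ell2 = {\<psi>. (\<lambda>n. (cmod (\<psi> n))\<^sup>2) summable_on UNIV}"

definition ell2_norm :: "(int \<Rightarrow> complex) \<Rightarrow> real" where
  "ell2_norm \<psi> = sqrt (\<Sum>\<^sub>\<infinity>n. (cmod (\<psi> n))\<^sup>2)"

definition ell2_inner :: "(int \<Rightarrow> complex) \<Rightarrow> (int \<Rightarrow> complex) \<Rightarrow> complex" where
  "ell2_inner \<phi> \<psi> = (\<Sum>\<^sub>\<infinity>n. cnj (\<phi> n) * \<psi> n)"

type_synonym operator = "(int \<Rightarrow> complex) \<Rightarrow> (int \<Rightarrow> complex)"

definition schroedinger :: "(int \<Rightarrow> real) \<Rightarrow> operator" where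
  "schroedinger V \<psi> = (\<lambda>n. \<psi> (n + 1) + \<psi> (n - 1) + complex_of_real (V n) * \<psi> n)"

definition H_op :: "'a topology \<Rightarrow> ('a \<Rightarrow> 'a) \<Rightarrow> ('a \<Rightarrow> real) \<Rightarrow> 'a \<Rightarrow> operator" where
  "H_op X T f \<omega> = schroedinger (\<lambda>n. f (int_iterate (topspace X) T n \<omega>))"

definition shifted :: "operator \<Rightarrow> complex \<Rightarrow> operator" where
  "shifted H z \<psi> = (\<lambda>n. H \<psi> n - z * \<psi> n)"

definition resolvent :: "operator \<Rightarrow> complex \<Rightarrow> operator" where
  "resolvent H z = inv_into ell2 (shifted H z)"

text \<open>\<open>H - z\<close> is a bijection of \<open>\<ell>\<^sup>2\<close> whose inverse is bounded.\<close>

definition resolvent_set :: "operator \<Rightarrow> complex set" where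
  "resolvent_set H =
     {z. bij_betw (shifted H z) ell2 ell2 \<and>
         (\<exists>C. \<forall>\<psi>\<in>ell2. ell2_norm (resolvent H z \<psi>) \<le> C * ell2_norm \<psi>)}"

definition op_spectrum :: "operator \<Rightarrow> complex set" where
  "op_spectrum H = - resolvent_set H"

text \<open>
  The spectral measure of a bounded self-adjoint operator \<open>H\<close> at the vector \<open>\<psi>\<close> is the finite
  Borel measure \<open>\<mu>\<close> on the real line with
  \<open>\<langle>\<psi>, (H - z)\<^sup>-\<^sup>1 \<psi>\<rangle> = \<integral> 1 / (x - z) d\<mu>(x)\<close> for all \<open>z\<close> outside the spectrum. Such a measure is
  unique, being determined by its Borel transform on the non-real \<open>z\<close>, where the integrand is
  bounded and hence integrable.
\<close>

definition is_spectral_measure :: "operator \<Rightarrow> (int \<Rightarrow> complex) \<Rightarrow> real measure \<Rightarrow> bool" where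
  "is_spectral_measure H \<psi> \<mu> \<longleftrightarrow>
     finite_measure \<mu> \<and> sets \<mu> = sets borel \<and>
     (\<forall>z\<in>resolvent_set H.
        ell2_inner \<psi> (resolvent H z \<psi>) = (\<integral>x. 1 / (complex_of_real x - z) \<partial>\<mu>))"

text \<open>
  As spectral measures are unique, the existential form below says that the spectral measure
  of every \<open>\<psi>\<close> is absolutely continuous, and cannot hold vacuously.
\<close>

definition purely_ac_spectrum :: "operator \<Rightarrow> bool" where
  "purely_ac_spectrum H \<longleftrightarrow>
     (\<forall>\<psi>\<in>ell2. \<exists>\<mu>. is_spectral_measure H \<psi> \<mu> \<and> absolutely_continuous lborel \<mu>)"

definition cantor_set :: "real set \<Rightarrow> bool" where
  "cantor_set S \<longleftrightarrow> closed S \<and> interior S = {} \<and> (\<forall>x\<in>S. x islimpt S)"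

end

theory Submission
  imports Defs "HOL-Algebra.Multiplicative_Group" "HOL-Probability.Probability" "HOL-Complex_Analysis.Complex_Analysis"
begin

text \<open>
  Density of the minimal orbit makes \<open>T\<close> act on each finite cyclic quotient as \<open>k \<mapsto> k + 1\<close> on
  \<open>\<int>/P\<^sub>i\<close>, the \<open>P\<^sub>i\<close> are unbounded, and the functions that factor through some quotient are dense;
  along an orbit they give periodic potentials.

  A \<open>p\<close>-periodic potential with discriminant \<open>D\<close> has the absolutely continuous spectral measures
  \<open>sqrt (4 - D\<^sup>2) / (2 pi \<bar>s\<bar>) dx\<close> at the unit vectors, where \<open>s\<close> is the off-diagonal entry of the
  monodromy matrix; this follows by solving for the Green function and Stieltjes inversion. Seen as
  an \<open>Np\<close>-periodic potential, with \<open>N\<close> large, it acquires a gap in each of finitely many prescribed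
  intervals when an arbitrarily small constant is added on \<open>Np \<int>\<close>, while the spectral densities move
  arbitrarily little in \<open>L\<^sup>1\<close>. Iterating with summable errors along a sequence of quotients gives a
  uniform limit whose densities converge in \<open>L\<^sup>1\<close>, so that the spectrum stays absolutely continuous,
  and which has gaps in a dense set of energies, so that the spectrum has empty interior. An
  absolutely continuous spectral measure has no isolated point in its support and the support has
  positive measure.
\<close>

section \<open>The Hilbert space of square-summable sequences\<close>

text \<open>The obstacle is the passage to the limit. Uniform convergence of potentials gives only
  weak convergence of spectral measures, and a weak limit of absolutely continuous measures may be
  singular; this is why the densities themselves are followed in L1. For a single kick the L1
  estimate comes cheaply: the densities before and after have total mass 1, so convergence almost
  everywhere as the kick shrinks already implies L1 convergence (Scheffe), without any estimate near
  the band edges, where densities may blow up. Gaps are kept differently: a resolvent point persists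
  under all uniformly small changes, so each stage fixes a tolerance that the later stages together
  do not exceed. The period is multiplied before kicking because, seen with period
  \<open>N p\<close>, a band splits into pieces that touch where
  \<open>sin (N \<theta>) = 0\<close>; for large \<open>N\<close> every prescribed interval inside
  the spectrum contains places where a kick can separate them. All \<omega> are handled at once: at
  each stage the potentials along the orbits are translates of one periodic sequence, and every
  estimate is uniform over translates.\<close>

lemma ell2_iff: "f \<in> ell2 \<longleftrightarrow> (\<lambda>n. (cmod (f n))\<^sup>2) summable_on UNIV"
  by (simp add: ell2_def)

lemma norm_add_sq_le: "(norm (a + b))\<^sup>2 \<le> 2 * (norm a)\<^sup>2 + 2 * (norm (b::'a::real_normed_vector))\<^sup>2"
proof -
  have "(norm (a + b))\<^sup>2 \<le> (norm a + norm b)\<^sup>2"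
    by (intro power_mono norm_triangle_ineq) auto
  also have "\<dots> \<le> 2 * (norm a)\<^sup>2 + 2 * (norm b)\<^sup>2"
    using sum_squares_bound[of "norm a" "norm b"] by (simp add: power2_sum)
  finally show ?thesis .
qed

lemma ell2_comparison:
  assumes "f \<in> ell2" and "\<And>n. cmod (g n) \<le> C * cmod (f n)"
  shows "g \<in> ell2"
  unfolding ell2_iff
proof (rule summable_on_comparison_test)
  show "(\<lambda>n. C\<^sup>2 * (cmod (f n))\<^sup>2) summable_on UNIV"
    using assms(1) by (intro summable_on_cmult_right) (simp add: ell2_iff)
  show "(cmod (g n))\<^sup>2 \<le> C\<^sup>2 * (cmod (f n))\<^sup>2" for n
    using power_mono[OF assms(2)[of n] norm_ge_zero, of 2] by (simp add: power_mult_distrib)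
qed auto

lemma ell2_add: assumes "f \<in> ell2" "g \<in> ell2" shows "(\<lambda>n. f n + g n) \<in> ell2"
  unfolding ell2_iff
proof (rule summable_on_comparison_test)
  show "(\<lambda>n. 2 * (cmod (f n))\<^sup>2 + 2 * (cmod (g n))\<^sup>2) summable_on UNIV"
    using assms by (intro summable_on_add summable_on_cmult_right) (simp_all add: ell2_iff)
qed (auto intro: norm_add_sq_le)

lemma ell2_cnj_mult_summable:
  assumes "f \<in> ell2" "g \<in> ell2" shows "(\<lambda>n. cnj (f n) * g n) summable_on UNIV"
proof (rule abs_summable_summable, rule Infinite_Sum.abs_summable_on_comparison_test')
  show "(\<lambda>n. (cmod (f n))\<^sup>2 + (cmod (g n))\<^sup>2) summable_on UNIV"
    using assms by (intro summable_on_add) (simp_all add: ell2_iff)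
  show "norm (cnj (f n) * g n) \<le> (cmod (f n))\<^sup>2 + (cmod (g n))\<^sup>2" for n
  proof -
    have "0 \<le> cmod (f n) * cmod (g n)" by simp
    with sum_squares_bound[of "cmod (f n)" "cmod (g n)"] show ?thesis
      unfolding norm_mult complex_mod_cnj by linarith
  qed
qed

lemma Re_cnj_mult_self: "Re (cnj z * z) = (cmod z)\<^sup>2"
  unfolding cmod_power2 by (simp add: power2_eq_square)

text \<open>As a type, the square-summable sequences form a real Hilbert space on which linearity,
  surjectivity and fixed points are those of total maps. Complex scalars act as multiplication
  operators with constant functions, and \<open>cinner\<close> keeps the complex inner
  product.\<close>

typedef l2 = ell2
  by (rule exI[of _ "\<lambda>_. 0"]) (simp add: ell2_iff)

setup_lifting type_definition_l2

lemma Rep_l2_ell2 [simp]: "Rep_l2 x \<in> ell2"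
  using Rep_l2 by simp

instantiation l2 :: real_vector
begin
lift_definition zero_l2 :: l2 is "\<lambda>_. 0" by (simp add: ell2_iff)
lift_definition plus_l2 :: "l2 \<Rightarrow> l2 \<Rightarrow> l2" is "\<lambda>f g n. f n + g n" by (rule ell2_add)
lift_definition uminus_l2 :: "l2 \<Rightarrow> l2" is "\<lambda>f n. - f n" by (simp add: ell2_iff)
lift_definition minus_l2 :: "l2 \<Rightarrow> l2 \<Rightarrow> l2" is "\<lambda>f g n. f n - g n"
proof -
  fix f g assume "f \<in> ell2" "g \<in> ell2"
  then show "(\<lambda>n. f n - g n) \<in> ell2"
    using ell2_add[of f "\<lambda>n. - g n"] by (simp add: ell2_iff)
qed
lift_definition scaleR_l2 :: "real \<Rightarrow> l2 \<Rightarrow> l2" is "\<lambda>r f n. r *\<^sub>R f n"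
  by (rule ell2_comparison[where C="\<bar>r\<bar>" for r]) auto
instance
  by standard (transfer, simp add: fun_eq_iff algebra_simps scaleR_add_left scaleR_add_right)+
end

lift_definition cinner :: "l2 \<Rightarrow> l2 \<Rightarrow> complex" is ell2_inner .

instantiation l2 :: real_inner
begin
definition inner_l2 :: "l2 \<Rightarrow> l2 \<Rightarrow> real" where "inner_l2 x y = Re (cinner x y)"
definition norm_l2 :: "l2 \<Rightarrow> real" where "norm_l2 x = sqrt (inner x x)"
definition dist_l2 :: "l2 \<Rightarrow> l2 \<Rightarrow> real" where "dist_l2 x y = norm (x - y)"
definition sgn_l2 :: "l2 \<Rightarrow> l2" where "sgn_l2 x = x /\<^sub>R norm x"
definition uniformity_l2 :: "(l2 \<times> l2) filter"
  where "uniformity_l2 = (INF e\<in>{0 <..}. principal {(x, y). dist x y < e})"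
definition open_l2 :: "l2 set \<Rightarrow> bool"
  where "open_l2 U = (\<forall>x\<in>U. eventually (\<lambda>(x', y). x' = x \<longrightarrow> y \<in> U) uniformity)"
instance
proof
  fix x y z :: l2 and r :: real
  show "inner x y = inner y x"
    unfolding inner_l2_def
  proof transfer
    fix f g assume fg: "f \<in> ell2" "g \<in> ell2"
    have "ell2_inner g f = cnj (ell2_inner f g)"
      unfolding ell2_inner_def infsum_cnj[symmetric] by (simp add: mult.commute)
    then show "Re (ell2_inner f g) = Re (ell2_inner g f)" by simp
  qed
  show "inner (x + y) z = inner x z + inner y z"
    unfolding inner_l2_def
  proof transfer
    fix f g h assume "f \<in> ell2" "g \<in> ell2" "h \<in> ell2"
    then show "Re (ell2_inner (\<lambda>n. f n + g n) h) = Re (ell2_inner f h) + Re (ell2_inner g h)"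
      unfolding ell2_inner_def by (simp add: distrib_right infsum_add ell2_cnj_mult_summable)
  qed
  show "inner (r *\<^sub>R x) y = r * inner x y"
    unfolding inner_l2_def
  proof transfer
    fix r f g assume "f \<in> ell2" "g \<in> ell2"
    have "ell2_inner (\<lambda>n. r *\<^sub>R f n) g = of_real r * ell2_inner f g"
      unfolding ell2_inner_def infsum_cmult_right'[symmetric] by (simp add: scaleR_conv_of_real mult.assoc)
    then show "Re (ell2_inner (\<lambda>n. r *\<^sub>R f n) g) = r * Re (ell2_inner f g)" by simp
  qed
  have sq: "Re (cinner x x) = (\<Sum>\<^sub>\<infinity>n. (cmod (Rep_l2 x n))\<^sup>2)" for x
  proof transfer
    fix f assume "f \<in> ell2"
    then show "Re (ell2_inner f f) = (\<Sum>\<^sub>\<infinity>n. (cmod (f n))\<^sup>2)"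
      unfolding ell2_inner_def
      by (subst infsum_Re[symmetric], rule ell2_cnj_mult_summable)
         (simp_all only: Re_cnj_mult_self)
  qed
  show "0 \<le> inner x x" unfolding inner_l2_def sq by (rule infsum_nonneg) auto
  show "inner x x = 0 \<longleftrightarrow> x = 0"
  proof
    assume 0: "inner x x = 0"
    have "Rep_l2 x n = 0" for n
      using nonneg_infsum_le_0D[of "\<lambda>n. (cmod (Rep_l2 x n))\<^sup>2" UNIV n] 0 Rep_l2[of x]
      by (auto simp: inner_l2_def sq ell2_iff)
    then show "x = 0" by transfer (simp add: fun_eq_iff)
  next
    assume "x = 0"
    then show "inner x x = 0"
      unfolding inner_l2_def by simp (transfer, simp add: ell2_inner_def)
  qed
qed (simp_all add: dist_l2_def sgn_l2_def uniformity_l2_def open_l2_def norm_l2_def)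
end

lemma norm_l2_sq: "(norm x)\<^sup>2 = (\<Sum>\<^sub>\<infinity>n. (cmod (Rep_l2 x n))\<^sup>2)"
proof -
  have "(norm x)\<^sup>2 = Re (cinner x x)"
    by (simp add: norm_eq_sqrt_inner inner_l2_def[symmetric])
  also have "\<dots> = (\<Sum>\<^sub>\<infinity>n. (cmod (Rep_l2 x n))\<^sup>2)"
  proof transfer
    fix f assume "f \<in> ell2"
    then show "Re (ell2_inner f f) = (\<Sum>\<^sub>\<infinity>n. (cmod (f n))\<^sup>2)"
      unfolding ell2_inner_def
      by (subst infsum_Re[symmetric], rule ell2_cnj_mult_summable)
         (simp_all only: Re_cnj_mult_self)
  qed
  finally show ?thesis .
qed

lemma norm_l2_ell2: "norm x = ell2_norm (Rep_l2 x)"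
  unfolding ell2_norm_def norm_l2_sq[symmetric] by simp

lemma sum_sq_le_norm: "finite F \<Longrightarrow> (\<Sum>n\<in>F. (cmod (Rep_l2 x n))\<^sup>2) \<le> (norm x)\<^sup>2"
  unfolding norm_l2_sq using Rep_l2_ell2[of x, unfolded ell2_iff] by (intro finite_sum_le_infsum) auto

lemma cmod_Rep_le_norm: "cmod (Rep_l2 x n) \<le> norm x"
  using sum_sq_le_norm[of "{n}" x] by (simp add: power2_le_iff_abs_le)

lemma ell2_bounded_sums:
  assumes "\<And>F. finite F \<Longrightarrow> (\<Sum>n\<in>F. (cmod (f n))\<^sup>2) \<le> C"
  shows "f \<in> ell2"
  unfolding ell2_iff by (rule nonneg_bdd_above_summable_on) (use assms in \<open>auto intro!: bdd_aboveI2\<close>)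

lemma Rep_l2_simps [simp]:
  "Rep_l2 (x + y) n = Rep_l2 x n + Rep_l2 y n"
  "Rep_l2 (x - y) n = Rep_l2 x n - Rep_l2 y n"
  "Rep_l2 (- x) n = - Rep_l2 x n"
  "Rep_l2 0 n = 0"
  "Rep_l2 (r *\<^sub>R x) n = r *\<^sub>R Rep_l2 x n"
  by (transfer, simp)+

lemma l2_eqI: "(\<And>n. Rep_l2 x n = Rep_l2 y n) \<Longrightarrow> x = y"
  by (simp add: Rep_l2_inject[symmetric] fun_eq_iff)

text \<open>Coordinates of a Cauchy sequence converge. The Cauchy estimate for sums over finite
  index sets passes to the coordinatewise limit and yields both membership in \<open>ell2\<close>
  and convergence in norm.\<close>

instance l2 :: complete_space
proof
  fix X :: "nat \<Rightarrow> l2"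
  assume X: "Cauchy X"
  have "Cauchy (\<lambda>k. Rep_l2 (X k) n)" for n
  proof (rule metric_CauchyI)
    fix e :: real assume "e > 0"
    then obtain M where M: "\<forall>m\<ge>M. \<forall>k\<ge>M. dist (X m) (X k) < e"
      using metric_CauchyD[OF X] by blast
    have "dist (Rep_l2 (X m) n) (Rep_l2 (X k) n) < e" if "m \<ge> M" "k \<ge> M" for m k
    proof -
      have "dist (Rep_l2 (X m) n) (Rep_l2 (X k) n) \<le> dist (X m) (X k)"
        using cmod_Rep_le_norm[of "X m - X k" n] by (simp add: dist_norm)
      also have "\<dots> < e" using M that by blast
      finally show ?thesis .
    qed
    then show "\<exists>M. \<forall>m\<ge>M. \<forall>k\<ge>M. dist (Rep_l2 (X m) n) (Rep_l2 (X k) n) < e" by blast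
  qed
  then have "\<forall>n. \<exists>l. (\<lambda>k. Rep_l2 (X k) n) \<longlonglongrightarrow> l"
    by (simp add: Cauchy_convergent_iff convergent_def)
  then obtain f where f: "\<And>n. (\<lambda>k. Rep_l2 (X k) n) \<longlonglongrightarrow> f n" by metis
  have bd: "(\<Sum>n\<in>F. (cmod (Rep_l2 (X m) n - f n))\<^sup>2) \<le> e\<^sup>2"
    if M: "\<And>m n. m \<ge> M \<Longrightarrow> n \<ge> M \<Longrightarrow> dist (X m) (X n) < e" and "finite F" "m \<ge> M" for F e M m
  proof (rule LIMSEQ_le_const2)
    show "(\<lambda>k. \<Sum>n\<in>F. (cmod (Rep_l2 (X m) n - Rep_l2 (X k) n))\<^sup>2)
        \<longlonglongrightarrow> (\<Sum>n\<in>F. (cmod (Rep_l2 (X m) n - f n))\<^sup>2)"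
      by (intro tendsto_intros f)
    have "(\<Sum>n\<in>F. (cmod (Rep_l2 (X m) n - Rep_l2 (X k) n))\<^sup>2) \<le> e\<^sup>2" if "k \<ge> M" for k
    proof -
      have "(\<Sum>n\<in>F. (cmod (Rep_l2 (X m - X k) n))\<^sup>2) \<le> (norm (X m - X k))\<^sup>2"
        using \<open>finite F\<close> by (rule sum_sq_le_norm)
      also have "\<dots> \<le> e\<^sup>2"
        using M[OF \<open>m \<ge> M\<close> \<open>k \<ge> M\<close>] by (intro power_mono) (auto simp: dist_norm)
      finally show ?thesis by simp
    qed
    then show "\<exists>N. \<forall>k\<ge>N. (\<Sum>n\<in>F. (cmod (Rep_l2 (X m) n - Rep_l2 (X k) n))\<^sup>2) \<le> e\<^sup>2" by blast
  qed
  obtain M where M: "\<And>m n. m \<ge> M \<Longrightarrow> n \<ge> M \<Longrightarrow> dist (X m) (X n) < 1"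
    using metric_CauchyD[OF X zero_less_one] by blast
  have "(\<lambda>n. Rep_l2 (X M) n - f n) \<in> ell2"
    using bd[OF M] by (intro ell2_bounded_sums[where C="1\<^sup>2"]) auto
  then have "Rep_l2 (X M - Abs_l2 (\<lambda>n. Rep_l2 (X M) n - f n)) = f"
    by (auto simp: fun_eq_iff Abs_l2_inverse)
  then obtain y where y: "Rep_l2 y = f" by blast
  have "X \<longlonglongrightarrow> y"
  proof (rule metric_LIMSEQ_I)
    fix e :: real assume "e > 0"
    then obtain M where M: "\<And>m n. m \<ge> M \<Longrightarrow> n \<ge> M \<Longrightarrow> dist (X m) (X n) < e/2"
      using metric_CauchyD[OF X, of "e/2"] half_gt_zero[of e] by blast
    have "dist (X m) y < e" if "m \<ge> M" for m
    proof -
      have "(norm (X m - y))\<^sup>2 \<le> (e/2)\<^sup>2"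
        unfolding norm_l2_sq
        by (rule infsum_le_finite_sums)
           (use bd[OF M _ that] Rep_l2_ell2[of "X m - y", unfolded ell2_iff] in \<open>auto simp: y\<close>)
      then have "norm (X m - y) \<le> e/2"
        by (rule power2_le_imp_le) (use \<open>e > 0\<close> in simp)
      then show ?thesis using \<open>e > 0\<close> by (simp add: dist_norm)
    qed
    then show "\<exists>no. \<forall>n\<ge>no. dist (X n) y < e"
      by blast
  qed
  then show "convergent X" by (auto simp: convergent_def)
qed

instance l2 :: banach ..

section \<open>Bounded inverses and their stability\<close>

definition boundedly_invertible :: "('a::real_normed_vector \<Rightarrow> 'a) \<Rightarrow> real \<Rightarrow> bool" where
  "boundedly_invertible A c \<longleftrightarrow> linear A \<and> surj A \<and> (\<forall>x. norm x \<le> c * norm (A x))"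

lemma boundedly_invertible_bij: "boundedly_invertible A c \<Longrightarrow> bij A"
  unfolding boundedly_invertible_def bij_def
  by (auto simp: linear_injective_0 intro: order.trans)
    (metis mult_zero_right norm_le_zero_iff norm_zero)

text \<open>Solving \<open>A x + B x = y\<close> means finding a fixed point of
  \<open>x \<mapsto> A^-1 (y - B x)\<close>, a contraction with factor \<open>c * b\<close>. The new
  constant comes from \<open>norm x \<le> c * (norm (A x + B x) + b * norm x)\<close>.\<close>

lemma boundedly_invertible_perturb:
  fixes A B :: "'a::banach \<Rightarrow> 'a"
  assumes A: "boundedly_invertible A c" and B: "linear B" "\<And>x. norm (B x) \<le> b * norm x"
    and c: "0 \<le> c" "0 \<le> b" "c * b < 1"
  shows "boundedly_invertible (\<lambda>x. A x + B x) (c / (1 - c * b))"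
  unfolding boundedly_invertible_def
proof (intro conjI allI)
  have lin: "linear A" and surj: "surj A" and low: "\<And>x. norm x \<le> c * norm (A x)"
    using A by (auto simp: boundedly_invertible_def)
  show "linear (\<lambda>x. A x + B x)" by (intro linear_compose_add lin B)
  show "surj (\<lambda>x. A x + B x)"
  proof (rule surjI)
    fix y
    define T where "T x = inv_into UNIV A (y - B x)" for x
    have AT: "A (T x) = y - B x" for x unfolding T_def by (rule surj_f_inv_f[OF surj])
    have "dist (T x) (T x') \<le> c * b * dist x x'" for x x'
    proof -
      have "norm (T x - T x') \<le> c * norm (A (T x - T x'))" by (rule low)
      also have "A (T x - T x') = B (x' - x)"
        using B(1) by (simp add: linear_diff[OF lin] AT linear_diff)
      also have "c * norm (B (x' - x)) \<le> c * (b * norm (x' - x))"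
        using c B(2) by (intro mult_left_mono) auto
      finally show ?thesis by (simp add: dist_norm norm_minus_commute mult.assoc)
    qed
    then have "\<exists>!x. T x = x" using c by (intro banach_fix_type[of "c * b"]) auto
    then obtain x where "T x = x" by blast
    then have "A x + B x = y" using AT[of x] by simp
    then show "A (SOME x. A x + B x = y) + B (SOME x. A x + B x = y) = y"
      by (rule someI[of "\<lambda>x. A x + B x = y"])
  qed
  fix x
  have "norm x \<le> c * norm ((A x + B x) - B x)" using low[of x] by simp
  also have "\<dots> \<le> c * (norm (A x + B x) + b * norm x)"
    using c B(2)[of x] norm_triangle_ineq4[of "A x + B x" "B x"] by (intro mult_left_mono) auto
  finally have "(1 - c * b) * norm x \<le> c * norm (A x + B x)" by (simp add: algebra_simps)
  then show "norm x \<le> c / (1 - c * b) * norm (A x + B x)"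
    using c by (simp add: field_simps)
qed

section \<open>Shifts, multiplications and the complex inner product\<close>

lift_definition shift_op :: "int \<Rightarrow> l2 \<Rightarrow> l2" is "\<lambda>k f n. f (n + k)"
proof -
  fix k :: int and f assume "f \<in> ell2"
  then show "(\<lambda>n. f (n + k)) \<in> ell2"
    unfolding ell2_iff
    by (subst summable_on_reindex_bij_betw[of "\<lambda>n. n + k" UNIV UNIV "\<lambda>n. (cmod (f n))\<^sup>2"])
       (auto simp: bij_plus_right)
qed

text \<open>The value 0 for an unbounded \<open>V\<close> makes the lifting total, and the resulting
  map is still linear.\<close>

lift_definition mult_op :: "(int \<Rightarrow> complex) \<Rightarrow> l2 \<Rightarrow> l2" is
  "\<lambda>V f n. if bounded (range V) then V n * f n else 0"
proof -
  fix V :: "int \<Rightarrow> complex" and f assume f: "f \<in> ell2"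
  show "(\<lambda>n. if bounded (range V) then V n * f n else 0) \<in> ell2"
  proof (cases "bounded (range V)")
    case True
    then obtain C where "\<forall>v\<in>range V. cmod v \<le> C" unfolding bounded_iff by blast
    then have "cmod (V n) \<le> C" for n by simp
    from mult_right_mono[OF this norm_ge_zero] have "cmod (V n * f n) \<le> C * cmod (f n)" for n
      by (simp add: norm_mult)
    with True show ?thesis by (intro ell2_comparison[OF f, of _ C]) simp
  qed (simp add: ell2_iff)
qed

lemma Rep_shift_op [simp]: "Rep_l2 (shift_op k x) n = Rep_l2 x (n + k)"
  by transfer simp

lemma Rep_mult_op [simp]: "bounded (range V) \<Longrightarrow> Rep_l2 (mult_op V x) n = V n * Rep_l2 x n"
  by transfer simp

lemma linear_shift_op: "linear (shift_op k)"
  by (rule linearI) (auto intro: l2_eqI)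

lemma linear_mult_op: "linear (mult_op V)"
proof (cases "bounded (range V)")
  case True
  then show ?thesis by (intro linearI l2_eqI) (auto simp: algebra_simps)
next
  case False
  then have "mult_op V x = 0" for x by (intro l2_eqI) (transfer, simp)
  then show ?thesis by (intro linearI) auto
qed

lemma norm_shift_op [simp]: "norm (shift_op k x) = norm x"
proof -
  have "(norm (shift_op k x))\<^sup>2 = (norm x)\<^sup>2"
    unfolding norm_l2_sq Rep_shift_op
    by (rule infsum_reindex_bij_betw[of "\<lambda>n. n + k" UNIV UNIV "\<lambda>n. (cmod (Rep_l2 x n))\<^sup>2"])
       (auto simp: bij_plus_right)
  then show ?thesis by simp
qed

lemma norm_mult_op_le:
  assumes "\<And>n. cmod (V n) \<le> C"
  shows "norm (mult_op V x) \<le> C * norm x"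
proof -
  have C: "0 \<le> C" using assms[of 0] norm_ge_zero order.trans by blast
  have bV: "bounded (range V)" using assms by (intro boundedI[of _ C]) auto
  have "(norm (mult_op V x))\<^sup>2 \<le> (C * norm x)\<^sup>2"
    unfolding norm_l2_sq
  proof (rule infsum_le_finite_sums)
    show "(\<lambda>n. (cmod (Rep_l2 (mult_op V x) n))\<^sup>2) summable_on UNIV"
      using Rep_l2_ell2[of "mult_op V x"] unfolding ell2_iff .
    fix F :: "int set" assume F: "finite F"
    have "(\<Sum>n\<in>F. (cmod (Rep_l2 (mult_op V x) n))\<^sup>2) \<le> (\<Sum>n\<in>F. C\<^sup>2 * (cmod (Rep_l2 x n))\<^sup>2)"
      using assms bV by (intro sum_mono) (auto simp: norm_mult power_mult_distrib intro!: mult_right_mono power_mono)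
    also have "\<dots> \<le> C\<^sup>2 * (norm x)\<^sup>2"
      unfolding sum_distrib_left[symmetric] by (intro mult_left_mono sum_sq_le_norm F) auto
    finally show "(\<Sum>n\<in>F. (cmod (Rep_l2 (mult_op V x) n))\<^sup>2) \<le> (C * norm x)\<^sup>2"
      by (simp add: power_mult_distrib)
  qed
  then show ?thesis by (rule power2_le_imp_le) (use C in simp)
qed

lemma cinner_eq: "cinner x y = (\<Sum>\<^sub>\<infinity>n. cnj (Rep_l2 x n) * Rep_l2 y n)"
  by transfer (simp add: ell2_inner_def)

lemma cinner_summable: "(\<lambda>n. cnj (Rep_l2 x n) * Rep_l2 y n) summable_on UNIV"
  by (rule ell2_cnj_mult_summable) auto

lemma cinner_add_right: "cinner x (y + z) = cinner x y + cinner x z"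
  unfolding cinner_eq using infsum_add[OF cinner_summable[of x y] cinner_summable[of x z]]
  by (simp add: algebra_simps)

lemma cinner_add_left: "cinner (x + y) z = cinner x z + cinner y z"
  unfolding cinner_eq using infsum_add[OF cinner_summable[of x z] cinner_summable[of y z]]
  by (simp add: algebra_simps)

lemma cinner_cnj: "cnj (cinner x y) = cinner y x"
  unfolding cinner_eq infsum_cnj[symmetric] by (simp add: mult.commute)

lemma cinner_scaleR_right: "cinner x (r *\<^sub>R y) = r *\<^sub>R cinner x y"
  unfolding cinner_eq
  by (simp add: scaleR_conv_of_real infsum_cmult_right'[symmetric] mult.left_commute)

lemma cinner_scaleR_left: "cinner (r *\<^sub>R x) y = r *\<^sub>R cinner x y"
  unfolding cinner_eq
  by (simp add: scaleR_conv_of_real infsum_cmult_right'[symmetric] mult.assoc)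

lemma cinner_minus_right: "cinner x (- y) = - cinner x y"
  using cinner_scaleR_right[of x "-1" y] by simp

lemma cinner_diff_right: "cinner x (y - z) = cinner x y - cinner x z"
  using cinner_add_right[of x y "- z"] by (simp add: cinner_minus_right)

lemma cinner_mult_op_const: "cinner x (mult_op (\<lambda>_. c) y) = c * cinner x y"
proof -
  have "cinner x (mult_op (\<lambda>_. c) y) = (\<Sum>\<^sub>\<infinity>n. c * (cnj (Rep_l2 x n) * Rep_l2 y n))"
    unfolding cinner_eq by (rule infsum_cong) simp
  then show ?thesis unfolding cinner_eq infsum_cmult_right' .
qed

lemma cinner_self: "cinner x x = of_real ((norm x)\<^sup>2)"
proof (rule complex_eqI)
  show "Re (cinner x x) = Re (of_real ((norm x)\<^sup>2))"
    by (simp add: power2_norm_eq_inner inner_l2_def)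
  have "cnj (cinner x x) = cinner x x" by (rule cinner_cnj)
  then show "Im (cinner x x) = Im (of_real ((norm x)\<^sup>2))" by (simp add: complex_eq_iff)
qed

text \<open>The real Cauchy-Schwarz inequality is applied to \<open>x\<close> and
  \<open>cnj c\<close> times \<open>y\<close> with \<open>c = cinner x y\<close>: this factor turns
  the inner product into the real number \<open>(cmod c)^2\<close>.\<close>

lemma cmod_cinner_le: "cmod (cinner x y) \<le> norm x * norm y"
proof (cases "cinner x y = 0")
  case False
  define c where "c = cinner x y"
  have "(cmod c)\<^sup>2 = Re (cnj c * c)" by (rule Re_cnj_mult_self[symmetric])
  also have "\<dots> = inner x (mult_op (\<lambda>_. cnj c) y)"
    by (simp add: inner_l2_def cinner_mult_op_const c_def)
  also have "\<dots> \<le> norm x * norm (mult_op (\<lambda>_. cnj c) y)" by (rule norm_cauchy_schwarz)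
  also have "\<dots> \<le> norm x * (cmod c * norm y)"
    by (intro mult_left_mono norm_mult_op_le) auto
  finally have "cmod c * cmod c \<le> cmod c * (norm x * norm y)"
    by (simp add: power2_eq_square algebra_simps)
  then show ?thesis using False by (simp add: c_def)
qed simp

text \<open>The potential is real, so conjugation exchanges \<open>Hz V z\<close> and
  \<open>Hz V (cnj z)\<close>; this is the source of the symmetry of the Green function.\<close>

lift_definition cnj_l2 :: "l2 \<Rightarrow> l2" is "\<lambda>f n. cnj (f n)" by (simp add: ell2_iff)

lemma Rep_cnj_l2 [simp]: "Rep_l2 (cnj_l2 x) n = cnj (Rep_l2 x n)"
  by transfer simp

lift_definition delta :: "int \<Rightarrow> l2" is "\<lambda>k n. if n = k then 1 else 0"
proof -
  fix k :: int
  have "(\<lambda>n. (cmod (if n = k then 1 else 0))\<^sup>2) summable_on UNIV \<longleftrightarrow>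
        (\<lambda>n. (cmod (if n = k then 1 else 0))\<^sup>2) summable_on {k}"
    by (rule summable_on_cong_neutral) auto
  then show "(\<lambda>n. if n = k then 1 else 0) \<in> ell2" by (simp add: ell2_iff)
qed

lemma Rep_delta [simp]: "Rep_l2 (delta k) n = (if n = k then 1 else 0)"
  by transfer simp

lemma cinner_delta_left: "cinner (delta k) x = Rep_l2 x k"
proof -
  have "cinner (delta k) x = (\<Sum>\<^sub>\<infinity>n\<in>{k}. cnj (Rep_l2 (delta k) n) * Rep_l2 x n)"
    unfolding cinner_eq by (rule infsum_cong_neutral) auto
  then show ?thesis by simp
qed

lemma norm_delta [simp]: "norm (delta k) = 1"
proof -
  have "complex_of_real ((norm (delta k))\<^sup>2) = of_real 1"
    unfolding cinner_self[symmetric] cinner_delta_left by simp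
  then have "(norm (delta k))\<^sup>2 = 1" unfolding of_real_eq_iff .
  then show ?thesis using power2_eq_iff_nonneg[of "norm (delta k)" 1] by simp
qed

section \<open>Resolvents of discrete Schroedinger operators\<close>

text \<open>The operator \<open>H - z\<close> on \<open>l2\<close>. Potential and energy are merged
  into one multiplication operator, so that changes of either are perturbations of the same
  kind.\<close>

definition Hz :: "(int \<Rightarrow> real) \<Rightarrow> complex \<Rightarrow> l2 \<Rightarrow> l2" where
  "Hz V z x = shift_op 1 x + shift_op (-1) x + mult_op (\<lambda>n. of_real (V n) - z) x"

lemma linear_Hz: "linear (Hz V z)"
  unfolding Hz_def by (intro linear_compose_add linear_shift_op linear_mult_op)

definition bounded_by :: "(int \<Rightarrow> real) \<Rightarrow> real \<Rightarrow> bool" where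
  "bounded_by V M \<longleftrightarrow> (\<forall>n. \<bar>V n\<bar> \<le> M)"

lemma bounded_byD: "bounded_by V M \<Longrightarrow> \<bar>V n\<bar> \<le> M"
  by (simp add: bounded_by_def)

lemma bounded_pot_minus:
  "bounded_by V M \<Longrightarrow> bounded (range (\<lambda>n. of_real (V n) - (z::complex)))"
proof -
  assume V: "bounded_by V M"
  have "cmod (of_real (V n) - z) \<le> M + cmod z" for n
    using norm_triangle_ineq4[of "of_real (V n)" z] bounded_byD[OF V, of n] by simp
  then show ?thesis by (intro boundedI[of _ "M + cmod z"]) auto
qed

lemma Rep_Hz:
  assumes V: "bounded_by V M"
  shows "Rep_l2 (Hz V z x) n = Rep_l2 x (n + 1) + Rep_l2 x (n - 1) + (of_real (V n) - z) * Rep_l2 x n"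
  unfolding Hz_def by (simp add: Rep_mult_op[OF bounded_pot_minus[OF V]])

lemma Rep_Hz_shifted:
  assumes V: "bounded_by V M"
  shows "Rep_l2 (Hz V z x) = shifted (schroedinger V) z (Rep_l2 x)"
  by (rule ext) (simp add: Rep_Hz[OF V] shifted_def schroedinger_def algebra_simps)

lemma shift_op_symmetric: "cinner (shift_op k x) y = cinner x (shift_op (- k) y)"
proof -
  have "bij_betw (\<lambda>n. n - k) UNIV UNIV" by (rule bij_betwI[where g="\<lambda>n. n + k"]) auto
  from infsum_reindex_bij_betw[OF this, of "\<lambda>n. cnj (Rep_l2 x (n + k)) * Rep_l2 y n"]
  show ?thesis unfolding cinner_eq by simp
qed

lemma cinner_Hz:
  assumes "bounded_by V M"
  shows "cinner (Hz V z x) y = cinner x (Hz V (cnj z) y)"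
proof -
  have "cinner (mult_op (\<lambda>n. of_real (V n) - z) x) y = cinner x (mult_op (\<lambda>n. of_real (V n) - cnj z) y)"
    unfolding cinner_eq by (simp add: Rep_mult_op[OF bounded_pot_minus[OF assms]] mult_ac)
  then show ?thesis
    unfolding Hz_def by (simp add: cinner_add_left cinner_add_right shift_op_symmetric)
qed

lemma Hz_diff:
  assumes "bounded_by V M" "bounded_by V' M'"
  shows "Hz V' z' x = Hz V z x + mult_op (\<lambda>n. of_real (V' n - V n) - (z' - z)) x"
proof (rule l2_eqI)
  have "bounded_by (\<lambda>n. V' n - V n) (M + M')"
    unfolding bounded_by_def
  proof
    show "\<bar>V' n - V n\<bar> \<le> M + M'" for n
      using bounded_byD[OF assms(1), of n] bounded_byD[OF assms(2), of n] by linarith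
  qed
  note b = Rep_mult_op[OF bounded_pot_minus[OF this]]
  show "Rep_l2 (Hz V' z' x) n = Rep_l2 (Hz V z x + mult_op (\<lambda>n. of_real (V' n - V n) - (z' - z)) x) n" for n
    unfolding Rep_l2_simps b Rep_Hz[OF assms(1)] Rep_Hz[OF assms(2)] by (simp add: algebra_simps)
qed

lemma Hz_perturb:
  assumes V: "bounded_by V M" and V': "bounded_by V' M'" and inv: "boundedly_invertible (Hz V z) c"
    and d: "\<And>n. \<bar>V' n - V n\<bar> + cmod (z' - z) \<le> d" and c: "0 \<le> c" "c * d < 1"
  shows "boundedly_invertible (Hz V' z') (c / (1 - c * d))"
proof -
  have "boundedly_invertible (\<lambda>x. Hz V z x + mult_op (\<lambda>n. of_real (V' n - V n) - (z' - z)) x) (c / (1 - c * d))"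
  proof (rule boundedly_invertible_perturb[OF inv linear_mult_op])
    have "cmod (of_real (V' n - V n) - (z' - z)) \<le> d" for n
      using norm_triangle_ineq4[of "of_real (V' n - V n)" "z' - z"] d[of n] by (simp add: norm_of_real del: of_real_diff)
    then show "norm (mult_op (\<lambda>n. complex_of_real (V' n - V n) - (z' - z)) x) \<le> d * norm x" for x
      by (rule norm_mult_op_le)
    show "0 \<le> d" using d[of 0] by (smt (verit) norm_ge_zero)
  qed (use c in auto)
  then show ?thesis unfolding Hz_diff[OF V V', symmetric] .
qed

lemma norm_H_le:
  assumes V: "bounded_by V M"
  shows "norm (Hz V 0 x) \<le> (2 + M) * norm x"
proof -
  have "norm (Hz V 0 x) \<le> norm (shift_op 1 x) + norm (shift_op (-1) x) + norm (mult_op (\<lambda>n. of_real (V n) - 0) x)"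
    unfolding Hz_def by (intro norm_triangle_le add_mono order.refl)
  also have "norm (mult_op (\<lambda>n. of_real (V n) - 0) x) \<le> M * norm x"
    using bounded_byD[OF V] by (intro norm_mult_op_le) simp
  finally show ?thesis by (simp add: algebra_simps)
qed

text \<open>\<open>H\<close> has norm at most \<open>2 + M\<close>, so for large \<open>z\<close> it
  is a small perturbation of multiplication by \<open>- z\<close>.\<close>

lemma Hz_large:
  assumes V: "bounded_by V M" and z: "cmod z > 2 + M"
  shows "boundedly_invertible (Hz V z) (1 / (cmod z - (2 + M)))"
proof -
  have M: "M \<ge> 0" using bounded_byD[OF V, of 0] by linarith
  then have z0: "cmod z > 0" using z by linarith
  have A: "boundedly_invertible (mult_op (\<lambda>_. - z)) (1 / cmod z)"
    unfolding boundedly_invertible_def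
  proof (intro conjI allI linear_mult_op)
    have "mult_op (\<lambda>_. - z) (mult_op (\<lambda>_. - 1 / z) x) = x" for x
      by (rule l2_eqI) (use z0 in simp)
    then show "surj (mult_op (\<lambda>_. - z))" by (rule surjI)
    fix x
    have "norm x = norm (mult_op (\<lambda>_. - 1 / z) (mult_op (\<lambda>_. - z) x))"
      by (rule arg_cong[of _ _ norm], rule l2_eqI) (use z0 in simp)
    also have "\<dots> \<le> (1 / cmod z) * norm (mult_op (\<lambda>_. - z) x)"
      by (rule norm_mult_op_le) (simp add: norm_divide)
    finally show "norm x \<le> 1 / cmod z * norm (mult_op (\<lambda>_. - z) x)" .
  qed
  have "boundedly_invertible (\<lambda>x. mult_op (\<lambda>_. - z) x + Hz V 0 x) ((1 / cmod z) / (1 - 1 / cmod z * (2 + M)))"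
    using z z0 M by (intro boundedly_invertible_perturb A linear_Hz norm_H_le[OF V]) (auto simp: field_simps)
  also have "(\<lambda>x. mult_op (\<lambda>_. - z) x + Hz V 0 x) = Hz V z"
    by (rule ext, rule l2_eqI) (simp add: Rep_Hz[OF V] algebra_simps)
  also have "(1 / cmod z) / (1 - 1 / cmod z * (2 + M)) = 1 / (cmod z - (2 + M))"
    using z0 z by (simp add: field_simps)
  finally show ?thesis .
qed

lemma Im_cinner_Hz:
  assumes V: "bounded_by V M"
  shows "Im (cinner x (Hz V z x)) = - Im z * (norm x)\<^sup>2"
proof -
  have 1: "Hz V (cnj z) x = Hz V z x + mult_op (\<lambda>_. z - cnj z) x"
    using Hz_diff[OF V V, where z'="cnj z" and z=z and x=x] by simp
  have "cnj (cinner x (Hz V z x)) = cinner x (Hz V (cnj z) x)"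
    unfolding cinner_cnj by (rule cinner_Hz[OF V])
  also have "\<dots> = cinner x (Hz V z x) + (z - cnj z) * of_real ((norm x)\<^sup>2)"
    unfolding 1 by (simp only: cinner_add_right cinner_mult_op_const cinner_self)
  finally have "Im (cnj (cinner x (Hz V z x))) = Im (cinner x (Hz V z x) + (z - cnj z) * of_real ((norm x)\<^sup>2))"
    by (rule arg_cong)
  then show ?thesis by simp
qed

lemma norm_le_Hz_nonreal:
  assumes V: "bounded_by V M" and z: "Im z \<noteq> 0"
  shows "norm x \<le> (1 / \<bar>Im z\<bar>) * norm (Hz V z x)"
proof -
  have "\<bar>Im z\<bar> * (norm x)\<^sup>2 = \<bar>Im (cinner x (Hz V z x))\<bar>" by (simp add: Im_cinner_Hz[OF V] abs_mult)
  also have "\<dots> \<le> norm x * norm (Hz V z x)" using abs_Im_le_cmod cmod_cinner_le by (rule order.trans)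
  finally have "norm x * (\<bar>Im z\<bar> * norm x) \<le> norm x * norm (Hz V z x)" by (simp add: power2_eq_square algebra_simps)
  then have "x = 0 \<or> \<bar>Im z\<bar> * norm x \<le> norm (Hz V z x)" by (auto simp: mult_le_cancel_left)
  then show ?thesis using z by (auto simp: field_simps)
qed

text \<open>The lower bound \<open>norm_le_Hz_nonreal\<close> supplies the constant. What remains is
  surjectivity, which is transported from a point far out on the imaginary axis in the same half
  plane.\<close>

lemma Hz_nonreal:
  assumes V: "bounded_by V M" and z: "Im z \<noteq> 0"
  shows "boundedly_invertible (Hz V z) (1 / \<bar>Im z\<bar>)"
proof -
  define y where "y = \<bar>Im z\<bar>"
  have y: "y > 0" using z by (simp add: y_def)
  \<comment> \<open>\<open>Y > 2 + M\<close> puts \<open>w\<close> in the range of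
    \<open>Hz_large\<close>. Moreover \<open>(cmod (z - w))^2 = (cmod z)^2 - 2 y Y + Y^2\<close>, so
    any \<open>Y\<close> above \<open>(cmod z)^2 / (2 y)\<close> puts \<open>z\<close> inside the
    disc around \<open>w\<close> that touches the real axis.\<close>
  define Y where "Y = (cmod z)\<^sup>2 / y + 3 + M"
  define w where "w = Complex 0 (sgn (Im z) * Y)"
  have M: "M \<ge> 0" using bounded_byD[OF V, of 0] by linarith
  have "(cmod z)\<^sup>2 / y \<ge> 0" using y by simp
  then have Y: "Y > 2 + M" "Y > 0" unfolding Y_def using M by linarith+
  have cw: "cmod w = Y" "\<bar>Im w\<bar> = Y" using Y z by (auto simp: w_def cmod_def abs_mult abs_sgn_eq)
  \<comment> \<open>\<open>Hz_large\<close> contributes surjectivity; the constant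
    \<open>1 / Y\<close> is the sharper one from self-adjointness and allows steps of any length
    below \<open>Y\<close>.\<close>
  have w: "boundedly_invertible (Hz V w) (1 / Y)"
    using Hz_large[OF V, of w] norm_le_Hz_nonreal[OF V, of w] Y cw
    unfolding boundedly_invertible_def by force
  have "Re z * Re z + (Im z - sgn (Im z) * Y) * (Im z - sgn (Im z) * Y) = (cmod z)\<^sup>2 - 2 * y * Y + Y\<^sup>2"
    using z unfolding y_def cmod_power2 by (cases "Im z > 0") (auto simp: power2_eq_square algebra_simps)
  then have "(cmod (z - w))\<^sup>2 = (cmod z)\<^sup>2 - 2 * y * Y + Y\<^sup>2"
    unfolding cmod_power2[of "z - w"] by (simp add: w_def power2_eq_square)
  also have "\<dots> < Y\<^sup>2"
  proof -
    have "2 * y * Y = 2 * (cmod z)\<^sup>2 + 2 * y * (3 + M)" using y by (simp add: Y_def field_simps)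
    moreover have "0 < 2 * y * (3 + M)" using y M by simp
    ultimately show ?thesis by (smt (verit) zero_le_power2)
  qed
  finally have "cmod (z - w) < Y" using Y by (auto intro: power2_less_imp_less)
  then have "boundedly_invertible (Hz V z) ((1 / Y) / (1 - 1 / Y * cmod (z - w)))"
    using Y by (intro Hz_perturb[OF V V w]) auto
  then show ?thesis
    using norm_le_Hz_nonreal[OF V z] unfolding boundedly_invertible_def by blast
qed

definition Res :: "(int \<Rightarrow> real) \<Rightarrow> complex \<Rightarrow> l2 \<Rightarrow> l2" where
  "Res V z = inv_into UNIV (Hz V z)"

context
  fixes V :: "int \<Rightarrow> real" and z :: complex and c :: real
  assumes inv: "boundedly_invertible (Hz V z) c"
begin

lemma Hz_Res [simp]: "Hz V z (Res V z x) = x"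
  using inv unfolding Res_def boundedly_invertible_def by (simp add: surj_f_inv_f)

lemma Res_Hz [simp]: "Res V z (Hz V z x) = x"
  using boundedly_invertible_bij[OF inv] unfolding Res_def bij_def by (simp add: inv_f_f)

lemma Res_eqI: "Hz V z y = x \<Longrightarrow> Res V z x = y"
  using Res_Hz by auto

lemma norm_Res_le: "norm (Res V z x) \<le> c * norm x"
  using inv Hz_Res[of x] unfolding boundedly_invertible_def by metis

lemma Res_add: "Res V z (x + y) = Res V z x + Res V z y"
  by (rule Res_eqI) (simp add: linear_add[OF linear_Hz])

lemma Res_scaleR: "Res V z (r *\<^sub>R x) = r *\<^sub>R Res V z x"
  by (rule Res_eqI) (simp add: linear_cmul[OF linear_Hz])

end

text \<open>Bridge between the two settings: resolvent set and resolvent are defined for maps of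
  functions restricted to \<open>ell2\<close>, while all estimates are made on the type
  \<open>l2\<close>.\<close>

lemma bij_l2_conjugate:
  assumes A: "\<And>x. Rep_l2 (A x) = B (Rep_l2 x)"
  shows "bij_betw B ell2 ell2 \<longleftrightarrow> bij A" "bij A \<Longrightarrow> inv_into ell2 B (Rep_l2 x) = Rep_l2 (inv_into UNIV A x)"
proof -
  have R: "bij_betw Rep_l2 UNIV ell2"
    by (intro bij_betwI[where g=Abs_l2]) (auto simp: Abs_l2_inverse Rep_l2_inverse)
  have eq: "bij_betw (B \<circ> Rep_l2) UNIV ell2 \<longleftrightarrow> bij_betw (Rep_l2 \<circ> A) UNIV ell2"
    by (simp add: comp_def A)
  show *: "bij_betw B ell2 ell2 \<longleftrightarrow> bij A"
    using eq bij_betw_comp_iff[OF R, of B ell2] bij_betw_comp_iff2[OF R, of A UNIV] by simp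
  assume "bij A"
  show "inv_into ell2 B (Rep_l2 x) = Rep_l2 (inv_into UNIV A x)"
  proof (rule inv_into_f_eq)
    show "inj_on B ell2" using * \<open>bij A\<close> by (simp add: bij_betw_def)
    show "B (Rep_l2 (inv_into UNIV A x)) = Rep_l2 x"
      unfolding A[symmetric] using \<open>bij A\<close> by (simp add: bij_def surj_f_inv_f)
  qed simp
qed

lemma resolvent_Rep:
  assumes V: "bounded_by V M" and inv: "boundedly_invertible (Hz V z) c"
  shows "resolvent (schroedinger V) z (Rep_l2 x) = Rep_l2 (Res V z x)"
  unfolding resolvent_def Res_def
  by (rule bij_l2_conjugate(2)[of "Hz V z", OF Rep_Hz_shifted[OF V] boundedly_invertible_bij[OF inv]])

lemma resolvent_set_iff:
  assumes V: "bounded_by V M"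
  shows "z \<in> resolvent_set (schroedinger V) \<longleftrightarrow> (\<exists>c>0. boundedly_invertible (Hz V z) c)"
proof
  assume "\<exists>c>0. boundedly_invertible (Hz V z) c"
  then obtain c where c: "boundedly_invertible (Hz V z) c" by blast
  have "ell2_norm (resolvent (schroedinger V) z \<psi>) \<le> c * ell2_norm \<psi>" if "\<psi> \<in> ell2" for \<psi>
    using norm_Res_le[OF c, of "Abs_l2 \<psi>"] resolvent_Rep[OF V c, of "Abs_l2 \<psi>"] that
    by (simp add: norm_l2_ell2 Abs_l2_inverse)
  then show "z \<in> resolvent_set (schroedinger V)"
    using bij_l2_conjugate(1)[of "Hz V z", OF Rep_Hz_shifted[OF V]] boundedly_invertible_bij[OF c]
    unfolding resolvent_set_def by blast
next
  assume "z \<in> resolvent_set (schroedinger V)"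
  then obtain C where bij: "bij (Hz V z)"
    and C: "\<And>\<psi>. \<psi> \<in> ell2 \<Longrightarrow> ell2_norm (resolvent (schroedinger V) z \<psi>) \<le> C * ell2_norm \<psi>"
    using bij_l2_conjugate(1)[of "Hz V z", OF Rep_Hz_shifted[OF V]] unfolding resolvent_set_def by blast
  have *: "norm (inv_into UNIV (Hz V z) x) \<le> C * norm x" for x
    using C[of "Rep_l2 x"] bij_l2_conjugate(2)[of "Hz V z", OF Rep_Hz_shifted[OF V] bij, of x]
    by (simp add: norm_l2_ell2 resolvent_def)
  \<comment> \<open>The maximum with 1 secures the positive constant that the right side of the
    equivalence demands.\<close>
  have "norm x \<le> max C 1 * norm (Hz V z x)" for x
  proof -
    have "norm x \<le> C * norm (Hz V z x)"
      using *[of "Hz V z x"] bij by (simp add: bij_def inv_f_f)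
    also have "\<dots> \<le> max C 1 * norm (Hz V z x)" by (intro mult_right_mono) auto
    finally show ?thesis .
  qed
  then have "boundedly_invertible (Hz V z) (max C 1)"
    unfolding boundedly_invertible_def using bij linear_Hz by (auto simp: bij_def)
  then show "\<exists>c>0. boundedly_invertible (Hz V z) c" by (intro exI[of _ "max C 1"]) auto
qed

section \<open>Herglotz representation and Stieltjes inversion\<close>

lemma integrable_inverse_1_plus_square: "integrable lborel (\<lambda>x::real. 1 / (1 + x\<^sup>2))"
  and integral_inverse_1_plus_square: "(\<integral>x. 1 / (1 + x\<^sup>2) \<partial>lborel) = pi"
proof -
  have 1: "set_integrable lborel (einterval (-\<infinity>) \<infinity>) (\<lambda>x::real. inverse (1 + x\<^sup>2))"
    and 2: "(LBINT x=-\<infinity>..\<infinity>. inverse (1 + x\<^sup>2)) = pi"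
    by (rule Sinc_Integral.integrable_inverse_1_plus_square LBINT_inverse_1_plus_square)+
  have [simp]: "einterval (-\<infinity>) \<infinity> = UNIV" by (auto simp: einterval_def)
  show "integrable lborel (\<lambda>x::real. 1 / (1 + x\<^sup>2))"
    using 1 by (simp add: set_integrable_def inverse_eq_divide)
  show "(\<integral>x. 1 / (1 + x\<^sup>2) \<partial>lborel) = pi"
    using 2 by (simp add: interval_lebesgue_integral_def set_lebesgue_integral_def inverse_eq_divide)
qed

lemma integrable_decay:
  fixes f :: "real \<Rightarrow> 'a::{banach, second_countable_topology}"
  assumes "f \<in> borel_measurable lborel" "\<And>x. norm (f x) \<le> K / (1 + x\<^sup>2)"
  shows "integrable lborel f"
proof (rule Bochner_Integration.integrable_bound)
  show "integrable lborel (\<lambda>x::real. K * (1 / (1 + x\<^sup>2)))"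
    by (intro integrable_mult_right integrable_inverse_1_plus_square)
  have "norm (f x) \<le> \<bar>K\<bar> / (1 + x\<^sup>2)" for x
    using assms(2)[of x] divide_right_mono[OF abs_ge_self[of K], of "1 + x\<^sup>2"] by simp
  then show "AE x in lborel. norm (f x) \<le> norm (K * (1 / (1 + x\<^sup>2)))" by simp
qed (use assms(1) in simp)

lemma has_vector_derivative_Complex: "((\<lambda>x. Complex x e) has_vector_derivative 1) (at x)"
proof -
  have "((\<lambda>x. complex_of_real x + Complex 0 e) has_vector_derivative 1 + 0) (at x)"
    using bounded_linear.has_vector_derivative[OF bounded_linear_of_real has_vector_derivative_id]
    by (intro has_vector_derivative_add has_vector_derivative_const) (simp add: of_real_def)
  also have "(\<lambda>x. complex_of_real x + Complex 0 e) = (\<lambda>x. Complex x e)"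
    by (auto simp: complex_eq_iff)
  finally show ?thesis by simp
qed

lemma continuous_on_Complex_left [continuous_intros]: "continuous_on S (\<lambda>x. Complex x e)"
  unfolding Complex_eq by (intro continuous_intros)

lemma one_plus_cmod_sq: "1 + x\<^sup>2 \<le> (1 + cmod (Complex x e))\<^sup>2"
proof -
  have "x\<^sup>2 \<le> (cmod (Complex x e))\<^sup>2" by (simp add: cmod_power2)
  moreover have "0 \<le> cmod (Complex x e)" by simp
  ultimately show ?thesis unfolding power2_sum one_power2 by linarith
qed

section \<open>Contour shift and Poisson formula in the upper half plane\<close>

lemma tendsto_integral_symmetric_interval:
  fixes f :: "real \<Rightarrow> 'a::{banach, second_countable_topology}"
  assumes int: "integrable lborel f"
  shows "(\<lambda>n. \<integral>x. indicator {-real n..real n} x *\<^sub>R f x \<partial>lborel) \<longlonglongrightarrow> (\<integral>x. f x \<partial>lborel)"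
proof (rule integral_dominated_convergence)
  have "(\<lambda>n. indicator {-real n..real n} x *\<^sub>R f x) \<longlonglongrightarrow> f x" for x
  proof (rule tendsto_eventually)
    obtain N where N: "\<bar>x\<bar> \<le> real N" using real_arch_simple by blast
    show "\<forall>\<^sub>F n in sequentially. indicator {-real n..real n} x *\<^sub>R f x = f x"
      using eventually_ge_at_top[of N] by eventually_elim (use N in \<open>auto simp: indicator_def\<close>)
  qed
  then show "AE x in lborel. (\<lambda>n. indicator {-real n..real n} x *\<^sub>R f x) \<longlonglongrightarrow> f x" by simp
  show "integrable lborel (\<lambda>x. norm (f x))" using int by simp
  show "AE x in lborel. norm (indicator {-real n..real n} x *\<^sub>R f x) \<le> norm (f x)" for n
    by (auto simp: indicator_def)
  show "f \<in> borel_measurable lborel" using int by auto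
  then show "(\<lambda>x. indicator {-real n..real n} x *\<^sub>R f x) \<in> borel_measurable lborel" for n by measurable
qed

text \<open>
  A function that is holomorphic on a half plane has a primitive there, so its integral along
  \<open>Im w = e\<close> can be moved to the three other sides of a large rectangle.
\<close>

lemma half_plane_integral_zero:
  assumes hol: "q holomorphic_on {w. a < Im w}" and ae: "a < e"
    and K: "\<And>w. e \<le> Im w \<Longrightarrow> Im w = e \<or> R \<le> cmod w \<Longrightarrow> cmod (q w) \<le> K / (1 + cmod w)\<^sup>2"
  shows "integrable lborel (\<lambda>x. q (Complex x e))" "(\<integral>x. q (Complex x e) \<partial>lborel) = 0"
proof -
  have pos: "0 < (1 + cmod w)\<^sup>2" for w by (intro zero_less_power add_pos_nonneg) auto
  have "0 \<le> K / (1 + cmod (Complex 0 e))\<^sup>2"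
    by (rule order.trans[OF norm_ge_zero K]) auto
  then have Kpos: "K \<ge> 0" using pos by (simp only: zero_le_divide_iff) (meson not_le)
  have cont: "continuous_on UNIV (\<lambda>x. q (Complex x e))"
    by (rule continuous_on_compose2[OF holomorphic_on_imp_continuous_on[OF hol]])
       (use ae continuous_on_Complex_left in auto)
  have line: "cmod (q (Complex x e)) \<le> K / (1 + x\<^sup>2)" for x
  proof -
    have "cmod (q (Complex x e)) \<le> K / (1 + cmod (Complex x e))\<^sup>2" by (rule K) auto
    also have "\<dots> \<le> K / (1 + x\<^sup>2)"
      using Kpos one_plus_cmod_sq[of x e]
      by (intro divide_left_mono mult_pos_pos zero_less_power add_pos_nonneg) auto
    finally show ?thesis .
  qed
  show int: "integrable lborel (\<lambda>x. q (Complex x e))"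
    using borel_measurable_continuous_onI[OF cont] line by (intro integrable_decay) auto
  obtain Q where Q: "\<And>w. a < Im w \<Longrightarrow> (Q has_field_derivative q w) (at w)"
    using holomorphic_convex_primitive'[OF _ _ hol] convex_halfspace_Im_gt[of a] open_halfspace_Im_gt[of a]
    by (metis at_within_open mem_Collect_eq)
  have FTC: "(\<integral>x. indicator {-r..r} x *\<^sub>R q (Complex x e) \<partial>lborel) = Q (Complex r e) - Q (Complex (-r) e)"
    if "r \<ge> 0" for r
  proof (rule integral_FTC_Icc)
    fix x
    have "((Q \<circ> (\<lambda>x. Complex x e)) has_vector_derivative 1 * q (Complex x e)) (at x)"
      by (rule field_vector_diff_chain_at[OF has_vector_derivative_Complex Q]) (use ae in simp)
    then show "((\<lambda>x. Q (Complex x e)) has_vector_derivative q (Complex x e)) (at x within {-r..r})"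
      by (auto simp: comp_def intro: has_vector_derivative_at_within)
  qed (use that cont in \<open>auto intro: continuous_on_subset\<close>)
  \<comment> \<open>Beyond \<open>R'\<close> the left, top and right sides of the rectangle over
    \<open>{-r..r}\<close> with top at height \<open>r\<close> lie where
    \<open>cmod w \<ge> r \<ge> R\<close>; there \<open>q\<close> is at most \<open>K / r^2\<close>,
    while each side has length at most \<open>2 * r\<close>.\<close>
  define R' where "R' = max 1 (max R \<bar>e\<bar>)"
  have bd: "cmod (\<integral>x. indicator {-r..r} x *\<^sub>R q (Complex x e) \<partial>lborel) \<le> 8 * K / r" if r: "r \<ge> R'" for r
  proof -
    have r': "r \<ge> 1" "r \<ge> R" "r \<ge> \<bar>e\<bar>" using r by (auto simp: R'_def)
    have side: "cmod (Q u - Q v) \<le> 2 * K / r"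
      if S: "convex S" "\<And>w. w \<in> S \<Longrightarrow> e \<le> Im w \<and> r \<le> cmod w" "u \<in> S" "v \<in> S" "cmod (u - v) \<le> 2 * r" for S u v
    proof -
      have "cmod (Q u - Q v) \<le> (K / r\<^sup>2) * cmod (u - v)"
      proof (rule field_differentiable_bound[OF S(1) _ _ S(3,4)])
        fix w assume w: "w \<in> S"
        show "(Q has_field_derivative q w) (at w within S)"
          using Q[of w] S(2)[OF w] ae by (auto intro: has_field_derivative_at_within)
        have "cmod (q w) \<le> K / (1 + cmod w)\<^sup>2" using S(2)[OF w] r' by (intro K) auto
        also have "\<dots> \<le> K / r\<^sup>2"
          using S(2)[OF w] r' Kpos by (intro divide_left_mono power_mono) (auto intro!: mult_pos_pos)
        finally show "cmod (q w) \<le> K / r\<^sup>2" .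
      qed
      also have "\<dots> \<le> (K / r\<^sup>2) * (2 * r)" using S(5) Kpos by (intro mult_left_mono) auto
      also have "\<dots> = 2 * K / r" using r' by (simp add: power2_eq_square)
      finally show ?thesis .
    qed
    have "convex {w. Re w = x \<and> e \<le> Im w}" for x
      using convex_Int[OF convex_hyperplane[of "1::complex" x] convex_halfspace_Im_ge[of e]]
      by (simp add: inner_complex_def Int_def conj_commute)
    note cv1 = this
    have cv2: "convex {w. Im w = r}"
      using convex_hyperplane[of "\<i>" r] by (simp add: inner_complex_def)
    have len: "cmod (Complex x y - Complex x' y') \<le> \<bar>x - x'\<bar> + \<bar>y - y'\<bar>" for x y x' y'
      using cmod_le[of "Complex x y - Complex x' y'"] by simp
    have "cmod (Q (Complex r e) - Q (Complex r r)) \<le> 2 * K / r"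
    proof (rule side[OF cv1[of r]])
      show "e \<le> Im w \<and> r \<le> cmod w" if "w \<in> {w. Re w = r \<and> e \<le> Im w}" for w
        using that abs_Re_le_cmod[of w] r' by auto
      show "cmod (Complex r e - Complex r r) \<le> 2 * r" using len[of r e r r] r' by linarith
    qed (use r' in auto)
    moreover have "cmod (Q (Complex r r) - Q (Complex (-r) r)) \<le> 2 * K / r"
    proof (rule side[OF cv2])
      show "e \<le> Im w \<and> r \<le> cmod w" if "w \<in> {w. Im w = r}" for w
        using that abs_Im_le_cmod[of w] r' by auto
      show "cmod (Complex r r - Complex (-r) r) \<le> 2 * r" using len[of r r "-r" r] r' by linarith
    qed auto
    moreover have "cmod (Q (Complex (-r) r) - Q (Complex (-r) e)) \<le> 2 * K / r"
    proof (rule side[OF cv1[of "-r"]])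
      show "e \<le> Im w \<and> r \<le> cmod w" if "w \<in> {w. Re w = - r \<and> e \<le> Im w}" for w
        using that abs_Re_le_cmod[of w] r' by auto
      show "cmod (Complex (-r) r - Complex (-r) e) \<le> 2 * r" using len[of "-r" r "-r" e] r' by linarith
    qed (use r' in auto)
    moreover have "Q (Complex r e) - Q (Complex (-r) e) = (Q (Complex r e) - Q (Complex r r)) +
        (Q (Complex r r) - Q (Complex (-r) r)) + (Q (Complex (-r) r) - Q (Complex (-r) e))" by simp
    ultimately have "cmod (Q (Complex r e) - Q (Complex (-r) e)) \<le> 2 * K / r + 2 * K / r + 2 * K / r"
      by (metis (no_types, lifting) norm_triangle_mono)
    also have "\<dots> \<le> 8 * K / r" using Kpos r' by (simp add: field_simps)
    finally show ?thesis using FTC[of r] r' by simp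
  qed
  note lim = tendsto_integral_symmetric_interval[OF int]
  have "(\<lambda>n. \<integral>x. indicator {-real n..real n} x *\<^sub>R q (Complex x e) \<partial>lborel) \<longlonglongrightarrow> 0"
  proof (rule Lim_null_comparison)
    show "(\<lambda>n. 8 * K / real n) \<longlonglongrightarrow> 0" by (rule lim_const_over_n)
    obtain N where N: "R' \<le> real N" using real_arch_simple by blast
    show "\<forall>\<^sub>F n in sequentially. norm (\<integral>x. indicator {-real n..real n} x *\<^sub>R q (Complex x e) \<partial>lborel) \<le> 8 * K / real n"
      using eventually_ge_at_top[of N] by eventually_elim (use N in \<open>auto intro!: bd\<close>)
  qed
  with lim show "(\<integral>x. q (Complex x e) \<partial>lborel) = 0" by (rule LIMSEQ_unique)
qed

lemma integral_Lorentz: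
  assumes "0 < y"
  shows "integrable lborel (\<lambda>x. y / ((x - s)\<^sup>2 + y\<^sup>2))" "(\<integral>x. y / ((x - s)\<^sup>2 + y\<^sup>2) \<partial>lborel) = pi"
proof -
  have eq: "(1 / y) * (1 / (1 + (- s / y + (1 / y) * x)\<^sup>2)) = y / ((x - s)\<^sup>2 + y\<^sup>2)" for x
  proof -
    have "- s / y + (1 / y) * x = (x - s) / y" by (simp add: diff_divide_distrib)
    then have "(1 / y) * (1 / (1 + (- s / y + (1 / y) * x)\<^sup>2)) = 1 / (y * (1 + (x - s)\<^sup>2 / y\<^sup>2))"
      by (simp add: power_divide)
    also have "y * (1 + (x - s)\<^sup>2 / y\<^sup>2) = ((x - s)\<^sup>2 + y\<^sup>2) / y"
      using assms by (simp add: field_simps power2_eq_square)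
    finally show ?thesis by simp
  qed
  show "integrable lborel (\<lambda>x. y / ((x - s)\<^sup>2 + y\<^sup>2))"
    unfolding eq[symmetric] using assms
    by (intro integrable_mult_right lborel_integrable_real_affine integrable_inverse_1_plus_square) auto
  have "pi = (1 / y) * (\<integral>x. 1 / (1 + (- s / y + (1 / y) * x)\<^sup>2) \<partial>lborel)"
    using lborel_integral_real_affine[of "1 / y" "\<lambda>x. 1 / (1 + x\<^sup>2)" "- s / y"] assms
    by (simp add: integral_inverse_1_plus_square)
  also have "\<dots> = (\<integral>x. y / ((x - s)\<^sup>2 + y\<^sup>2) \<partial>lborel)"
    unfolding eq[symmetric] by (rule integral_mult_right_zero[symmetric])
  finally show "(\<integral>x. y / ((x - s)\<^sup>2 + y\<^sup>2) \<partial>lborel) = pi" by simp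
qed

text \<open>Turns the distance to a pole into decay in \<open>1 + cmod w\<close>; two decaying
  factors then produce the quadratic decay that the contour shift asks for.\<close>

lemma inverse_dist_le:
  assumes "0 < d" "d \<le> cmod (w - c)"
  shows "1 / cmod (w - c) \<le> (1 + (1 + cmod c) / d) / (1 + cmod w)"
proof -
  have "1 + cmod w \<le> (1 + cmod c) + cmod (w - c)" using norm_triangle_sub[of w c] by simp
  also have "1 + cmod c \<le> (1 + cmod c) * (cmod (w - c) / d)"
    using assms mult_left_mono[of 1 "cmod (w - c) / d" "1 + cmod c"] by simp
  finally have "1 + cmod w \<le> (1 + (1 + cmod c) / d) * cmod (w - c)" by (simp add: algebra_simps)
  moreover have "0 < cmod (w - c)" using assms by linarith
  ultimately show ?thesis by (simp add: field_simps add_pos_nonneg)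
qed

text \<open>On the line \<open>Im w = e\<close> the factors \<open>x - z\<close> and
  \<open>x - cnj z\<close> are \<open>w - \<zeta>\<close> and \<open>w - \<zeta>'\<close>, with
  \<open>\<zeta>\<close> above and \<open>\<zeta>'\<close> below the line. Hence
  \<open>F / (w - \<zeta>)\<close> integrates to the residue \<open>2 pi i F \<zeta>\<close> and
  \<open>F / (w - \<zeta>')\<close> to 0; conjugating the latter removes \<open>cnj F\<close> from
  \<open>Im F = (F - cnj F) / (2 i)\<close>.\<close>

lemma poisson_half_plane:
  assumes hol: "F holomorphic_on {w. 0 < Im w}" and e: "0 < e" and z: "0 < Im z"
    and C: "\<And>w. e \<le> Im w \<Longrightarrow> cmod (F w) \<le> C / (1 + cmod w)"
  shows "(\<integral>x. of_real (Im (F (Complex x e)) / pi) / (of_real x - z) \<partial>lborel) = F (z + Complex 0 e)"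
proof -
  define y where "y = Im z"
  define \<zeta> where "\<zeta> = z + Complex 0 e"
  define \<zeta>' where "\<zeta>' = cnj z + Complex 0 e"
  have y: "0 < y" and Im\<zeta>: "Im \<zeta> = e + y" "Im \<zeta>' = e - y" "0 < Im \<zeta>"
    using z e by (auto simp: y_def \<zeta>_def \<zeta>'_def)
  have "0 \<le> C / (1 + cmod (Complex 0 e))"
    by (rule order.trans[OF norm_ge_zero C]) auto
  moreover have "0 < 1 + cmod (Complex 0 e)" by (intro add_pos_nonneg) auto
  ultimately have Cpos: "C \<ge> 0" by (simp only: zero_le_divide_iff) (meson not_le)
  \<comment> \<open>\<open>d\<close> bounds from below the distance of \<open>\<zeta>\<close> from
    the line, of \<open>\<zeta>'\<close> from the half plane above the line and, through the 1, of
    \<open>\<zeta>\<close> from all \<open>w\<close> with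
    \<open>cmod w \<ge> cmod \<zeta> + 1\<close>.\<close>
  define d where "d = min 1 y"
  have d: "0 < d" "d \<le> 1" "d \<le> y" using y by (auto simp: d_def)
  define L where "L = 1 + (1 + cmod \<zeta>) / d"
  define L' where "L' = 1 + (1 + cmod \<zeta>') / d"
  have L: "0 \<le> L" "0 \<le> L'" using d by (auto simp: L_def L'_def)
  \<comment> \<open>The half plane above \<open>a\<close> contains the line, excludes
    \<open>\<zeta>'\<close> and stays inside the domain of \<open>F\<close>.\<close>
  define a where "a = max 0 (e - y)"
  have a: "0 \<le> a" "a < e" "e - y \<le> a" using e y by (auto simp: a_def)
  have hola: "F holomorphic_on {w. a < Im w}" using hol a by (rule_tac holomorphic_on_subset) auto
  have far': "d \<le> cmod (w - \<zeta>')" if "e \<le> Im w" for w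
    using abs_Im_le_cmod[of "w - \<zeta>'"] that Im\<zeta> d by simp
  have x\<zeta>: "Complex x e - \<zeta> = of_real x - z" "Complex x e - \<zeta>' = of_real x - cnj z" for x
    by (auto simp: \<zeta>_def \<zeta>'_def complex_eq_iff)
  have bd1: "cmod (F w / (w - \<zeta>')) \<le> (C * L') / (1 + cmod w)\<^sup>2" if "e \<le> Im w" for w
  proof -
    have "cmod (F w / (w - \<zeta>')) = cmod (F w) * (1 / cmod (w - \<zeta>'))" by (simp add: norm_divide)
    also have "\<dots> \<le> (C / (1 + cmod w)) * (L' / (1 + cmod w))"
      unfolding L'_def using d(1) far'[OF that] C[OF that] by (intro mult_mono inverse_dist_le) (auto simp: Cpos)
    finally show ?thesis by (simp add: power2_eq_square)
  qed
  have hol1: "(\<lambda>w. F w / (w - \<zeta>')) holomorphic_on {w. a < Im w}"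
  proof (intro holomorphic_intros hola)
    show "w - \<zeta>' \<noteq> 0" if "w \<in> {w. a < Im w}" for w
    proof
      assume "w - \<zeta>' = 0"
      then show False using that a(3) Im\<zeta>(2) by simp
    qed
  qed
  have J1: "integrable lborel (\<lambda>x. F (Complex x e) / (of_real x - cnj z))"
      "(\<integral>x. F (Complex x e) / (of_real x - cnj z) \<partial>lborel) = 0"
    by (rule half_plane_integral_zero[OF hol1 a(2), of 0, unfolded x\<zeta>], rule bd1, assumption)+
  have frac: "(a / u) * (b / u) = a * b / u\<^sup>2" for a b u :: real by (simp add: power2_eq_square)
  \<comment> \<open>The residue is split off algebraically. The difference quotient
    \<open>h\<close>, with its removable singularity filled in, decays only like
    \<open>1 / w\<close>; adding \<open>F \<zeta> / (w - \<zeta>')\<close> cancels the leading term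
    and restores quadratic decay.\<close>
  define h where "h w = (if w = \<zeta> then deriv F \<zeta> else (F w - F \<zeta>) / (w - \<zeta>))" for w
  define q where "q w = h w + F \<zeta> / (w - \<zeta>')" for w
  have hq: "q holomorphic_on {w. a < Im w}"
    unfolding q_def h_def
  proof (intro holomorphic_intros pole_lemma_open hola open_halfspace_Im_gt)
    show "w - \<zeta>' \<noteq> 0" if "w \<in> {w. a < Im w}" for w
    proof
      assume "w - \<zeta>' = 0"
      then show False using that a(3) Im\<zeta>(2) by simp
    qed
  qed
  have qeq: "q w = F w / (w - \<zeta>) - F \<zeta> * (2 * \<i> * of_real y) * (1 / (w - \<zeta>) * (1 / (w - \<zeta>')))"
    if "d \<le> cmod (w - \<zeta>)" "e \<le> Im w" for w
  proof -
    have ne: "w - \<zeta> \<noteq> 0" "w - \<zeta>' \<noteq> 0" using that far'[OF that(2)] d by auto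
    have "\<zeta> - \<zeta>' = 2 * \<i> * of_real y" by (auto simp: \<zeta>_def \<zeta>'_def y_def complex_eq_iff)
    moreover have "1 / (w - \<zeta>) - 1 / (w - \<zeta>') = (\<zeta> - \<zeta>') * (1 / (w - \<zeta>) * (1 / (w - \<zeta>')))"
      using ne by (simp add: diff_frac_eq)
    ultimately have 1: "1 / (w - \<zeta>') - 1 / (w - \<zeta>) = - (2 * \<i> * of_real y) * (1 / (w - \<zeta>) * (1 / (w - \<zeta>')))"
      by (metis minus_diff_eq mult_minus_left)
    have "q w = F w / (w - \<zeta>) + F \<zeta> * (1 / (w - \<zeta>') - 1 / (w - \<zeta>))"
      using ne by (simp add: q_def h_def diff_divide_distrib right_diff_distrib)
    then show ?thesis unfolding 1 by simp
  qed
  have qbd: "cmod (q w) \<le> (C * L + cmod (F \<zeta>) * (2 * y) * (L * L')) / (1 + cmod w)\<^sup>2"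
    if w: "e \<le> Im w" and far: "d \<le> cmod (w - \<zeta>)" for w
  proof -
    have i: "1 / cmod (w - \<zeta>) \<le> L / (1 + cmod w)" "1 / cmod (w - \<zeta>') \<le> L' / (1 + cmod w)"
      unfolding L_def L'_def using d(1) far far'[OF w] by (auto intro: inverse_dist_le)
    have "cmod (q w) \<le> cmod (F w) * (1 / cmod (w - \<zeta>)) +
        cmod (F \<zeta>) * (2 * y) * (1 / cmod (w - \<zeta>) * (1 / cmod (w - \<zeta>')))"
      unfolding qeq[OF far w] using y
      by (rule_tac order.trans[OF norm_triangle_ineq4]) (simp add: norm_mult norm_divide)
    also have "\<dots> \<le> (C / (1 + cmod w)) * (L / (1 + cmod w)) +
        cmod (F \<zeta>) * (2 * y) * (L / (1 + cmod w) * (L' / (1 + cmod w)))"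
      using i C[OF w] L Cpos y by (intro add_mono mult_mono) auto
    finally show ?thesis unfolding frac unfolding times_divide_eq_right add_divide_distrib[symmetric] .
  qed
  have far: "d \<le> cmod (w - \<zeta>)" if "e \<le> Im w" "Im w = e \<or> cmod \<zeta> + 1 \<le> cmod w" for w
    using that(2)
  proof
    assume "Im w = e"
    then show ?thesis using abs_Im_le_cmod[of "w - \<zeta>"] Im\<zeta> d by simp
  next
    assume "cmod \<zeta> + 1 \<le> cmod w"
    then show ?thesis using norm_triangle_ineq2[of w \<zeta>] d by linarith
  qed
  have J2: "integrable lborel (\<lambda>x. q (Complex x e))" "(\<integral>x. q (Complex x e) \<partial>lborel) = 0"
    by (rule half_plane_integral_zero[OF hq a(2), of "cmod \<zeta> + 1"], rule qbd, assumption, rule far, assumption+)+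
  have lor: "1 / (of_real x - z) * (1 / (of_real x - cnj z)) * of_real y = of_real (y / ((x - Re z)\<^sup>2 + y\<^sup>2))" for x
  proof -
    have "(of_real x - z) * (of_real x - cnj z) = (of_real x - z) * cnj (of_real x - z)" by simp
    also have "\<dots> = of_real ((x - Re z)\<^sup>2 + y\<^sup>2)"
      unfolding complex_mult_cnj by (simp add: y_def)
    finally have "1 / (of_real x - z) * (1 / (of_real x - cnj z)) = 1 / of_real ((x - Re z)\<^sup>2 + y\<^sup>2)"
      by (simp add: times_divide_times_eq del: of_real_add of_real_power)
    then show ?thesis by simp
  qed
  \<comment> \<open>What separates \<open>F / (w - \<zeta>)\<close> from \<open>q\<close> is a
    multiple of the Lorentz kernel, whose integral is pi.\<close>
  have qline: "F (Complex x e) / (of_real x - z) =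
      q (Complex x e) + F \<zeta> * 2 * \<i> * of_real (y / ((x - Re z)\<^sup>2 + y\<^sup>2))" for x
  proof -
    have "q (Complex x e) = F (Complex x e) / (of_real x - z)
        - F \<zeta> * 2 * \<i> * (1 / (of_real x - z) * (1 / (of_real x - cnj z)) * of_real y)"
      using qeq[OF far, of "Complex x e"] by (simp add: x\<zeta>)
    then show ?thesis unfolding lor by simp
  qed
  have J3: "integrable lborel (\<lambda>x. F (Complex x e) / (of_real x - z))"
      "(\<integral>x. F (Complex x e) / (of_real x - z) \<partial>lborel) = 2 * \<i> * pi * F \<zeta>"
  proof -
    define lo where "lo x = complex_of_real (y / ((x - Re z)\<^sup>2 + y\<^sup>2))" for x
    have io: "integrable lborel lo"
      unfolding lo_def using integral_Lorentz(1)[OF y, of "Re z"] by (rule integrable_of_real)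
    have "(\<integral>x. lo x \<partial>lborel) = of_real pi"
      unfolding lo_def by (subst integral_of_real[OF integral_Lorentz(1)[OF y]]) (simp add: integral_Lorentz(2)[OF y])
    then show "integrable lborel (\<lambda>x. F (Complex x e) / (of_real x - z))"
        "(\<integral>x. F (Complex x e) / (of_real x - z) \<partial>lborel) = 2 * \<i> * pi * F \<zeta>"
      unfolding qline lo_def[symmetric]
      using Bochner_Integration.integrable_add[OF J2(1) integrable_mult_right[OF io, of "F \<zeta> * 2 * \<i>"]]
        Bochner_Integration.integral_add[OF J2(1) integrable_mult_right[OF io, of "F \<zeta> * 2 * \<i>"]]
      by (simp_all add: J2(2) mult_ac)
  qed
  have J1': "integrable lborel (\<lambda>x. cnj (F (Complex x e)) / (of_real x - z))"
      "(\<integral>x. cnj (F (Complex x e)) / (of_real x - z) \<partial>lborel) = 0"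
  proof -
    have eq: "cnj (F (Complex x e)) / (of_real x - z) = cnj (F (Complex x e) / (of_real x - cnj z))" for x
      by simp
    show "integrable lborel (\<lambda>x. cnj (F (Complex x e)) / (of_real x - z))"
      unfolding eq by (rule integrable_cnj[OF J1(1)])
    show "(\<integral>x. cnj (F (Complex x e)) / (of_real x - z) \<partial>lborel) = 0"
      using Bochner_Integration.integral_cnj[of lborel "\<lambda>x. F (Complex x e) / (of_real x - cnj z)"] J1(2) by simp
  qed
  have "of_real (Im (F (Complex x e)) / pi) / (of_real x - z) =
      (1 / (2 * \<i> * pi)) * (F (Complex x e) / (of_real x - z) - cnj (F (Complex x e)) / (of_real x - z))" for x
  proof -
    have "F (Complex x e) - cnj (F (Complex x e)) = 2 * \<i> * of_real (Im (F (Complex x e)))"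
      by (simp add: complex_eq_iff)
    then show ?thesis unfolding diff_divide_distrib[symmetric] by simp
  qed
  then have "(\<integral>x. of_real (Im (F (Complex x e)) / pi) / (of_real x - z) \<partial>lborel) =
      (1 / (2 * \<i> * pi)) * (2 * \<i> * pi * F \<zeta> - 0)"
    using J3 J1' by (simp add: Bochner_Integration.integral_diff)
  also have "\<dots> = F \<zeta>" by simp
  finally show ?thesis unfolding \<zeta>_def .
qed

definition cauchy_transform :: "real measure \<Rightarrow> complex \<Rightarrow> complex" where
  "cauchy_transform \<mu> z = (\<integral>x. 1 / (complex_of_real x - z) \<partial>\<mu>)"

lemma norm_cauchy_kernel_le: "Im z \<noteq> 0 \<Longrightarrow> cmod (1 / (complex_of_real x - z)) \<le> 1 / \<bar>Im z\<bar>"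
  using abs_Im_le_cmod[of "complex_of_real x - z"] by (simp add: norm_divide frac_le)

lemma Im_cauchy_kernel: "Im (1 / (complex_of_real x - Complex s e)) = e / ((x - s)\<^sup>2 + e\<^sup>2)"
  by (simp add: Im_divide)

lemma integrable_cauchy_kernel:
  assumes "finite_measure \<mu>" and [measurable_cong]: "sets \<mu> = sets borel" and "Im z \<noteq> 0"
  shows "integrable \<mu> (\<lambda>x. 1 / (complex_of_real x - z))"
proof -
  interpret finite_measure \<mu> by fact
  show ?thesis
    by (rule integrable_const_bound[of _ "1 / \<bar>Im z\<bar>"]) (use norm_cauchy_kernel_le[OF assms(3)] in auto)
qed

lemma Im_cauchy_transform:
  assumes "finite_measure \<mu>" "sets \<mu> = sets borel" "0 < e"
  shows "Im (cauchy_transform \<mu> (Complex s e)) = (\<integral>x. e / ((x - s)\<^sup>2 + e\<^sup>2) \<partial>\<mu>)"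
proof -
  have "Im (cauchy_transform \<mu> (Complex s e)) = (\<integral>x. Im (1 / (complex_of_real x - Complex s e)) \<partial>\<mu>)"
    unfolding cauchy_transform_def using integrable_cauchy_kernel[OF assms(1,2), of "Complex s e"] assms(3)
    by (subst integral_Im) auto
  then show ?thesis unfolding Im_cauchy_kernel .
qed

text \<open>The probability densities \<open>Im F (x + i e) / pi\<close> represent
  \<open>F (z + i e)\<close> by the Poisson formula, and a weak limit along some \<open>e\<close>
  tending to 0 represents \<open>F\<close>. Condition \<open>C\<close> serves the Poisson formula,
  \<open>D\<close> bounds the tails uniformly in \<open>e\<close> and gives tightness,
  \<open>mass\<close> fixes the total mass.\<close>

theorem herglotz_representation:
  assumes hol: "F holomorphic_on {w. 0 < Im w}"
    and nonneg: "\<And>w. 0 < Im w \<Longrightarrow> 0 \<le> Im (F w)"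
    and C: "\<And>e. 0 < e \<Longrightarrow> \<exists>C\<ge>0. \<forall>w. e \<le> Im w \<longrightarrow> cmod (F w) \<le> C / (1 + cmod w)"
    and D: "\<And>x e. 0 < e \<Longrightarrow> e \<le> 1 \<Longrightarrow> R \<le> \<bar>x\<bar> \<Longrightarrow> Im (F (Complex x e)) \<le> D / (1 + x\<^sup>2)"
    and mass: "((\<lambda>y. of_real y * F (Complex 0 y)) \<longlongrightarrow> \<i>) at_top"
  shows "\<exists>\<mu>. real_distribution \<mu> \<and> (\<forall>z. 0 < Im z \<longrightarrow> F z = cauchy_transform \<mu> z)"
proof -
  define u where "u e x = Im (F (Complex x e)) / pi" for e x
  have u0: "0 \<le> u e x" if "0 < e" for e x using nonneg[of "Complex x e"] that by (simp add: u_def)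
  have contF: "continuous_on {w. 0 < Im w} F" by (rule holomorphic_on_imp_continuous_on[OF hol])
  have um: "u e \<in> borel_measurable borel" if "0 < e" for e
  proof -
    have "continuous_on UNIV (\<lambda>x. F (Complex x e))"
      by (rule continuous_on_compose2[OF contF continuous_on_Complex_left]) (use that in auto)
    then have "continuous_on UNIV (u e)" unfolding u_def by (intro continuous_intros) auto
    then show ?thesis by (rule borel_measurable_continuous_onI)
  qed
  define g where "g x = \<bar>D\<bar> / (1 + x\<^sup>2)" for x :: real
  have p: "0 < 1 + x\<^sup>2" for x :: real by (simp add: add_pos_nonneg)
  have uD: "u e x \<le> g x" if "0 < e" "e \<le> 1" "R \<le> \<bar>x\<bar>" for e x
  proof -
    have "u e x \<le> Im (F (Complex x e)) / 1"
      unfolding u_def using nonneg[of "Complex x e"] that pi_ge_two by (intro divide_left_mono) auto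
    also have "\<dots> = Im (F (Complex x e))" by simp
    also have "\<dots> \<le> D / (1 + x\<^sup>2)" using that by (rule D)
    also have "\<dots> \<le> g x" unfolding g_def using p[of x] by (intro divide_right_mono) auto
    finally show ?thesis .
  qed
  have gint: "integrable lborel g"
    unfolding g_def using integrable_mult_right[OF integrable_inverse_1_plus_square, of "\<bar>D\<bar>"] by simp
  have uint: "integrable lborel (u e)" if e: "0 < e" "e \<le> 1" for e
  proof -
    obtain C where C: "C \<ge> 0" "\<And>w. e \<le> Im w \<Longrightarrow> cmod (F w) \<le> C / (1 + cmod w)"
      using assms(3)[OF e(1)] by blast
    have "norm (u e x) \<le> (\<bar>D\<bar> + C * (1 + R\<^sup>2)) / (1 + x\<^sup>2)" for x
    proof (cases "R \<le> \<bar>x\<bar>")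
      case True
      have "u e x \<le> \<bar>D\<bar> / (1 + x\<^sup>2)" using uD[OF e True] by (simp add: g_def)
      also have "\<dots> \<le> (\<bar>D\<bar> + C * (1 + R\<^sup>2)) / (1 + x\<^sup>2)"
        using p[of x] C(1) by (intro divide_right_mono) auto
      finally show ?thesis using u0[OF e(1), of x] by simp
    next
      case False
      have "u e x \<le> cmod (F (Complex x e))"
      proof -
        have "u e x \<le> cmod (F (Complex x e)) / 1"
          unfolding u_def using pi_ge_two by (intro frac_le abs_le_D1[OF abs_Im_le_cmod]) auto
        then show ?thesis by simp
      qed
      also have "\<dots> \<le> C / (1 + cmod (Complex x e))" by (rule C) simp
      also have "\<dots> \<le> C / 1" using C(1) by (intro divide_left_mono) (auto intro: add_pos_nonneg)
      also have "C / 1 = C * (1 + x\<^sup>2) / (1 + x\<^sup>2)" using p[of x] by simp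
      also have "\<dots> \<le> (\<bar>D\<bar> + C * (1 + R\<^sup>2)) / (1 + x\<^sup>2)"
      proof (rule divide_right_mono)
        have "x\<^sup>2 \<le> R\<^sup>2" using False by (intro power2_le_iff_abs_le[THEN iffD2]) auto
        then have "C * (1 + x\<^sup>2) \<le> C * (1 + R\<^sup>2)" using C(1) by (intro mult_left_mono) auto
        then show "C * (1 + x\<^sup>2) \<le> \<bar>D\<bar> + C * (1 + R\<^sup>2)" by linarith
      qed (use p[of x] in simp)
      finally show ?thesis using u0[OF e(1), of x] by simp
    qed
    then show ?thesis using um[OF e(1)] by (intro integrable_decay) auto
  qed
  have poisson: "(\<integral>x. of_real (u e x) / (of_real x - z) \<partial>lborel) = F (z + Complex 0 e)"
    if e: "0 < e" and z: "0 < Im z" for e z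
  proof -
    obtain C where "\<And>w. e \<le> Im w \<Longrightarrow> cmod (F w) \<le> C / (1 + cmod w)"
      using assms(3)[OF e(1)] by blast
    from poisson_half_plane[OF hol e z this] show ?thesis unfolding u_def .
  qed
  have umass: "(\<integral>x. u e x \<partial>lborel) = 1" if e: "0 < e" "e \<le> 1" for e
  proof -
    \<comment> \<open>The kernel of the Poisson formula at \<open>z = i n\<close>, rescaled so that
      it tends to 1 and is bounded by 1: dominated convergence turns the asymptotics in
      \<open>mass\<close> into total mass 1.\<close>
    define k where "k n x = - (\<i> * of_nat n) / (complex_of_real x - Complex 0 (real n))" for n :: nat and x :: real
    have "(\<lambda>n. \<integral>x. of_real (u e x) * k n x \<partial>lborel) \<longlonglongrightarrow> (\<integral>x. complex_of_real (u e x) \<partial>lborel)"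
    proof (rule integral_dominated_convergence[where w="u e"])
      show "integrable lborel (u e)" by (rule uint[OF e])
      note [measurable] = um[OF e(1)]
      show "(\<lambda>x. complex_of_real (u e x)) \<in> borel_measurable lborel" by measurable
      show "(\<lambda>x. of_real (u e x) * k n x) \<in> borel_measurable lborel" for n unfolding k_def by measurable
      have "(\<lambda>n. k n x) \<longlonglongrightarrow> 1" for x
      proof -
        have k: "k n x = 1 / (1 + \<i> * (of_real x / of_nat n))" if "n > 0" for n
        proof -
          have "complex_of_real x - Complex 0 (real n) = - (\<i> * of_nat n) * (1 + \<i> * (of_real x / of_nat n))"
            using that by (simp add: complex_eq_iff field_simps)
          then show ?thesis unfolding k_def using that by simp
        qed
        have "(\<lambda>n. 1 / (1 + \<i> * (complex_of_real x / of_nat n))) \<longlonglongrightarrow> 1 / (1 + \<i> * 0)"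
          by (intro tendsto_intros lim_const_over_n) auto
        moreover have "\<forall>\<^sub>F n in sequentially. 1 / (1 + \<i> * (complex_of_real x / of_nat n)) = k n x"
          using eventually_gt_at_top[of 0] by eventually_elim (simp add: k)
        ultimately have "(\<lambda>n. k n x) \<longlonglongrightarrow> 1 / (1 + \<i> * 0)" by (rule Lim_transform_eventually)
        then show ?thesis by simp
      qed
      then have "(\<lambda>n. of_real (u e x) * k n x) \<longlonglongrightarrow> of_real (u e x) * 1" for x
        by (intro tendsto_intros)
      then show "AE x in lborel. (\<lambda>n. of_real (u e x) * k n x) \<longlonglongrightarrow> complex_of_real (u e x)" by simp
      have "cmod (k n x) \<le> 1" for n x
      proof (cases "n = 0")
        case False
        then have "cmod (1 / (complex_of_real x - Complex 0 (real n))) \<le> 1 / real n"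
          using norm_cauchy_kernel_le[of "Complex 0 (real n)" x] by simp
        then have "real n * cmod (1 / (complex_of_real x - Complex 0 (real n))) \<le> real n * (1 / real n)"
          by (rule mult_left_mono) simp
        then show ?thesis using False by (simp add: k_def norm_divide norm_mult)
      qed (simp add: k_def)
      then show "AE x in lborel. norm (of_real (u e x) * k n x) \<le> u e x" for n
        using u0[OF e(1)] by (auto simp: norm_mult mult_left_le)
    qed
    moreover have "(\<lambda>n. \<integral>x. of_real (u e x) * k n x \<partial>lborel) \<longlonglongrightarrow> 1"
    proof -
      have eq: "(\<integral>x. of_real (u e x) * k n x \<partial>lborel) = - (\<i> * of_nat n) * F (Complex 0 (real n + e))" if "n > 0" for n
      proof -
        have "(\<integral>x. of_real (u e x) * k n x \<partial>lborel) =
            (\<integral>x. - (\<i> * of_nat n) * (of_real (u e x) / (of_real x - Complex 0 (real n))) \<partial>lborel)"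
          unfolding k_def by (intro Bochner_Integration.integral_cong) auto
        also have "\<dots> = - (\<i> * of_nat n) * F (Complex 0 (real n) + Complex 0 e)"
          using poisson[OF e(1), of "Complex 0 (real n)"] that by (subst integral_mult_right_zero) simp
        also have "Complex 0 (real n) + Complex 0 e = Complex 0 (real n + e)" by (simp add: complex_eq_iff)
        finally show ?thesis .
      qed
      have "filterlim (\<lambda>n. real n + e) at_top sequentially"
        by (rule filterlim_tendsto_add_at_top[OF tendsto_const filterlim_real_sequentially, of e, unfolded add.commute[of e]])
      from filterlim_compose[OF mass this]
      have "(\<lambda>n. of_real (real n + e) * F (Complex 0 (real n + e))) \<longlonglongrightarrow> \<i>" .
      moreover have "(\<lambda>n. - \<i> / (1 + of_real e / of_nat n)) \<longlonglongrightarrow> - \<i> / (1 + 0)"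
        by (intro tendsto_intros lim_const_over_n) auto
      ultimately have "(\<lambda>n. - \<i> / (1 + of_real e / of_nat n) * (of_real (real n + e) * F (Complex 0 (real n + e))))
          \<longlonglongrightarrow> - \<i> / (1 + 0) * \<i>" by (intro tendsto_mult)
      note lim = this
      have eq': "- \<i> / (1 + of_real e / of_nat n) * (of_real (real n + e) * F (Complex 0 (real n + e))) =
          (\<integral>x. of_real (u e x) * k n x \<partial>lborel)" if "n > 0" for n
      proof -
        have "real n + e > 0" using e by (simp add: add_nonneg_pos)
        then have "complex_of_real (real n + e) \<noteq> 0" unfolding of_real_eq_0_iff by linarith
        then have ne: "of_nat n + complex_of_real e \<noteq> 0" by simp
        have "- \<i> / (1 + complex_of_real e / of_nat n) * of_real (real n + e) = - (\<i> * of_nat n)"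
          using that ne by (simp add: field_simps)
        then show ?thesis unfolding eq[OF that] by (metis mult.assoc)
      qed
      have "\<forall>\<^sub>F n in sequentially. - \<i> / (1 + of_real e / of_nat n) *
          (of_real (real n + e) * F (Complex 0 (real n + e))) = (\<integral>x. of_real (u e x) * k n x \<partial>lborel)"
        using eventually_gt_at_top[of 0] by eventually_elim (rule eq')
      from Lim_transform_eventually[OF lim this] show ?thesis by simp
    qed
    ultimately have "(\<integral>x. complex_of_real (u e x) \<partial>lborel) = 1" by (rule LIMSEQ_unique)
    then have "complex_of_real (\<integral>x. u e x \<partial>lborel) = of_real 1"
      using integral_of_real[OF uint[OF e], where ?'a = complex] by simp
    then show ?thesis unfolding of_real_eq_iff .
  qed
  define \<epsilon> where "\<epsilon> n = inverse (real (Suc n))" for n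
  have \<epsilon>: "0 < \<epsilon> n" "\<epsilon> n \<le> 1" for n by (auto simp: \<epsilon>_def inverse_le_1_iff)
  have \<epsilon>lim: "\<epsilon> \<longlonglongrightarrow> 0" unfolding \<epsilon>_def by (rule LIMSEQ_inverse_real_of_nat)
  define \<mu> where "\<mu> n = density lborel (\<lambda>x. ennreal (u (\<epsilon> n) x))" for n
  have um': "(\<lambda>x. u (\<epsilon> n) x) \<in> borel_measurable lborel" for n using um[OF \<epsilon>(1)] by simp
  have rd: "real_distribution (\<mu> n)" for n
  proof (unfold real_distribution_def real_distribution_axioms_def, intro conjI)
    show "prob_space (\<mu> n)"
    proof
      have "emeasure (\<mu> n) (space (\<mu> n)) = (\<integral>\<^sup>+x. ennreal (u (\<epsilon> n) x) \<partial>lborel)"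
        unfolding \<mu>_def using um' by (subst emeasure_density) auto
      also have "\<dots> = 1"
        using nn_integral_eq_integral[OF uint[OF \<epsilon>]] u0[OF \<epsilon>(1)] umass[OF \<epsilon>] by simp
      finally show "emeasure (\<mu> n) (space (\<mu> n)) = 1" .
    qed
    show "sets (\<mu> n) = sets borel" by (simp add: \<mu>_def)
  qed
  have int\<mu>: "integral\<^sup>L (\<mu> n) f = (\<integral>x. u (\<epsilon> n) x *\<^sub>R f x \<partial>lborel)"
    if "f \<in> borel_measurable lborel" for f :: "real \<Rightarrow> 'b::{banach, second_countable_topology}" and n
    unfolding \<mu>_def using um' u0[OF \<epsilon>(1)] that by (intro integral_density) auto
  have tight: "tight \<mu>"
    unfolding tight_def
  proof (intro conjI allI impI rd)
    fix d :: real assume d: "0 < d"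
    have "(\<lambda>n. \<integral>x. indicator {-real n..real n} x *\<^sub>R g x \<partial>lborel) \<longlonglongrightarrow> (\<integral>x. g x \<partial>lborel)"
      by (rule tendsto_integral_symmetric_interval[OF gint])
    then have "\<forall>\<^sub>F n in sequentially. (\<integral>x. g x \<partial>lborel) - d < (\<integral>x. indicator {-real n..real n} x *\<^sub>R g x \<partial>lborel)"
      by (rule order_tendstoD) (use d in simp)
    moreover obtain N0 where N0: "R \<le> real N0" using real_arch_simple by blast
    ultimately obtain N where N: "N \<ge> N0" and Ng: "(\<integral>x. g x \<partial>lborel) - d < (\<integral>x. indicator {-real N..real N} x *\<^sub>R g x \<partial>lborel)"
      unfolding eventually_sequentially using nle_le[of N0] by blast
    \<comment> \<open>Outside \<open>{-N..N}\<close> every density lies below the integrable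
      \<open>g\<close>, so the missing mass is at most the tail of \<open>g\<close>. The interval is
      widened by 1 because tightness speaks of intervals open on the left.\<close>
    have "1 - d < measure (\<mu> n) {-real N - 1<..real N}" for n
    proof -
      interpret M: real_distribution "\<mu> n" by (rule rd)
      have iu: "integrable lborel (\<lambda>x. indicator {-real N..real N} x *\<^sub>R u (\<epsilon> n) x)"
        using uint[OF \<epsilon>, of n] by (intro integrable_mult_indicator) auto
      have ig: "integrable lborel (\<lambda>x. indicator {-real N..real N} x *\<^sub>R g x)"
        using gint by (intro integrable_mult_indicator) auto
      have "1 - (\<integral>x. indicator {-real N..real N} x *\<^sub>R u (\<epsilon> n) x \<partial>lborel) =
          (\<integral>x. u (\<epsilon> n) x - indicator {-real N..real N} x *\<^sub>R u (\<epsilon> n) x \<partial>lborel)"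
        using iu uint[OF \<epsilon>, of n] umass[OF \<epsilon>, of n] by (simp add: Bochner_Integration.integral_diff)
      also have "\<dots> \<le> (\<integral>x. g x - indicator {-real N..real N} x *\<^sub>R g x \<partial>lborel)"
      proof (rule integral_mono)
        show "u (\<epsilon> n) x - indicator {-real N..real N} x *\<^sub>R u (\<epsilon> n) x \<le> g x - indicator {-real N..real N} x *\<^sub>R g x" for x
        proof (cases "x \<in> {-real N..real N}")
          case False
          then have "R \<le> \<bar>x\<bar>" using N N0 by auto
          from uD[OF \<epsilon> this] False show ?thesis by (simp add: indicator_def)
        qed simp
      qed (use iu ig gint uint[OF \<epsilon>, of n] in auto)
      also have "\<dots> < d" using ig gint Ng by (simp add: Bochner_Integration.integral_diff)
      finally have "1 - d < (\<integral>x. u (\<epsilon> n) x *\<^sub>R indicator {-real N..real N} x \<partial>lborel)" by (simp add: mult.commute)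
      also have "\<dots> = measure (\<mu> n) {-real N..real N}"
        using int\<mu>[of "indicator {-real N..real N} :: real \<Rightarrow> real" n] by simp
      also have "\<dots> \<le> measure (\<mu> n) {-real N - 1<..real N}"
        by (intro M.finite_measure_mono) auto
      finally show ?thesis .
    qed
    then show "\<exists>a b. a < b \<and> (\<forall>n. 1 - d < measure (\<mu> n) {a<..b})"
      by (intro exI[of _ "-real N - 1"] exI[of _ "real N"]) auto
  qed
  obtain r M where r: "strict_mono (r :: nat \<Rightarrow> nat)" and M: "real_distribution M" and w: "weak_conv_m (\<mu> \<circ> id \<circ> r) M"
    using tight_imp_convergent_subsubsequence[OF tight, of id] by (auto simp: strict_mono_def)
  \<comment> \<open>For fixed nonreal \<open>z\<close> the Cauchy kernel is bounded and continuous,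
    so weak convergence along the subsequence carries the Poisson formula to the limit.\<close>
  have "F z = cauchy_transform M z" if z: "0 < Im z" for z
  proof -
    have "(\<lambda>n. integral\<^sup>L ((\<mu> \<circ> id \<circ> r) n) (\<lambda>x. 1 / (complex_of_real x - z))) \<longlonglongrightarrow> integral\<^sup>L M (\<lambda>x. 1 / (complex_of_real x - z))"
    proof (rule weak_conv_imp_integral_bdd_continuous_conv[OF _ M w])
      show "real_distribution ((\<mu> \<circ> id \<circ> r) n)" for n using rd by simp
      show "isCont (\<lambda>x. 1 / (complex_of_real x - z)) x" for x
      proof (intro continuous_intros)
        show "complex_of_real x - z \<noteq> 0" using z by (metis Im_complex_of_real eq_iff_diff_eq_0 less_irrefl)
      qed
      show "norm (1 / (complex_of_real x - z)) \<le> 1 / \<bar>Im z\<bar>" for x by (rule norm_cauchy_kernel_le) (use z in simp)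
    qed
    moreover have "integral\<^sup>L ((\<mu> \<circ> id \<circ> r) n) (\<lambda>x. 1 / (complex_of_real x - z)) = F (z + Complex 0 (\<epsilon> (r n)))" for n
      using poisson[OF \<epsilon>(1) z, of "r n"] int\<mu>[of "\<lambda>x. 1 / (complex_of_real x - z)" "r n"]
      by (simp add: scaleR_conv_of_real)
    moreover have "(\<lambda>n. F (z + Complex 0 (\<epsilon> (r n)))) \<longlonglongrightarrow> F z"
    proof (rule isCont_tendsto_compose[of _ F])
      show "isCont F z" using contF z open_halfspace_Im_gt[of 0] by (simp add: continuous_on_eq_continuous_at)
      have "(\<lambda>n. z + \<i> * of_real (\<epsilon> (r n))) \<longlonglongrightarrow> z + \<i> * of_real 0"
        by (intro tendsto_intros LIMSEQ_subseq_LIMSEQ[OF \<epsilon>lim r, unfolded comp_def])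
      then show "(\<lambda>n. z + Complex 0 (\<epsilon> (r n))) \<longlonglongrightarrow> z" by (simp add: Complex_eq)
    qed
    ultimately show ?thesis unfolding cauchy_transform_def by (simp add: LIMSEQ_unique)
  qed
  then show ?thesis using M by blast
qed

section \<open>Recovering a measure from its Cauchy transform\<close>

lemma nn_integral_poisson_kernel:
  assumes "a \<le> b" "0 < e"
  shows "(\<integral>\<^sup>+s. ennreal (e / ((x - s)\<^sup>2 + e\<^sup>2)) * indicator {a..b} s \<partial>lborel) =
    ennreal (arctan ((b - x) / e) - arctan ((a - x) / e))"
proof (rule nn_integral_FTC_Icc)
  fix s
  have "((\<lambda>s. arctan ((s - x) / e)) has_real_derivative inverse (1 + ((s - x) / e)\<^sup>2) * (1 / e)) (at s)"
    by (rule DERIV_chain2[OF DERIV_arctan]) (use assms in \<open>auto intro!: derivative_eq_intros\<close>)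
  also have "inverse (1 + ((s - x) / e)\<^sup>2) * (1 / e) = e / ((x - s)\<^sup>2 + e\<^sup>2)"
  proof -
    have "1 + ((s - x) / e)\<^sup>2 = ((x - s)\<^sup>2 + e\<^sup>2) / e\<^sup>2"
      using assms by (simp add: power_divide add_divide_distrib power2_commute)
    then show ?thesis using assms by (simp add: inverse_eq_divide power2_eq_square)
  qed
  finally show "((\<lambda>s. arctan ((s - x) / e)) has_real_derivative e / ((x - s)\<^sup>2 + e\<^sup>2)) (at s)" .
qed (use assms in auto)

text \<open>Fubini turns the left side into the integral of
  \<open>A e x = arctan ((b - x) / e) - arctan ((a - x) / e)\<close>. It stays between 0 and pi and
  tends to pi inside the interval, to pi/2 at the end points and to 0 outside; hence the
  halves.\<close>

lemma stieltjes_inversion: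
  assumes fin: "finite_measure \<mu>" and sets: "sets \<mu> = sets borel" and ab: "a < b"
    and \<epsilon>: "\<And>n. 0 < \<epsilon> n" "\<epsilon> \<longlonglongrightarrow> 0"
  shows "(\<lambda>n. \<integral>s. indicator {a..b} s * Im (cauchy_transform \<mu> (Complex s (\<epsilon> n))) \<partial>lborel)
    \<longlonglongrightarrow> pi * (measure \<mu> {a<..<b} + measure \<mu> {a} / 2 + measure \<mu> {b} / 2)"
proof -
  interpret finite_measure \<mu> by fact
  interpret P: pair_sigma_finite lborel \<mu> ..
  note [measurable_cong] = sets
  define A where "A e x = arctan ((b - x) / e) - arctan ((a - x) / e)" for e x :: real
  have A0: "0 \<le> A e x" if "0 < e" for e x
    unfolding A_def using ab that arctan_le_iff[of "(a - x) / e" "(b - x) / e"] by (simp add: divide_right_mono)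
  have Api: "A e x \<le> pi" for e x
    unfolding A_def using arctan_bounded[of "(b - x) / e"] arctan_bounded[of "(a - x) / e"] by linarith
  have Am [measurable]: "A e \<in> borel_measurable borel" for e unfolding A_def by measurable
  have eq: "(\<integral>s. indicator {a..b} s * Im (cauchy_transform \<mu> (Complex s e)) \<partial>lborel) = (\<integral>x. A e x \<partial>\<mu>)"
    if e: "0 < e" for e
  proof -
    define k where "k x s = e / ((x - s)\<^sup>2 + e\<^sup>2)" for x s :: real
    have k0: "0 \<le> k x s" for x s using e by (simp add: k_def)
    have [measurable]: "(\<lambda>(x, s). k x s) \<in> borel_measurable (borel \<Otimes>\<^sub>M borel)" unfolding k_def by measurable
    have kint: "integrable \<mu> (\<lambda>x. k x s)" for s
    proof (rule integrable_const_bound[of _ "1 / e"])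
      have "k x s \<le> 1 / e" for x
      proof -
        have "e / ((x - s)\<^sup>2 + e\<^sup>2) \<le> e / e\<^sup>2" using e by (intro divide_left_mono mult_pos_pos add_nonneg_pos) auto
        then show ?thesis using e by (simp add: k_def power2_eq_square)
      qed
      then show "AE x in \<mu>. norm (k x s) \<le> 1 / e" using k0 by simp
    qed (unfold k_def, measurable)
    have m: "(\<lambda>s. \<integral>x. k x s \<partial>\<mu>) \<in> borel_measurable lborel"
      by measurable
    have "(\<integral>s. indicator {a..b} s * Im (cauchy_transform \<mu> (Complex s e)) \<partial>lborel) =
        (\<integral>s. indicator {a..b} s * (\<integral>x. k x s \<partial>\<mu>) \<partial>lborel)"
      unfolding Im_cauchy_transform[OF fin sets e] k_def ..
    also have "\<dots> = enn2real (\<integral>\<^sup>+s. ennreal (indicator {a..b} s * (\<integral>x. k x s \<partial>\<mu>)) \<partial>lborel)"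
    proof (rule integral_eq_nn_integral)
      show "(\<lambda>s. indicator {a..b} s * (\<integral>x. k x s \<partial>\<mu>)) \<in> borel_measurable lborel" using m by measurable
    qed (use k0 in \<open>auto intro!: mult_nonneg_nonneg integral_nonneg\<close>)
    also have "(\<integral>\<^sup>+s. ennreal (indicator {a..b} s * (\<integral>x. k x s \<partial>\<mu>)) \<partial>lborel) =
        (\<integral>\<^sup>+s. (\<integral>\<^sup>+x. ennreal (k x s) * indicator {a..b} s \<partial>\<mu>) \<partial>lborel)"
    proof (rule nn_integral_cong)
      fix s :: real
      have "ennreal (\<integral>x. k x s \<partial>\<mu>) = (\<integral>\<^sup>+x. ennreal (k x s) \<partial>\<mu>)"
        using nn_integral_eq_integral[OF kint] k0 by simp
      then show "ennreal (indicator {a..b} s * (\<integral>x. k x s \<partial>\<mu>)) = (\<integral>\<^sup>+x. ennreal (k x s) * indicator {a..b} s \<partial>\<mu>)"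
        by (simp add: indicator_def)
    qed
    also have "\<dots> = (\<integral>\<^sup>+x. (\<integral>\<^sup>+s. ennreal (k x s) * indicator {a..b} s \<partial>lborel) \<partial>\<mu>)"
      by (rule P.Fubini'[symmetric]) (unfold k_def, measurable)
    also have "\<dots> = (\<integral>\<^sup>+x. ennreal (A e x) \<partial>\<mu>)"
      unfolding k_def A_def using ab e by (intro nn_integral_cong nn_integral_poisson_kernel) auto
    also have "enn2real \<dots> = (\<integral>x. A e x \<partial>\<mu>)"
      using A0[OF e] by (intro integral_eq_nn_integral[symmetric]) auto
    finally show ?thesis .
  qed
  define L where "L x = pi * (indicator {a<..<b} x + indicator {a} x / 2 + indicator {b} x / 2)" for x :: real
  have inf: "filterlim (\<lambda>n. c / \<epsilon> n) at_top sequentially" if "c > 0" for c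
  proof -
    have "filterlim (\<lambda>n. inverse (\<epsilon> n)) at_top sequentially"
      using \<epsilon> by (intro filterlim_inverse_at_top) auto
    from filterlim_tendsto_pos_mult_at_top[OF tendsto_const that this] show ?thesis
      by (simp add: divide_inverse)
  qed
  have arc: "(\<lambda>n. arctan (c / \<epsilon> n)) \<longlonglongrightarrow> (if c > 0 then pi / 2 else if c = 0 then 0 else - (pi / 2))" for c
  proof -
    have pos: "(\<lambda>n. arctan (c / \<epsilon> n)) \<longlonglongrightarrow> pi / 2" if "c > 0" for c
      by (rule filterlim_compose[OF tendsto_arctan_at_top inf[OF that]])
    have "(\<lambda>n. arctan (c / \<epsilon> n)) \<longlonglongrightarrow> - (pi / 2)" if "c < 0"
      using tendsto_minus[OF pos[of "- c"]] that by (simp add: arctan_minus)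
    with pos show ?thesis by simp
  qed
  have lim: "(\<lambda>n. A (\<epsilon> n) x) \<longlonglongrightarrow> L x" for x
  proof -
    have "(\<lambda>n. A (\<epsilon> n) x) \<longlonglongrightarrow> (if b - x > 0 then pi / 2 else if b - x = 0 then 0 else - (pi / 2)) -
        (if a - x > 0 then pi / 2 else if a - x = 0 then 0 else - (pi / 2))"
      unfolding A_def by (intro tendsto_diff arc)
    also have "(if b - x > 0 then pi / 2 else if b - x = 0 then 0 else - (pi / 2)) -
        (if a - x > 0 then pi / 2 else if a - x = 0 then 0 else - (pi / 2)) = L x"
      using ab by (auto simp: L_def indicator_def)
    finally show ?thesis .
  qed
  have "(\<lambda>n. \<integral>x. A (\<epsilon> n) x \<partial>\<mu>) \<longlonglongrightarrow> (\<integral>x. L x \<partial>\<mu>)"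
  proof (rule integral_dominated_convergence[where w="\<lambda>_. pi"])
    show "AE x in \<mu>. norm (A (\<epsilon> n) x) \<le> pi" for n using A0[OF \<epsilon>(1)] Api by simp
  qed (use lim in \<open>auto simp: L_def\<close>)
  also have "(\<integral>x. L x \<partial>\<mu>) = pi * (measure \<mu> {a<..<b} + measure \<mu> {a} / 2 + measure \<mu> {b} / 2)"
    unfolding L_def using sets
    by (simp add: integrable_real_indicator less_top[symmetric])
  finally show ?thesis unfolding eq[OF \<epsilon>(1)] .
qed

text \<open>\<open>e^2 / ((x - s)^2 + e^2)\<close> is bounded by 1 and tends to the indicator of
  \<open>s\<close> as \<open>e\<close> tends to 0.\<close>

lemma cauchy_transform_atom:
  assumes fin: "finite_measure \<mu>" and sets: "sets \<mu> = sets borel"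
    and \<epsilon>: "\<And>n. 0 < \<epsilon> n" "\<epsilon> \<longlonglongrightarrow> 0"
  shows "(\<lambda>n. \<epsilon> n * Im (cauchy_transform \<mu> (Complex s (\<epsilon> n)))) \<longlonglongrightarrow> measure \<mu> {s}"
proof -
  interpret finite_measure \<mu> by fact
  note [measurable_cong] = sets
  have eq: "\<epsilon> n * Im (cauchy_transform \<mu> (Complex s (\<epsilon> n))) = (\<integral>x. \<epsilon> n * (\<epsilon> n / ((x - s)\<^sup>2 + (\<epsilon> n)\<^sup>2)) \<partial>\<mu>)" for n
    unfolding Im_cauchy_transform[OF fin sets \<epsilon>(1)] by (rule integral_mult_right_zero[symmetric])
  have "(\<lambda>n. \<integral>x. \<epsilon> n * (\<epsilon> n / ((x - s)\<^sup>2 + (\<epsilon> n)\<^sup>2)) \<partial>\<mu>) \<longlonglongrightarrow> (\<integral>x. indicator {s} x \<partial>\<mu>)"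
  proof (rule integral_dominated_convergence[where w="\<lambda>_. 1"])
    have "(\<lambda>n. \<epsilon> n * (\<epsilon> n / ((x - s)\<^sup>2 + (\<epsilon> n)\<^sup>2))) \<longlonglongrightarrow> indicator {s} x" for x
    proof (cases "x = s")
      case True
      have "\<epsilon> n * (\<epsilon> n / ((x - s)\<^sup>2 + (\<epsilon> n)\<^sup>2)) = 1" for n
        using \<epsilon>(1)[of n] True by (simp add: power2_eq_square)
      then show ?thesis using True by simp
    next
      case False
      have "(\<lambda>n. \<epsilon> n * (\<epsilon> n / ((x - s)\<^sup>2 + (\<epsilon> n)\<^sup>2))) \<longlonglongrightarrow> 0 * (0 / ((x - s)\<^sup>2 + 0\<^sup>2))"
        using False by (intro tendsto_intros \<epsilon>) auto
      then show ?thesis using False by simp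
    qed
    then show "AE x in \<mu>. (\<lambda>n. \<epsilon> n * (\<epsilon> n / ((x - s)\<^sup>2 + (\<epsilon> n)\<^sup>2))) \<longlonglongrightarrow> indicator {s} x" by simp
    have "\<epsilon> n * (\<epsilon> n / ((x - s)\<^sup>2 + (\<epsilon> n)\<^sup>2)) \<le> 1" for n x
      using \<epsilon>(1)[of n] by (simp add: divide_le_eq_1 power2_eq_square[symmetric] add_nonneg_pos)
    then show "AE x in \<mu>. norm (\<epsilon> n * (\<epsilon> n / ((x - s)\<^sup>2 + (\<epsilon> n)\<^sup>2))) \<le> 1" for n
      using \<epsilon>(1)[of n] by simp
  qed auto
  also have "(\<integral>x. indicator {s} x \<partial>\<mu>) = measure \<mu> {s}" using sets by simp
  finally show ?thesis unfolding eq .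
qed

lemma inverse_Suc_null: "0 < inverse (real (Suc n))" "(\<lambda>n. inverse (real (Suc n))) \<longlonglongrightarrow> 0"
  by (simp, rule LIMSEQ_inverse_real_of_nat)

lemma integrable_Im_cauchy_transform:
  assumes fin: "finite_measure \<mu>" and sets: "sets \<mu> = sets borel" and e: "0 < e"
  shows "integrable lborel (\<lambda>s. indicator {a..b} s * Im (cauchy_transform \<mu> (Complex s e)))"
proof -
  interpret finite_measure \<mu> by fact
  note [measurable_cong] = sets
  have m: "(\<lambda>s. \<integral>x. e / ((x - s)\<^sup>2 + e\<^sup>2) \<partial>\<mu>) \<in> borel_measurable lborel"
    by measurable
  have le: "norm (indicator {a..b} s * (\<integral>x. e / ((x - s)\<^sup>2 + e\<^sup>2) \<partial>\<mu>)) \<le> norm ((measure \<mu> UNIV / e) * indicator {a..b} s)" for s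
  proof -
    have "(\<integral>x. e / ((x - s)\<^sup>2 + e\<^sup>2) \<partial>\<mu>) \<le> (\<integral>x. 1 / e \<partial>\<mu>)"
    proof (rule integral_mono_AE')
      have "e / ((x - s)\<^sup>2 + e\<^sup>2) \<le> 1 / e" for x
      proof -
        have "e / ((x - s)\<^sup>2 + e\<^sup>2) \<le> e / e\<^sup>2" using e by (intro divide_left_mono mult_pos_pos add_nonneg_pos) auto
        then show ?thesis using e by (simp add: power2_eq_square)
      qed
      then show "AE x in \<mu>. e / ((x - s)\<^sup>2 + e\<^sup>2) \<le> 1 / e" by simp
    qed (use e in auto)
    also have "\<dots> = measure \<mu> UNIV / e" using sets_eq_imp_space_eq[OF sets] by simp
    finally have "(\<integral>x. e / ((x - s)\<^sup>2 + e\<^sup>2) \<partial>\<mu>) \<le> measure \<mu> UNIV / e" .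
    moreover have "0 \<le> (\<integral>x. e / ((x - s)\<^sup>2 + e\<^sup>2) \<partial>\<mu>)" using e by (intro Bochner_Integration.integral_nonneg) auto
    ultimately show ?thesis using e by (auto simp: indicator_def)
  qed
  show ?thesis
    unfolding Im_cauchy_transform[OF fin sets e]
  proof (rule Bochner_Integration.integrable_bound)
    show "integrable lborel (\<lambda>s. (measure \<mu> UNIV / e) * indicator {a..b} s)"
      by (intro integrable_mult_right integrable_real_indicator) (auto simp: emeasure_lborel_Icc_eq)
    show "(\<lambda>s. indicator {a..b} s * (\<integral>x. e / ((x - s)\<^sup>2 + e\<^sup>2) \<partial>\<mu>)) \<in> borel_measurable lborel"
      using m by measurable
  qed (use le in simp)
qed

lemma borel_real_sigma_sets: "sets borel = sigma_sets UNIV (range (\<lambda>(a, b). {a<..<b::real}))"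
  unfolding borel_eq_box[where ?'a = real] box_real by simp

lemma Int_stable_open_intervals: "Int_stable (range (\<lambda>(a, b). {a<..<b::real}))"
proof (rule Int_stableI_image)
  fix i j :: "real \<times> real"
  have "(case i of (a, b) \<Rightarrow> {a<..<b}) \<inter> (case j of (a, b) \<Rightarrow> {a<..<b}) =
      (case (max (fst i) (fst j), min (snd i) (snd j)) of (a, b) \<Rightarrow> {a<..<b})"
    by (auto split: prod.splits)
  then show "\<exists>k\<in>UNIV. (case i of (a, b) \<Rightarrow> {a<..<b}) \<inter> (case j of (a, b) \<Rightarrow> {a<..<b}) = (case k of (a, b) \<Rightarrow> {a<..<b})"
    by blast
qed

lemma finite_measure_tendsto_UNIV:
  assumes "finite_measure \<mu>" "sets \<mu> = sets borel"
  shows "(\<lambda>n. measure \<mu> {- real n<..<real n}) \<longlonglongrightarrow> measure \<mu> UNIV"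
proof -
  interpret finite_measure \<mu> by fact
  have inc: "incseq (\<lambda>n. {- real n<..<real n})"
  proof (rule monoI)
    fix m n :: nat assume "m \<le> n"
    then have "real m \<le> real n" by simp
    then show "{- real m<..<real m} \<subseteq> {- real n<..<real n}" by force
  qed
  have "range (\<lambda>n. {- real n<..<real n}) \<subseteq> sets \<mu>" unfolding assms(2) by auto
  from finite_Lim_measure_incseq[OF this inc]
  have "(\<lambda>n. measure \<mu> {- real n<..<real n}) \<longlonglongrightarrow> measure \<mu> (\<Union>n. {- real n<..<real n})" .
  also have "(\<Union>n. {- real n<..<real n}) = UNIV"
  proof (rule UNIV_eq_I[symmetric])
    fix x :: real
    obtain n where "\<bar>x\<bar> < real n" using reals_Archimedean2 by blast
    then have "x \<in> {- real n<..<real n}" by auto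
    then show "x \<in> (\<Union>n. {- real n<..<real n})" by blast
  qed
  finally show ?thesis .
qed

text \<open>Signed coefficients let one statement yield uniqueness as well as the quadratic
  identities between spectral measures. Imaginary parts suffice because they alone enter the
  inversion formula. Atoms come first, as end points count half there; then open intervals, then the
  sigma-algebra they generate.\<close>

theorem cauchy_transform_linear_unique:
  fixes c :: "'k \<Rightarrow> real"
  assumes K: "finite K" and fin: "\<And>k. k \<in> K \<Longrightarrow> finite_measure (\<mu> k)"
    and sets: "\<And>k. k \<in> K \<Longrightarrow> sets (\<mu> k) = sets borel"
    and eq: "\<And>z. 0 < Im z \<Longrightarrow> (\<Sum>k\<in>K. c k * Im (cauchy_transform (\<mu> k) z)) = 0"
    and A: "A \<in> sets borel"
  shows "(\<Sum>k\<in>K. c k * measure (\<mu> k) A) = 0"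
proof -
  define \<epsilon> where "\<epsilon> n = inverse (real (Suc n))" for n
  have \<epsilon>: "0 < \<epsilon> n" "\<epsilon> \<longlonglongrightarrow> 0" for n unfolding \<epsilon>_def by (rule inverse_Suc_null)+
  have eq': "(\<Sum>k\<in>K. c k * Im (cauchy_transform (\<mu> k) (Complex s (\<epsilon> n)))) = 0" for s n
    using eq \<epsilon>(1) by simp
  have space: "space (\<mu> k) = UNIV" if "k \<in> K" for k using sets_eq_imp_space_eq[OF sets[OF that]] by simp
  have atom: "(\<Sum>k\<in>K. c k * measure (\<mu> k) {s}) = 0" for s
  proof (rule LIMSEQ_unique)
    show "(\<lambda>n. \<Sum>k\<in>K. c k * (\<epsilon> n * Im (cauchy_transform (\<mu> k) (Complex s (\<epsilon> n))))) \<longlonglongrightarrow> (\<Sum>k\<in>K. c k * measure (\<mu> k) {s})"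
      by (intro tendsto_intros cauchy_transform_atom fin sets \<epsilon>)
    have "(\<Sum>k\<in>K. c k * (\<epsilon> n * Im (cauchy_transform (\<mu> k) (Complex s (\<epsilon> n))))) =
        \<epsilon> n * (\<Sum>k\<in>K. c k * Im (cauchy_transform (\<mu> k) (Complex s (\<epsilon> n))))" for n
      by (simp add: sum_distrib_left mult.left_commute)
    then show "(\<lambda>n. \<Sum>k\<in>K. c k * (\<epsilon> n * Im (cauchy_transform (\<mu> k) (Complex s (\<epsilon> n))))) \<longlonglongrightarrow> 0"
      unfolding eq' by simp
  qed
  have open_int: "(\<Sum>k\<in>K. c k * measure (\<mu> k) {a<..<b}) = 0" for a b
  proof (cases "a < b")
    case True
    let ?I = "\<lambda>k n. \<integral>s. indicator {a..b} s * Im (cauchy_transform (\<mu> k) (Complex s (\<epsilon> n))) \<partial>lborel"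
    have "(\<Sum>k\<in>K. c k * ?I k n) = 0" for n
    proof -
      have "(\<Sum>k\<in>K. c k * ?I k n) =
          (\<integral>s. (\<Sum>k\<in>K. c k * (indicator {a..b} s * Im (cauchy_transform (\<mu> k) (Complex s (\<epsilon> n))))) \<partial>lborel)"
        by (subst Bochner_Integration.integral_sum)
          (auto intro!: integrable_mult_right integrable_Im_cauchy_transform fin sets \<epsilon>(1))
      also have "(\<lambda>s. \<Sum>k\<in>K. c k * (indicator {a..b} s * Im (cauchy_transform (\<mu> k) (Complex s (\<epsilon> n))))) =
          (\<lambda>s. indicator {a..b} s * (\<Sum>k\<in>K. c k * Im (cauchy_transform (\<mu> k) (Complex s (\<epsilon> n)))))"
        by (simp add: sum_distrib_left mult.left_commute)
      finally show ?thesis unfolding eq' by simp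
    qed
    moreover have "(\<lambda>n. \<Sum>k\<in>K. c k * ?I k n) \<longlonglongrightarrow>
        (\<Sum>k\<in>K. c k * (pi * (measure (\<mu> k) {a<..<b} + measure (\<mu> k) {a} / 2 + measure (\<mu> k) {b} / 2)))"
      by (intro tendsto_intros stieltjes_inversion fin sets True \<epsilon>)
    ultimately have "(\<Sum>k\<in>K. c k * (pi * (measure (\<mu> k) {a<..<b} + measure (\<mu> k) {a} / 2 + measure (\<mu> k) {b} / 2))) = 0"
      by (simp add: LIMSEQ_const_iff)
    also have "(\<Sum>k\<in>K. c k * (pi * (measure (\<mu> k) {a<..<b} + measure (\<mu> k) {a} / 2 + measure (\<mu> k) {b} / 2))) =
        pi * ((\<Sum>k\<in>K. c k * measure (\<mu> k) {a<..<b}) + (\<Sum>k\<in>K. c k * measure (\<mu> k) {a}) / 2 + (\<Sum>k\<in>K. c k * measure (\<mu> k) {b}) / 2)"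
      unfolding sum_distrib_left sum_divide_distrib sum.distrib[symmetric]
      by (rule sum.cong) (simp_all add: field_simps)
    finally show ?thesis by (simp add: atom)
  qed simp
  have UNIV: "(\<Sum>k\<in>K. c k * measure (\<mu> k) UNIV) = 0"
  proof (rule LIMSEQ_unique)
    show "(\<lambda>n. \<Sum>k\<in>K. c k * measure (\<mu> k) {- real n<..<real n}) \<longlonglongrightarrow> (\<Sum>k\<in>K. c k * measure (\<mu> k) UNIV)"
      by (intro tendsto_sum tendsto_mult tendsto_const finite_measure_tendsto_UNIV fin sets)
    show "(\<lambda>n. \<Sum>k\<in>K. c k * measure (\<mu> k) {- real n<..<real n}) \<longlonglongrightarrow> 0" by (simp add: open_int)
  qed
  have "range (\<lambda>(a, b). {a<..<b::real}) \<subseteq> Pow UNIV" by simp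
  moreover have "A \<in> sigma_sets UNIV (range (\<lambda>(a, b). {a<..<b::real}))" using A by (simp add: borel_real_sigma_sets)
  moreover note Int_stable_open_intervals
  ultimately have "Int_stable (range (\<lambda>(a, b). {a<..<b::real}))" "range (\<lambda>(a, b). {a<..<b::real}) \<subseteq> Pow UNIV"
    "A \<in> sigma_sets UNIV (range (\<lambda>(a, b). {a<..<b::real}))" by blast+
  then show ?thesis
  proof (induction rule: sigma_sets_induct_disjoint)
    case (compl A)
    then have A: "A \<in> sets borel" by (simp add: borel_real_sigma_sets)
    have "measure (\<mu> k) (UNIV - A) = measure (\<mu> k) UNIV - measure (\<mu> k) A" if "k \<in> K" for k
      using finite_measure.finite_measure_compl[OF fin[OF that], of A] A sets[OF that] space[OF that] by simp
    then have "(\<Sum>k\<in>K. c k * measure (\<mu> k) (UNIV - A)) = (\<Sum>k\<in>K. c k * measure (\<mu> k) UNIV) - (\<Sum>k\<in>K. c k * measure (\<mu> k) A)"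
      by (simp add: right_diff_distrib sum_subtractf)
    then show ?case by (simp add: compl UNIV)
  next
    case (union A)
    have "(\<lambda>n. measure (\<mu> k) (A n)) sums measure (\<mu> k) (\<Union>n. A n)" if "k \<in> K" for k
      using union sets[OF that] by (intro finite_measure.finite_measure_UNION[OF fin[OF that]]) (auto simp: borel_real_sigma_sets)
    then have "(\<lambda>n. \<Sum>k\<in>K. c k * measure (\<mu> k) (A n)) sums (\<Sum>k\<in>K. c k * measure (\<mu> k) (\<Union>n. A n))"
      by (intro sums_sum sums_mult)
    then show ?case by (simp add: union.IH sums_iff)
  qed (use open_int in auto)
qed

corollary cauchy_transform_unique:
  assumes fin: "finite_measure \<mu>" "finite_measure \<nu>" and sets: "sets \<mu> = sets borel" "sets \<nu> = sets borel"
    and eq: "\<And>z. 0 < Im z \<Longrightarrow> cauchy_transform \<mu> z = cauchy_transform \<nu> z"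
  shows "\<mu> = \<nu>"
proof (rule measure_eqI)
  fix A assume "A \<in> sets \<mu>"
  then have "measure \<mu> A = measure \<nu> A"
    using cauchy_transform_linear_unique[of UNIV "\<lambda>b. if b then \<mu> else \<nu>" "\<lambda>b. if b then 1 else -1" A] assms
    by (simp add: UNIV_bool)
  then show "emeasure \<mu> A = emeasure \<nu> A"
    using fin by (simp add: finite_measure.emeasure_eq_measure)
qed (use sets in simp)

text \<open>An imaginary part of order \<open>e\<close> above the interval makes the limit in the
  inversion formula vanish.\<close>

lemma cauchy_transform_null_interval:
  assumes fin: "finite_measure \<mu>" and sets: "sets \<mu> = sets borel" and e0: "0 < e0"
    and bd: "\<And>s e. a \<le> s \<Longrightarrow> s \<le> b \<Longrightarrow> 0 < e \<Longrightarrow> e < e0 \<Longrightarrow> Im (cauchy_transform \<mu> (Complex s e)) \<le> C * e"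
  shows "measure \<mu> {a<..<b} = 0"
proof (cases "a < b")
  case True
  define \<epsilon> where "\<epsilon> n = e0 / 2 * inverse (real (Suc n))" for n
  have \<epsilon>: "0 < \<epsilon> n" "\<epsilon> n < e0" for n
  proof -
    show "0 < \<epsilon> n" unfolding \<epsilon>_def using e0 by (intro mult_pos_pos) auto
    have "\<epsilon> n \<le> e0 / 2 * 1"
      unfolding \<epsilon>_def using e0 by (intro mult_left_mono) (auto simp: inverse_le_1_iff)
    then show "\<epsilon> n < e0" using e0 by simp
  qed
  have \<epsilon>lim: "\<epsilon> \<longlonglongrightarrow> 0"
    unfolding \<epsilon>_def using tendsto_mult[OF tendsto_const[of "e0/2"] inverse_Suc_null(2)] by simp
  have "pi * (measure \<mu> {a<..<b} + measure \<mu> {a} / 2 + measure \<mu> {b} / 2) \<le> 0"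
  proof (rule LIMSEQ_le[OF stieltjes_inversion[OF fin sets True \<epsilon>(1) \<epsilon>lim]])
    have "(\<lambda>n. (\<bar>C\<bar> * (b - a)) * \<epsilon> n) \<longlonglongrightarrow> (\<bar>C\<bar> * (b - a)) * 0" by (intro tendsto_intros \<epsilon>lim)
    then show "(\<lambda>n. (\<bar>C\<bar> * (b - a)) * \<epsilon> n) \<longlonglongrightarrow> 0" by simp
    have "(\<integral>s. indicator {a..b} s * Im (cauchy_transform \<mu> (Complex s (\<epsilon> n))) \<partial>lborel) \<le> (\<bar>C\<bar> * (b - a)) * \<epsilon> n" for n
    proof -
      have "(\<integral>s. indicator {a..b} s * Im (cauchy_transform \<mu> (Complex s (\<epsilon> n))) \<partial>lborel) \<le>
          (\<integral>s. (\<bar>C\<bar> * \<epsilon> n) * indicator {a..b} s \<partial>lborel)"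
      proof (rule integral_mono_AE')
        show "integrable lborel (\<lambda>s. \<bar>C\<bar> * \<epsilon> n * indicator {a..b} s)"
          using True by (intro integrable_mult_right integrable_real_indicator) auto
        have "indicator {a..b} s * Im (cauchy_transform \<mu> (Complex s (\<epsilon> n))) \<le> \<bar>C\<bar> * \<epsilon> n * indicator {a..b} s" for s
        proof (cases "s \<in> {a..b}")
          case s: True
          have "Im (cauchy_transform \<mu> (Complex s (\<epsilon> n))) \<le> C * \<epsilon> n" using bd[of s "\<epsilon> n"] \<epsilon> s by auto
          also have "\<dots> \<le> \<bar>C\<bar> * \<epsilon> n" using \<epsilon>(1)[of n] by (intro mult_right_mono) auto
          finally show ?thesis using s by simp
        qed simp
        then show "AE s in lborel. indicator {a..b} s * Im (cauchy_transform \<mu> (Complex s (\<epsilon> n))) \<le> \<bar>C\<bar> * \<epsilon> n * indicator {a..b} s"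
          by simp
        show "AE s in lborel. 0 \<le> \<bar>C\<bar> * \<epsilon> n * indicator {a..b} s" using \<epsilon>(1)[of n] by (auto simp: indicator_def)
      qed
      also have "\<dots> = (\<bar>C\<bar> * (b - a)) * \<epsilon> n" using True by simp
      finally show ?thesis .
    qed
    then show "\<exists>N. \<forall>n\<ge>N. (\<integral>s. indicator {a..b} s * Im (cauchy_transform \<mu> (Complex s (\<epsilon> n))) \<partial>lborel) \<le> (\<bar>C\<bar> * (b - a)) * \<epsilon> n"
      by blast
  qed
  then have "pi * (measure \<mu> {a<..<b} + measure \<mu> {a} / 2 + measure \<mu> {b} / 2) \<le> pi * 0" by simp
  then have "measure \<mu> {a<..<b} + measure \<mu> {a} / 2 + measure \<mu> {b} / 2 \<le> 0"
    unfolding mult_le_cancel_left_pos[OF pi_gt_zero] .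
  moreover have "0 \<le> measure \<mu> {a<..<b}" "0 \<le> measure \<mu> {a}" "0 \<le> measure \<mu> {b}" by simp_all
  ultimately show ?thesis by linarith
qed simp

section \<open>Spectral measures\<close>

lemma Res_mult_const:
  assumes inv: "boundedly_invertible (Hz V z) c" and V: "bounded_by V M"
  shows "Res V z (mult_op (\<lambda>_. a) x) = mult_op (\<lambda>_. a) (Res V z x)"
proof (rule Res_eqI[OF inv], rule l2_eqI)
  fix n
  have e: "Rep_l2 x n = Rep_l2 (Res V z x) (n + 1) + Rep_l2 (Res V z x) (n - 1)
      + (of_real (V n) - z) * Rep_l2 (Res V z x) n"
    unfolding Rep_Hz[OF V, symmetric] by (simp add: Hz_Res[OF inv])
  show "Rep_l2 (Hz V z (mult_op (\<lambda>_. a) (Res V z x))) n = Rep_l2 (mult_op (\<lambda>_. a) x) n"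
    unfolding Rep_Hz[OF V] by (simp add: e algebra_simps)
qed

lemma resolvent_identity:
  assumes z: "boundedly_invertible (Hz V z) c" and w: "boundedly_invertible (Hz V w) d" and V: "bounded_by V M"
  shows "Res V z x = Res V w x + mult_op (\<lambda>_. z - w) (Res V z (Res V w x))"
proof -
  have "Res V z x = Res V w x + Res V z (mult_op (\<lambda>_. z - w) (Res V w x))"
  proof (rule Res_eqI[OF z])
    have "Hz V z (Res V w x) = x + mult_op (\<lambda>_. - (z - w)) (Res V w x)"
      using Hz_diff[OF V V, where z=w and z'=z and x="Res V w x"] by (simp add: Hz_Res[OF w])
    moreover have "mult_op (\<lambda>_. - (z - w)) y + mult_op (\<lambda>_. z - w) y = 0" for y
      by (rule l2_eqI) (simp add: algebra_simps)
    ultimately show "Hz V z (Res V w x + Res V z (mult_op (\<lambda>_. z - w) (Res V w x))) = x"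
      by (simp add: linear_add[OF linear_Hz] Hz_Res[OF z] add.assoc)
  qed
  then show ?thesis unfolding Res_mult_const[OF z V] .
qed

definition green :: "(int \<Rightarrow> real) \<Rightarrow> l2 \<Rightarrow> complex \<Rightarrow> complex" where
  "green V \<psi> z = cinner \<psi> (Res V z \<psi>)"

context
  fixes V :: "int \<Rightarrow> real" and M :: real
  assumes V: "bounded_by V M"
begin

lemma M_nonneg: "0 \<le> M" using bounded_byD[OF V, of 0] by linarith

text \<open>With \<open>\<phi> = Res V z \<psi>\<close> the Green function is the conjugate of
  \<open>cinner \<phi> (Hz V z \<phi>)\<close>, whose imaginary part is known. Positivity makes
  \<open>green\<close> a Herglotz function, and the exact value makes it quadratic in
  \<open>\<psi>\<close>.\<close>

lemma Im_green: "Im z \<noteq> 0 \<Longrightarrow> Im (green V \<psi> z) = Im z * (norm (Res V z \<psi>))\<^sup>2"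
proof -
  assume "Im z \<noteq> 0"
  note inv = Hz_nonreal[OF V this]
  have "green V \<psi> z = cnj (cinner (Res V z \<psi>) (Hz V z (Res V z \<psi>)))"
    by (simp add: green_def Hz_Res[OF inv] cinner_cnj)
  then show ?thesis by (simp add: Im_cinner_Hz[OF V])
qed

lemma cmod_green_le: "boundedly_invertible (Hz V z) c \<Longrightarrow> cmod (green V \<psi> z) \<le> c * (norm \<psi>)\<^sup>2"
proof -
  assume inv: "boundedly_invertible (Hz V z) c"
  have "cmod (green V \<psi> z) \<le> norm \<psi> * norm (Res V z \<psi>)" unfolding green_def by (rule cmod_cinner_le)
  also have "\<dots> \<le> norm \<psi> * (c * norm \<psi>)" by (intro mult_left_mono norm_Res_le[OF inv]) auto
  finally show ?thesis by (simp add: power2_eq_square algebra_simps)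
qed

lemma green_cnj:
  assumes "boundedly_invertible (Hz V z) c" "boundedly_invertible (Hz V (cnj z)) d"
  shows "green V \<psi> (cnj z) = cnj (green V \<psi> z)"
proof -
  have "green V \<psi> (cnj z) = cinner (Hz V z (Res V z \<psi>)) (Res V (cnj z) \<psi>)"
    by (simp add: green_def Hz_Res[OF assms(1)])
  also have "\<dots> = cinner (Res V z \<psi>) (Hz V (cnj z) (Res V (cnj z) \<psi>))" by (rule cinner_Hz[OF V])
  also have "\<dots> = cnj (green V \<psi> z)" by (simp add: green_def Hz_Res[OF assms(2)] cinner_cnj)
  finally show ?thesis .
qed

lemma norm_Res_diff_le:
  assumes z: "boundedly_invertible (Hz V z) c" and w: "boundedly_invertible (Hz V w) d"
  shows "norm (Res V z x - Res V w x) \<le> cmod (z - w) * (c * norm (Res V w x))"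
proof -
  have "Res V z x - Res V w x = mult_op (\<lambda>_. z - w) (Res V z (Res V w x))"
    by (subst resolvent_identity[OF z w V]) simp
  then have "norm (Res V z x - Res V w x) \<le> cmod (z - w) * norm (Res V z (Res V w x))"
    by (simp add: norm_mult_op_le)
  also have "\<dots> \<le> cmod (z - w) * (c * norm (Res V w x))"
    by (intro mult_left_mono norm_Res_le[OF z]) auto
  finally show ?thesis .
qed

text \<open>By the resolvent identity the difference quotient is
  \<open>cinner \<psi> (Res V w (Res V z \<psi>))\<close>, and \<open>Res V w\<close> converges to
  \<open>Res V z\<close> with an error of order \<open>cmod (w - z)\<close>.\<close>

lemma holomorphic_green: "green V \<psi> holomorphic_on {z. 0 < Im z}"
proof (rule holomorphic_onI)
  fix z :: complex assume "z \<in> {z. 0 < Im z}"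
  then have z: "0 < Im z" by simp
  note iz = Hz_nonreal[OF V, of z, OF z[THEN less_imp_neq, symmetric]]
  define \<phi> where "\<phi> = Res V z \<psi>"
  have "((\<lambda>w. (green V \<psi> w - green V \<psi> z) / (w - z)) \<longlongrightarrow> cinner \<psi> (Res V z \<phi>)) (at z)"
  proof (rule LIM_zero_cancel, rule Lim_null_comparison)
    have ev: "\<forall>\<^sub>F w in at z. Im z / 2 < Im w"
      by (rule order_tendstoD[where y="Im z"]) (use z in \<open>auto intro!: tendsto_intros\<close>)
    have "\<forall>\<^sub>F w in at z. w \<noteq> z" by (rule eventually_neq_at_within)
    with ev show "\<forall>\<^sub>F w in at z. norm ((green V \<psi> w - green V \<psi> z) / (w - z) - cinner \<psi> (Res V z \<phi>)) \<le>
        norm \<psi> * (cmod (w - z) * (2 / Im z * norm (Res V z \<phi>)))"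
    proof eventually_elim
      fix w assume w: "Im z / 2 < Im w" "w \<noteq> z"
      have iw: "boundedly_invertible (Hz V w) (1 / \<bar>Im w\<bar>)" by (rule Hz_nonreal[OF V]) (use w z in linarith)
      have "green V \<psi> w - green V \<psi> z = (w - z) * cinner \<psi> (Res V w \<phi>)"
        unfolding green_def \<phi>_def cinner_diff_right[symmetric]
        by (subst resolvent_identity[OF iw iz V]) (simp add: cinner_mult_op_const)
      then have "(green V \<psi> w - green V \<psi> z) / (w - z) - cinner \<psi> (Res V z \<phi>) = cinner \<psi> (Res V w \<phi> - Res V z \<phi>)"
        using w by (simp add: cinner_diff_right)
      also have "norm \<dots> \<le> norm \<psi> * norm (Res V w \<phi> - Res V z \<phi>)" by (rule cmod_cinner_le)
      also have "norm (Res V w \<phi> - Res V z \<phi>) \<le> cmod (w - z) * (1 / \<bar>Im w\<bar> * norm (Res V z \<phi>))"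
        by (rule norm_Res_diff_le[OF iw iz])
      also have "1 / \<bar>Im w\<bar> \<le> 2 / Im z"
        using w z by (simp add: frac_le field_simps)
      finally show "norm ((green V \<psi> w - green V \<psi> z) / (w - z) - cinner \<psi> (Res V z \<phi>)) \<le>
          norm \<psi> * (cmod (w - z) * (2 / Im z * norm (Res V z \<phi>)))"
        by (simp add: mult_left_mono mult_right_mono)
    qed
    have "((\<lambda>w. norm \<psi> * (cmod (w - z) * (2 / Im z * norm (Res V z \<phi>)))) \<longlongrightarrow>
        norm \<psi> * (cmod (z - z) * (2 / Im z * norm (Res V z \<phi>)))) (at z)"
      by (intro tendsto_intros)
    then show "((\<lambda>w. norm \<psi> * (cmod (w - z) * (2 / Im z * norm (Res V z \<phi>)))) \<longlongrightarrow> 0) (at z)" by simp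
  qed
  then have "(green V \<psi> has_field_derivative cinner \<psi> (Res V z \<phi>)) (at z)"
    unfolding has_field_derivative_iff .
  then show "green V \<psi> field_differentiable at z within {z. 0 < Im z}"
    by (auto simp: field_differentiable_def intro: has_field_derivative_at_within)
qed

lemma spectral_measure_unit_exists:
  assumes \<psi>: "norm \<psi> = 1"
  shows "\<exists>\<mu>. real_distribution \<mu> \<and> (\<forall>z. 0 < Im z \<longrightarrow> green V \<psi> z = cauchy_transform \<mu> z)"
proof (rule herglotz_representation[OF holomorphic_green])
  define B where "B = 2 + M"
  have B: "B > 0" using M_nonneg by (simp add: B_def)
  \<comment> \<open>From \<open>2 * B + 1\<close> on, \<open>cmod w - B\<close> is at least
    \<open>(1 + cmod w) / 2\<close>, so the bound far from the spectrum reads as decay in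
    \<open>1 + cmod w\<close>.\<close>
  have large: "cmod (green V \<psi> w) \<le> 2 / (1 + cmod w) \<and> norm (Res V w \<psi>) \<le> 2 / (1 + cmod w)"
    if w: "2 * B + 1 \<le> cmod w" for w
  proof -
    have "boundedly_invertible (Hz V w) (1 / (cmod w - B))"
      unfolding B_def by (rule Hz_large[OF V]) (use w B in \<open>simp add: B_def\<close>)
    from cmod_green_le[OF this, of \<psi>] norm_Res_le[OF this, of \<psi>] \<psi>
    have "cmod (green V \<psi> w) \<le> 1 / (cmod w - B)" "norm (Res V w \<psi>) \<le> 1 / (cmod w - B)" by simp_all
    moreover have "1 / (cmod w - B) \<le> 1 / ((1 + cmod w) / 2)"
      using w B by (intro divide_left_mono mult_pos_pos) auto
    ultimately show ?thesis by simp
  qed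
  show "0 \<le> Im (green V \<psi> w)" if "0 < Im w" for w using that by (simp add: Im_green)
  show "\<exists>C\<ge>0. \<forall>w. e \<le> Im w \<longrightarrow> cmod (green V \<psi> w) \<le> C / (1 + cmod w)" if e: "0 < e" for e
  proof (intro exI[of _ "2 + (2 * B + 2) / e"] conjI allI impI)
    show "0 \<le> 2 + (2 * B + 2) / e" using B e by (intro add_nonneg_nonneg divide_nonneg_pos) auto
    fix w assume w: "e \<le> Im w"
    have p: "0 < 1 + cmod w" by (simp add: add_pos_nonneg)
    show "cmod (green V \<psi> w) \<le> (2 + (2 * B + 2) / e) / (1 + cmod w)"
    proof (cases "2 * B + 1 \<le> cmod w")
      case True
      have "2 / (1 + cmod w) \<le> (2 + (2 * B + 2) / e) / (1 + cmod w)"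
        using p B e by (intro divide_right_mono) auto
      with large[OF True] show ?thesis by linarith
    next
      case False
      have "cmod (green V \<psi> w) \<le> 1 / \<bar>Im w\<bar>"
        using cmod_green_le[OF Hz_nonreal[OF V], of w \<psi>] w e \<psi> by simp
      also have "\<dots> \<le> 1 / e" using w e by (intro divide_left_mono) auto
      also have "\<dots> = ((1 + cmod w) / e) / (1 + cmod w)" using p by simp
      also have "\<dots> \<le> (2 + (2 * B + 2) / e) / (1 + cmod w)"
      proof (rule divide_right_mono)
        have "(1 + cmod w) / e \<le> (2 * B + 2) / e" using False e by (intro divide_right_mono) auto
        then show "(1 + cmod w) / e \<le> 2 + (2 * B + 2) / e" by linarith
      qed (use p in simp)
      finally show ?thesis .
    qed
  qed
  \<comment> \<open>The imaginary part is \<open>e\<close> times a squared resolvent norm: the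
    square gives an integrable tail, and \<open>e \<le> 1\<close> makes it uniform.\<close>
  show "Im (green V \<psi> (Complex x e)) \<le> 4 / (1 + x\<^sup>2)" if e: "0 < e" "e \<le> 1" and x: "2 * B + 1 \<le> \<bar>x\<bar>" for x e
  proof -
    have xw: "\<bar>x\<bar> \<le> cmod (Complex x e)" using abs_Re_le_cmod[of "Complex x e"] by simp
    have "Im (green V \<psi> (Complex x e)) = e * (norm (Res V (Complex x e) \<psi>))\<^sup>2" using e by (simp add: Im_green)
    also have "\<dots> \<le> 1 * (2 / (1 + cmod (Complex x e)))\<^sup>2"
      using large[of "Complex x e"] xw x e by (intro mult_mono power_mono) auto
    also have "\<dots> = 4 / (1 + cmod (Complex x e))\<^sup>2" by (simp add: power_divide)
    also have "\<dots> \<le> 4 / (1 + x\<^sup>2)"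
      using one_plus_cmod_sq[of x e]
      by (intro divide_left_mono mult_pos_pos zero_less_power add_pos_nonneg) auto
    finally show ?thesis .
  qed
  \<comment> \<open>At \<open>z = i y\<close> the difference \<open>y G - i\<close> is
    \<open>- i\<close> times \<open>cinner \<psi> (Hz V 0 (Res V z \<psi>))\<close>, and the
    resolvent there is at most \<open>1 / y\<close>.\<close>
  show "((\<lambda>y. of_real y * green V \<psi> (Complex 0 y)) \<longlongrightarrow> \<i>) at_top"
  proof (rule LIM_zero_cancel, rule Lim_null_comparison)
    show "((\<lambda>y. B / y) \<longlongrightarrow> 0) at_top"
      by (rule tendsto_divide_0[OF tendsto_const filterlim_at_top_imp_at_infinity[OF filterlim_ident]])
    show "\<forall>\<^sub>F y in at_top. norm (of_real y * green V \<psi> (Complex 0 y) - \<i>) \<le> B / y"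
      using eventually_gt_at_top[of 0]
    proof eventually_elim
      fix y :: real assume y: "0 < y"
      define z where "z = Complex 0 y"
      have inv: "boundedly_invertible (Hz V z) (1 / \<bar>Im z\<bar>)" by (rule Hz_nonreal[OF V]) (use y in \<open>simp add: z_def\<close>)
      define \<phi> where "\<phi> = Res V z \<psi>"
      have n\<phi>: "norm \<phi> \<le> 1 / y" using norm_Res_le[OF inv, of \<psi>] y \<psi> by (simp add: \<phi>_def z_def)
      have "Hz V 0 \<phi> = \<psi> + mult_op (\<lambda>_. z) \<phi>"
        using Hz_diff[OF V V, where z=z and z'=0 and x=\<phi>] by (simp add: \<phi>_def Hz_Res[OF inv])
      then have "cinner \<psi> (Hz V 0 \<phi>) = 1 + z * green V \<psi> z"
        using \<psi> by (simp add: cinner_add_right cinner_mult_op_const cinner_self green_def \<phi>_def)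
      moreover have "of_real y * green V \<psi> z - \<i> = - \<i> * (1 + z * green V \<psi> z)"
        by (simp add: z_def Complex_eq algebra_simps)
      ultimately have "norm (of_real y * green V \<psi> z - \<i>) = cmod (cinner \<psi> (Hz V 0 \<phi>))"
        by (simp add: norm_mult)
      also have "\<dots> \<le> norm \<psi> * norm (Hz V 0 \<phi>)" by (rule cmod_cinner_le)
      also have "\<dots> \<le> B * norm \<phi>" using norm_H_le[OF V, of \<phi>] \<psi> by (simp add: B_def)
      also have "\<dots> \<le> B * (1 / y)" using n\<phi> B by (intro mult_left_mono) auto
      finally show "norm (of_real y * green V \<psi> (Complex 0 y) - \<i>) \<le> B / y" by (simp add: z_def)
    qed
  qed
qed

lemma spectral_measure_exists:
  "\<exists>\<mu>. finite_measure \<mu> \<and> sets \<mu> = sets borel \<and> measure \<mu> UNIV = (norm \<psi>)\<^sup>2 \<and>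
    (\<forall>z. 0 < Im z \<longrightarrow> green V \<psi> z = cauchy_transform \<mu> z)"
proof -
  obtain \<phi> r where \<phi>: "norm \<phi> = 1" "\<psi> = r *\<^sub>R \<phi>" "0 \<le> r"
  proof (cases "\<psi> = 0")
    case True
    then show ?thesis using that[of "delta 0" 0] by simp
  next
    case False
    then show ?thesis using that[of "\<psi> /\<^sub>R norm \<psi>" "norm \<psi>"] by simp
  qed
  obtain \<mu> where \<mu>: "real_distribution \<mu>" "\<And>z. 0 < Im z \<Longrightarrow> green V \<phi> z = cauchy_transform \<mu> z"
    using spectral_measure_unit_exists[OF \<phi>(1)] by blast
  interpret \<mu>: real_distribution \<mu> by fact
  define \<nu> where "\<nu> = density \<mu> (\<lambda>_. ennreal (r\<^sup>2))"
  have em: "emeasure \<nu> UNIV = ennreal (r\<^sup>2)"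
  proof -
    have "emeasure \<nu> UNIV = (\<integral>\<^sup>+x. ennreal (r\<^sup>2) \<partial>\<mu>)"
      unfolding \<nu>_def by (subst emeasure_density) auto
    also have "\<dots> = ennreal (r\<^sup>2)" using \<mu>.emeasure_space_1 by simp
    finally show ?thesis .
  qed
  have "green V \<psi> z = cauchy_transform \<nu> z" if z: "0 < Im z" for z
  proof -
    have "green V \<psi> z = r\<^sup>2 *\<^sub>R green V \<phi> z"
      unfolding \<phi>(2) green_def Res_scaleR[OF Hz_nonreal[OF V less_imp_neq[OF z, symmetric]]]
      by (simp add: cinner_scaleR_left cinner_scaleR_right power2_eq_square)
    also have "\<dots> = cauchy_transform \<nu> z"
      unfolding \<mu>(2)[OF z] cauchy_transform_def \<nu>_def
      by (subst integral_density) (auto simp del: scaleR_complex.code)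
    finally show ?thesis .
  qed
  moreover have "finite_measure \<nu>" by (rule finite_measureI) (simp add: em \<nu>_def[symmetric], simp add: \<nu>_def em[unfolded \<nu>_def])
  moreover have "measure \<nu> UNIV = (norm \<psi>)\<^sup>2" using \<phi> by (simp add: measure_def em)
  moreover have "sets \<nu> = sets borel" by (simp add: \<nu>_def)
  ultimately show ?thesis by blast
qed

end

definition spectral_measure :: "(int \<Rightarrow> real) \<Rightarrow> l2 \<Rightarrow> real measure" where
  "spectral_measure V \<psi> = (SOME \<mu>. finite_measure \<mu> \<and> sets \<mu> = sets borel \<and> measure \<mu> UNIV = (norm \<psi>)\<^sup>2 \<and>
    (\<forall>z. 0 < Im z \<longrightarrow> green V \<psi> z = cauchy_transform \<mu> z))"

lemma spectral_measure:
  assumes "bounded_by V M"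
  shows "finite_measure (spectral_measure V \<psi>)" "sets (spectral_measure V \<psi>) = sets borel"
    "measure (spectral_measure V \<psi>) UNIV = (norm \<psi>)\<^sup>2"
    "0 < Im z \<Longrightarrow> cauchy_transform (spectral_measure V \<psi>) z = green V \<psi> z"
  using someI_ex[OF spectral_measure_exists[OF assms, of \<psi>], folded spectral_measure_def] by auto

section \<open>Spectral measures as quadratic functions of the vector\<close>

lemma bounded_range_indicator: "bounded (range (indicator F :: int \<Rightarrow> complex))"
  by (rule boundedI[of _ 1]) (auto simp: indicator_def)

lemma l2_truncate:
  assumes "0 < e"
  shows "\<exists>F. finite F \<and> (norm (\<psi> - mult_op (indicator F) \<psi>))\<^sup>2 < e"
proof -
  define f where "f n = (cmod (Rep_l2 \<psi> n))\<^sup>2" for n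
  have sum: "f summable_on UNIV" using Rep_l2_ell2[of \<psi>] unfolding ell2_iff f_def .
  have "(sum f \<longlongrightarrow> infsum f UNIV) (finite_subsets_at_top UNIV)"
    using has_sum_infsum[OF sum] by (simp add: has_sum_def)
  then have "\<forall>\<^sub>F F in finite_subsets_at_top UNIV. infsum f UNIV - e < sum f F"
    by (rule order_tendstoD) (use assms in simp)
  then obtain F where F: "finite F" "infsum f UNIV - e < sum f F"
    unfolding eventually_finite_subsets_at_top by blast
  have "(norm (\<psi> - mult_op (indicator F) \<psi>))\<^sup>2 = infsum f (UNIV - F)"
    unfolding norm_l2_sq
    by (rule infsum_cong_neutral) (auto simp: f_def bounded_range_indicator)
  also have "\<dots> = infsum f UNIV - infsum f F"
    by (rule infsum_Diff) (use sum F in auto)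
  also have "\<dots> < e" using F by simp
  finally show ?thesis using F by blast
qed

context
  fixes V :: "int \<Rightarrow> real" and M :: real
  assumes V: "bounded_by V M"
begin

lemma space_spectral_measure: "space (spectral_measure V \<psi>) = UNIV"
  using sets_eq_imp_space_eq[OF spectral_measure(2)[OF V]] by simp

lemma spectral_measure_le: "measure (spectral_measure V \<psi>) A \<le> (norm \<psi>)\<^sup>2"
  using finite_measure.bounded_measure[OF spectral_measure(1)[OF V], of \<psi> A]
  by (simp add: space_spectral_measure spectral_measure(3)[OF V])

text \<open>By \<open>Im_green\<close> the imaginary parts of the transforms are \<open>Im z\<close>
  times squared norms of resolvent vectors, so the parallelogram law for norms passes to the
  measures through \<open>cauchy_transform_linear_unique\<close>.\<close>

lemma spectral_measure_parallelogram:
  assumes A: "A \<in> sets borel"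
  shows "measure (spectral_measure V (\<phi> + \<xi>)) A + measure (spectral_measure V (\<phi> - \<xi>)) A =
    2 * measure (spectral_measure V \<phi>) A + 2 * measure (spectral_measure V \<xi>) A"
proof -
  define c :: "nat \<Rightarrow> real" where "c k = [1, 1, -2, -2] ! k" for k
  define \<psi> where "\<psi> k = [\<phi> + \<xi>, \<phi> - \<xi>, \<phi>, \<xi>] ! k" for k
  have "(\<Sum>k\<in>{0, 1, 2, 3}. c k * measure (spectral_measure V (\<psi> k)) A) = 0"
  proof (rule cauchy_transform_linear_unique[OF _ _ _ _ A])
    fix z :: complex assume z: "0 < Im z"
    note inv = Hz_nonreal[OF V, of z, OF z[THEN less_imp_neq, symmetric]]
    have Rdiff: "Res V z (\<phi> - \<xi>) = Res V z \<phi> - Res V z \<xi>"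
      using Res_add[OF inv, of \<phi> "- \<xi>"] Res_scaleR[OF inv, of "-1" \<xi>] by simp
    have "Im (green V (\<phi> + \<xi>) z) + Im (green V (\<phi> - \<xi>) z) = 2 * Im (green V \<phi> z) + 2 * Im (green V \<xi> z)"
      using z unfolding Im_green[OF V z[THEN less_imp_neq, symmetric]] Res_add[OF inv] Rdiff
      by (simp add: power2_norm_eq_inner inner_add_left inner_add_right inner_diff_left inner_diff_right
          inner_commute algebra_simps)
    then show "(\<Sum>k\<in>{0, 1, 2, 3}. c k * Im (cauchy_transform (spectral_measure V (\<psi> k)) z)) = 0"
      using z by (simp add: spectral_measure(4)[OF V] c_def \<psi>_def numeral_2_eq_2 numeral_3_eq_3)
  qed (auto simp: spectral_measure[OF V])
  then show ?thesis by (simp add: c_def \<psi>_def numeral_2_eq_2 numeral_3_eq_3)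
qed

lemma spectral_measure_scale:
  assumes A: "A \<in> sets borel"
  shows "measure (spectral_measure V (mult_op (\<lambda>_. a) \<psi>)) A = (cmod a)\<^sup>2 * measure (spectral_measure V \<psi>) A"
proof -
  define c where "c b = (if b then 1 else - (cmod a)\<^sup>2)" for b
  define \<phi> where "\<phi> b = (if b then mult_op (\<lambda>_. a) \<psi> else \<psi>)" for b
  have "(\<Sum>b\<in>UNIV. c b * measure (spectral_measure V (\<phi> b)) A) = 0"
  proof (rule cauchy_transform_linear_unique[OF _ _ _ _ A])
    fix z :: complex assume z: "0 < Im z"
    note inv = Hz_nonreal[OF V, of z, OF z[THEN less_imp_neq, symmetric]]
    have "green V (mult_op (\<lambda>_. a) \<psi>) z = cinner (mult_op (\<lambda>_. a) \<psi>) (mult_op (\<lambda>_. a) (Res V z \<psi>))"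
      unfolding green_def Res_mult_const[OF inv V] ..
    also have "\<dots> = cnj (a * cinner (mult_op (\<lambda>_. a) (Res V z \<psi>)) \<psi> ) * 1"
      using cinner_cnj[of "mult_op (\<lambda>_. a) (Res V z \<psi>)" "mult_op (\<lambda>_. a) \<psi>"] by (simp add: cinner_mult_op_const)
    also have "cinner (mult_op (\<lambda>_. a) (Res V z \<psi>)) \<psi> = cnj (a * green V \<psi> z)"
      using cinner_cnj[of \<psi> "mult_op (\<lambda>_. a) (Res V z \<psi>)"] by (simp add: cinner_mult_op_const green_def)
    finally have "green V (mult_op (\<lambda>_. a) \<psi>) z = (cnj a * a) * green V \<psi> z" by simp
    also have "cnj a * a = of_real ((cmod a)\<^sup>2)" unfolding complex_norm_square by (rule mult.commute)
    finally show "(\<Sum>b\<in>UNIV. c b * Im (cauchy_transform (spectral_measure V (\<phi> b)) z)) = 0"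
      using z by (simp add: spectral_measure(4)[OF V] c_def \<phi>_def UNIV_bool)
  qed (auto simp: spectral_measure[OF V])
  then show ?thesis by (simp add: c_def \<phi>_def UNIV_bool)
qed

text \<open>Discarding the measure of the difference vector from the parallelogram identity leaves a
  substitute for the triangle inequality that avoids mixed spectral measures.\<close>

lemma spectral_measure_add_le:
  "A \<in> sets borel \<Longrightarrow> measure (spectral_measure V (\<phi> + \<xi>)) A \<le>
    2 * measure (spectral_measure V \<phi>) A + 2 * measure (spectral_measure V \<xi>) A"
  using spectral_measure_parallelogram[of A \<phi> \<xi>] measure_nonneg[of "spectral_measure V (\<phi> - \<xi>)" A] by linarith

lemma spectral_measure_null_finite:
  assumes A: "A \<in> sets borel" and null: "\<And>n. measure (spectral_measure V (delta n)) A = 0" and F: "finite F"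
  shows "measure (spectral_measure V (mult_op (indicator F) \<psi>)) A = 0"
  using F
proof induction
  case empty
  have "mult_op (indicator {}) \<psi> = 0" by (rule l2_eqI) (simp add: bounded_range_indicator)
  moreover have "measure (spectral_measure V 0) A = 0"
    using spectral_measure_le[of 0 A] measure_nonneg[of "spectral_measure V 0" A] by simp
  ultimately show ?case by (simp only:)
next
  case (insert n F)
  have "mult_op (indicator (insert n F)) \<psi> = mult_op (indicator F) \<psi> + mult_op (\<lambda>_. Rep_l2 \<psi> n) (delta n)"
    by (rule l2_eqI) (use insert.hyps in \<open>auto simp: Rep_mult_op[OF bounded_range_indicator] indicator_def\<close>)
  then have "measure (spectral_measure V (mult_op (indicator (insert n F)) \<psi>)) A \<le> 0"
    using spectral_measure_add_le[OF A, of "mult_op (indicator F) \<psi>" "mult_op (\<lambda>_. Rep_l2 \<psi> n) (delta n)"]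
      insert.IH null[of n] by (simp add: spectral_measure_scale[OF A])
  then show ?case by (rule antisym[OF _ measure_nonneg])
qed

text \<open>Every vector is a finite combination of unit vectors plus a remainder of small norm,
  whose spectral measure has total mass equal to the squared norm.\<close>

lemma spectral_measure_null:
  assumes A: "A \<in> sets borel" and null: "\<And>n. measure (spectral_measure V (delta n)) A = 0"
  shows "measure (spectral_measure V \<psi>) A = 0"
proof (rule antisym)
  show "measure (spectral_measure V \<psi>) A \<le> 0"
  proof (rule field_le_epsilon)
    fix e :: real assume "0 < e"
    then obtain F where F: "finite F" "(norm (\<psi> - mult_op (indicator F) \<psi>))\<^sup>2 < e / 2"
      using l2_truncate[of "e / 2"] by auto
    have "measure (spectral_measure V (mult_op (indicator F) \<psi> + (\<psi> - mult_op (indicator F) \<psi>))) A \<le>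
        2 * 0 + 2 * measure (spectral_measure V (\<psi> - mult_op (indicator F) \<psi>)) A"
      using spectral_measure_add_le[OF A, of "mult_op (indicator F) \<psi>"] spectral_measure_null_finite[OF A null F(1)] by metis
    also have "\<dots> \<le> 2 * (norm (\<psi> - mult_op (indicator F) \<psi>))\<^sup>2" using spectral_measure_le by simp
    also have "\<dots> \<le> 0 + e" using F by simp
    finally show "measure (spectral_measure V \<psi>) A \<le> 0 + e" by simp
  qed
qed simp

section \<open>Resolvent set and null sets of spectral measures\<close>

lemma Hz_near:
  assumes inv: "boundedly_invertible (Hz V w) c" and c: "0 < c" and z: "2 * c * cmod (z - w) \<le> 1"
  shows "boundedly_invertible (Hz V z) (2 * c)"
proof -
  have cd: "c * cmod (z - w) \<le> 1 / 2" using z by simp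
  have b: "boundedly_invertible (Hz V z) (c / (1 - c * cmod (z - w)))"
    by (rule Hz_perturb[OF V V inv]) (use c cd in auto)
  have "c / (1 - c * cmod (z - w)) \<le> c / (1 / 2)"
    using c cd by (intro divide_left_mono) auto
  then have "c / (1 - c * cmod (z - w)) * norm y \<le> 2 * c * norm y" for y :: l2
    by (intro mult_right_mono) auto
  then show ?thesis using b unfolding boundedly_invertible_def by (meson order.trans)
qed

lemma open_resolvent_set: "open (resolvent_set (schroedinger V))"
  unfolding open_contains_ball
proof
  fix w assume "w \<in> resolvent_set (schroedinger V)"
  then obtain c where c: "0 < c" "boundedly_invertible (Hz V w) c" unfolding resolvent_set_iff[OF V] by blast
  have "z \<in> resolvent_set (schroedinger V)" if "z \<in> ball w (1 / (2 * c))" for z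
  proof -
    have "cmod (z - w) \<le> 1 / (2 * c)" using that by (simp add: dist_norm norm_minus_commute)
    then have "2 * c * cmod (z - w) \<le> 1" using c by (simp add: field_simps)
    from Hz_near[OF c(2,1) this] show ?thesis
      unfolding resolvent_set_iff[OF V] using c(1) by (intro exI[of _ "2 * c"]) simp
  qed
  then show "\<exists>e>0. ball w e \<subseteq> resolvent_set (schroedinger V)"
    using c by (intro exI[of _ "1 / (2 * c)"]) auto
qed

text \<open>Near \<open>E\<close> the resolvent is bounded by \<open>2 * c\<close> off the real axis
  too, so the imaginary part of the Green function, \<open>e\<close> times a squared resolvent norm,
  is of order \<open>e\<close>.\<close>

lemma spectral_measure_null_near_resolvent:
  assumes E: "complex_of_real E \<in> resolvent_set (schroedinger V)"
  shows "\<exists>r>0. \<forall>\<psi>. measure (spectral_measure V \<psi>) {E - r<..<E + r} = 0"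
proof -
  obtain c where c: "0 < c" "boundedly_invertible (Hz V (of_real E)) c"
    using E unfolding resolvent_set_iff[OF V] by blast
  \<comment> \<open>Points with both coordinates within \<open>r\<close> of \<open>E\<close> are at
    distance at most \<open>2 * r = 1 / (2 * c)\<close>, the radius that \<open>Hz_near\<close>
    allows.\<close>
  define r where "r = 1 / (4 * c)"
  have r: "r > 0" using c by (simp add: r_def)
  have "measure (spectral_measure V \<psi>) {E - r<..<E + r} = 0" for \<psi>
  proof (rule cauchy_transform_null_interval[OF spectral_measure(1,2)[OF V] r, where C="(2 * c * norm \<psi>)\<^sup>2"])
    fix s e assume se: "E - r \<le> s" "s \<le> E + r" "0 < e" "e < r"
    have "cmod (Complex s e - of_real E) \<le> \<bar>s - E\<bar> + \<bar>e\<bar>" using cmod_le[of "Complex s e - of_real E"] by simp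
    also have "\<dots> \<le> 2 * r" using se by linarith
    finally have "2 * c * cmod (Complex s e - of_real E) \<le> 2 * c * (2 * r)" using c by (intro mult_left_mono) auto
    also have "\<dots> = 1" using c by (simp add: r_def)
    finally have "boundedly_invertible (Hz V (Complex s e)) (2 * c)" by (rule Hz_near[OF c(2,1)])
    then have "norm (Res V (Complex s e) \<psi>) \<le> 2 * c * norm \<psi>" by (rule norm_Res_le)
    then have "(norm (Res V (Complex s e) \<psi>))\<^sup>2 \<le> (2 * c * norm \<psi>)\<^sup>2" by (intro power_mono) auto
    then have "e * (norm (Res V (Complex s e) \<psi>))\<^sup>2 \<le> e * (2 * c * norm \<psi>)\<^sup>2" using se by (intro mult_left_mono) auto
    then show "Im (cauchy_transform (spectral_measure V \<psi>) (Complex s e)) \<le> (2 * c * norm \<psi>)\<^sup>2 * e"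
      using se by (simp add: spectral_measure(4)[OF V] Im_green[OF V] mult.commute)
  qed
  then show ?thesis using r by blast
qed

text \<open>Without mass within distance \<open>r\<close> of \<open>E\<close>, the resolvent at
  \<open>E + i e\<close> is bounded by \<open>1 / r\<close> instead of \<open>1 / e\<close>, which
  is enough for a step down to the real axis.\<close>

lemma resolvent_set_if_null:
  assumes r: "0 < r" and null: "\<And>\<psi>. measure (spectral_measure V \<psi>) {E - r<..<E + r} = 0"
  shows "complex_of_real E \<in> resolvent_set (schroedinger V)"
proof -
  \<comment> \<open>With the constant \<open>1 / r\<close>, \<open>Hz_near\<close> reaches exactly
    the distance \<open>r / 2\<close>.\<close>
  define e where "e = r / 2"
  have e: "0 < e" using r by (simp add: e_def)
  define z where "z = Complex E e"
  have Imz: "Im z \<noteq> 0" "Im z = e" using e by (auto simp: z_def)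
  note inv = Hz_nonreal[OF V Imz(1)]
  have R: "norm (Res V z \<psi>) \<le> (1 / r) * norm \<psi>" for \<psi>
  proof -
    interpret finite_measure "spectral_measure V \<psi>" by (rule spectral_measure[OF V])
    note [measurable_cong] = spectral_measure(2)[OF V, of \<psi>]
    have "e * (norm (Res V z \<psi>))\<^sup>2 = Im (cauchy_transform (spectral_measure V \<psi>) z)"
      using Imz e by (simp add: spectral_measure(4)[OF V] Im_green[OF V])
    also have "\<dots> = (\<integral>x. e / ((x - E)\<^sup>2 + e\<^sup>2) \<partial>spectral_measure V \<psi>)"
      unfolding z_def by (rule Im_cauchy_transform[OF spectral_measure(1,2)[OF V] e])
    also have "\<dots> \<le> (\<integral>x. e / r\<^sup>2 \<partial>spectral_measure V \<psi>)"
    proof (rule integral_mono_AE')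
      have "{E - r<..<E + r} \<in> null_sets (spectral_measure V \<psi>)"
        using null[of \<psi>] by (intro null_setsI) (auto simp: emeasure_eq_measure)
      then have "AE x in spectral_measure V \<psi>. x \<notin> {E - r<..<E + r}" by (rule AE_not_in)
      then show "AE x in spectral_measure V \<psi>. e / ((x - E)\<^sup>2 + e\<^sup>2) \<le> e / r\<^sup>2"
      proof eventually_elim
        fix x assume "x \<notin> {E - r<..<E + r}"
        then have "r \<le> \<bar>x - E\<bar>" by auto
        then have "r\<^sup>2 \<le> (x - E)\<^sup>2" using r by (simp add: abs_le_square_iff[symmetric])
        then have "r\<^sup>2 \<le> (x - E)\<^sup>2 + e\<^sup>2" by (simp add: add_increasing2)
        moreover have "0 < r\<^sup>2" using r by simp
        moreover have "0 < (x - E)\<^sup>2 + e\<^sup>2" using e by (simp add: add_nonneg_pos)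
        ultimately show "e / ((x - E)\<^sup>2 + e\<^sup>2) \<le> e / r\<^sup>2" using e by (intro divide_left_mono mult_pos_pos) auto
      qed
    qed (use e in auto)
    also have "\<dots> = e * ((1 / r) * norm \<psi>)\<^sup>2"
      by (simp add: space_spectral_measure spectral_measure(3)[OF V] power_mult_distrib power_divide)
    finally have "(norm (Res V z \<psi>))\<^sup>2 \<le> ((1 / r) * norm \<psi>)\<^sup>2" using e by simp
    then show ?thesis by (rule power2_le_imp_le) (use r in simp)
  qed
  have "boundedly_invertible (Hz V z) (1 / r)"
    using inv R[of "Hz V z x" for x] unfolding boundedly_invertible_def Res_Hz[OF inv] by blast
  from Hz_near[OF this, of "of_real E"] have "boundedly_invertible (Hz V (of_real E)) (2 * (1 / r))"
  proof -
    have "of_real E - z = Complex 0 (- e)" by (simp add: z_def complex_eq_iff)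
    then have "cmod (of_real E - z) = e" using e by (simp add: cmod_def)
    then show ?thesis using Hz_near[OF \<open>boundedly_invertible (Hz V z) (1 / r)\<close>, of "of_real E"] r by (simp add: e_def)
  qed
  then show ?thesis unfolding resolvent_set_iff[OF V] using r by (intro exI[of _ "2 * (1 / r)"]) auto
qed

lemma nonreal_in_resolvent_set: "Im z \<noteq> 0 \<Longrightarrow> z \<in> resolvent_set (schroedinger V)"
  unfolding resolvent_set_iff[OF V] using Hz_nonreal[OF V, of z] by (intro exI[of _ "1 / \<bar>Im z\<bar>"]) auto

lemma op_spectrum_real:
  "op_spectrum (schroedinger V) = complex_of_real ` {x. complex_of_real x \<in> op_spectrum (schroedinger V)}"
proof -
  have "z = complex_of_real (Re z)" if "z \<in> op_spectrum (schroedinger V)" for z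
    using that nonreal_in_resolvent_set[of z] by (auto simp: op_spectrum_def complex_eq_iff)
  then show ?thesis by force
qed

lemma open_real_resolvent: "open {x. complex_of_real x \<in> resolvent_set (schroedinger V)}"
  using continuous_open_preimage[of UNIV complex_of_real, OF _ open_UNIV open_resolvent_set]
  by (simp add: vimage_def continuous_on_of_real)

text \<open>The open set of real resolvent points is covered by null intervals, of which countably
  many suffice.\<close>

lemma spectral_measure_real_resolvent:
  "{x. complex_of_real x \<in> resolvent_set (schroedinger V)} \<in> null_sets (spectral_measure V \<psi>)"
proof -
  define U where "U = {x. complex_of_real x \<in> resolvent_set (schroedinger V)}"
  interpret finite_measure "spectral_measure V \<psi>" by (rule spectral_measure[OF V])
  have "\<exists>r>0. measure (spectral_measure V \<psi>) {E - r<..<E + r} = 0" if "E \<in> U" for E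
    using spectral_measure_null_near_resolvent[of E] that by (auto simp: U_def)
  then obtain r where r: "\<And>E. E \<in> U \<Longrightarrow> r E > 0"
    "\<And>E. E \<in> U \<Longrightarrow> measure (spectral_measure V \<psi>) {E - r E<..<E + r E} = 0" by metis
  obtain F where F: "F \<subseteq> (\<lambda>E. {E - r E<..<E + r E}) ` U" "countable F" "\<Union>F = (\<Union>E\<in>U. {E - r E<..<E + r E})"
  proof (rule Lindelof)
    show "open X" if "X \<in> (\<lambda>E. {E - r E<..<E + r E}) ` U" for X using that by auto
  qed
  have "\<Union>F \<in> null_sets (spectral_measure V \<psi>)"
  proof -
    have "X \<in> null_sets (spectral_measure V \<psi>)" if "X \<in> F" for X
      using F(1) that r spectral_measure(2)[OF V, of \<psi>] by (intro null_setsI) (auto simp: emeasure_eq_measure)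
    from null_sets_UN'[OF F(2) this, of "\<lambda>x. x"] show ?thesis by simp
  qed
  moreover have "U \<subseteq> \<Union>F"
  proof
    fix E assume "E \<in> U"
    then have "E \<in> {E - r E<..<E + r E}" using r(1) by auto
    with \<open>E \<in> U\<close> show "E \<in> \<Union>F" unfolding F(3) by blast
  qed
  moreover have "U \<in> sets (spectral_measure V \<psi>)"
    using open_real_resolvent spectral_measure(2)[OF V, of \<psi>] by (simp add: U_def)
  ultimately show ?thesis unfolding U_def[symmetric] by (rule_tac null_sets_subset)
qed

text \<open>\<open>spectral_measure\<close> is tied to the Green function in the upper half plane
  only. The lower half plane follows by conjugation, and a real \<open>z\<close> in the resolvent
  set by a limit from above, dominated because no mass lies near \<open>z\<close>.\<close>

lemma is_spectral_measure_spectral_measure: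
  "is_spectral_measure (schroedinger V) (Rep_l2 \<psi>) (spectral_measure V \<psi>)"
  unfolding is_spectral_measure_def
proof (intro conjI ballI)
  let ?\<mu> = "spectral_measure V \<psi>"
  interpret finite_measure ?\<mu> by (rule spectral_measure[OF V])
  note [measurable_cong] = spectral_measure(2)[OF V, of \<psi>]
  show "finite_measure ?\<mu>" "sets ?\<mu> = sets borel" by (rule spectral_measure[OF V])+
  fix z assume zr: "z \<in> resolvent_set (schroedinger V)"
  then obtain c where c: "0 < c" "boundedly_invertible (Hz V z) c" unfolding resolvent_set_iff[OF V] by blast
  have eq: "ell2_inner (Rep_l2 \<psi>) (resolvent (schroedinger V) z (Rep_l2 \<psi>)) = green V \<psi> z"
    unfolding resolvent_Rep[OF V c(2)] green_def cinner.rep_eq ..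
  have "green V \<psi> z = cauchy_transform ?\<mu> z"
  proof -
    consider "0 < Im z" | "Im z < 0" | "Im z = 0" by linarith
    then show ?thesis
    proof cases
      case 1
      then show ?thesis by (simp add: spectral_measure(4)[OF V])
    next
      case 2
      have "green V \<psi> (cnj (cnj z)) = cnj (green V \<psi> (cnj z))"
        by (rule green_cnj[OF V Hz_nonreal[OF V] Hz_nonreal[OF V]]) (use 2 in auto)
      also have "green V \<psi> (cnj z) = cauchy_transform ?\<mu> (cnj z)" using 2 by (simp add: spectral_measure(4)[OF V])
      also have "cnj \<dots> = cauchy_transform ?\<mu> z"
        unfolding cauchy_transform_def Bochner_Integration.integral_cnj[symmetric] by simp
      finally show ?thesis by simp
    next
      case 3
      define E where "E = Re z"
      have zE: "z = of_real E" using 3 by (simp add: E_def complex_eq_iff)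
      obtain r where r: "0 < r" "measure ?\<mu> {E - r<..<E + r} = 0"
        using spectral_measure_null_near_resolvent[of E] zr zE by blast
      define \<epsilon> where "\<epsilon> n = inverse (real (Suc n)) * (1 / (2 * c))" for n
      have "\<epsilon> \<longlonglongrightarrow> 0 * (1 / (2 * c))" unfolding \<epsilon>_def by (intro tendsto_intros inverse_Suc_null)
      then have \<epsilon>lim: "\<epsilon> \<longlonglongrightarrow> 0" by simp
      have \<epsilon>: "0 < \<epsilon> n" "2 * c * \<epsilon> n \<le> 1" for n
      proof -
        show "0 < \<epsilon> n" unfolding \<epsilon>_def using c(1) by (intro mult_pos_pos) auto
        have "2 * c * \<epsilon> n = inverse (real (Suc n))" using c(1) by (simp add: \<epsilon>_def)
        also have "\<dots> \<le> 1" by (auto simp: inverse_le_1_iff)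
        finally show "2 * c * \<epsilon> n \<le> 1" .
      qed
      have dz: "Complex E (\<epsilon> n) - z = Complex 0 (\<epsilon> n)" for n by (simp add: zE complex_eq_iff)
      have cdz: "cmod (Complex E (\<epsilon> n) - z) = \<epsilon> n" for n unfolding dz using \<epsilon>(1)[of n] by (simp add: cmod_def)
      have "(\<lambda>n. green V \<psi> (Complex E (\<epsilon> n)) - green V \<psi> z) \<longlonglongrightarrow> 0"
      proof (rule Lim_null_comparison)
        show "\<forall>\<^sub>F n in sequentially. norm (green V \<psi> (Complex E (\<epsilon> n)) - green V \<psi> z) \<le>
            \<epsilon> n * (norm \<psi> * (2 * c * norm (Res V z \<psi>)))"
        proof (intro always_eventually allI)
          fix n
          have inv: "boundedly_invertible (Hz V (Complex E (\<epsilon> n))) (2 * c)"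
            by (rule Hz_near[OF c(2,1)]) (use cdz \<epsilon> in simp)
          have "norm (green V \<psi> (Complex E (\<epsilon> n)) - green V \<psi> z) \<le> norm \<psi> * norm (Res V (Complex E (\<epsilon> n)) \<psi> - Res V z \<psi>)"
            unfolding green_def cinner_diff_right[symmetric] by (rule cmod_cinner_le)
          also have "\<dots> \<le> norm \<psi> * (cmod (Complex E (\<epsilon> n) - z) * (2 * c * norm (Res V z \<psi>)))"
            by (intro mult_left_mono norm_Res_diff_le[OF V inv c(2)]) auto
          finally show "norm (green V \<psi> (Complex E (\<epsilon> n)) - green V \<psi> z) \<le> \<epsilon> n * (norm \<psi> * (2 * c * norm (Res V z \<psi>)))"
            unfolding cdz by (simp add: mult_ac)
        qed
        have "(\<lambda>n. \<epsilon> n * (norm \<psi> * (2 * c * norm (Res V z \<psi>)))) \<longlonglongrightarrow> 0 * (norm \<psi> * (2 * c * norm (Res V z \<psi>)))"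
          by (intro tendsto_intros \<epsilon>lim)
        then show "(\<lambda>n. \<epsilon> n * (norm \<psi> * (2 * c * norm (Res V z \<psi>)))) \<longlonglongrightarrow> 0" by simp
      qed
      then have "(\<lambda>n. green V \<psi> (Complex E (\<epsilon> n))) \<longlonglongrightarrow> green V \<psi> z" by (rule LIM_zero_cancel)
      moreover have "(\<lambda>n. green V \<psi> (Complex E (\<epsilon> n))) \<longlonglongrightarrow> cauchy_transform ?\<mu> z"
      proof -
        have "(\<lambda>n. \<integral>x. 1 / (complex_of_real x - Complex E (\<epsilon> n)) \<partial>?\<mu>) \<longlonglongrightarrow> (\<integral>x. 1 / (complex_of_real x - z) \<partial>?\<mu>)"
        proof (rule integral_dominated_convergence[where w="\<lambda>_. 1 / r"])
          have "{E - r<..<E + r} \<in> null_sets ?\<mu>"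
            using r by (intro null_setsI) (auto simp: emeasure_eq_measure)
          then have AE: "AE x in ?\<mu>. r \<le> \<bar>x - E\<bar>" by (rule AE_not_in[THEN AE_mp]) auto
          then show "AE x in ?\<mu>. (\<lambda>n. 1 / (complex_of_real x - Complex E (\<epsilon> n))) \<longlonglongrightarrow> 1 / (complex_of_real x - z)"
          proof eventually_elim
            fix x assume x: "r \<le> \<bar>x - E\<bar>"
            have "complex_of_real x - (of_real E + \<i> * of_real 0) \<noteq> 0" using x r(1) by auto
            then have "(\<lambda>n. 1 / (complex_of_real x - (of_real E + \<i> * of_real (\<epsilon> n)))) \<longlonglongrightarrow>
                1 / (complex_of_real x - (of_real E + \<i> * of_real 0))"
              by (intro tendsto_intros \<epsilon>lim)
            then show "(\<lambda>n. 1 / (complex_of_real x - Complex E (\<epsilon> n))) \<longlonglongrightarrow> 1 / (complex_of_real x - z)"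
              by (simp add: Complex_eq zE)
          qed
          from AE show "AE x in ?\<mu>. norm (1 / (complex_of_real x - Complex E (\<epsilon> n))) \<le> 1 / r" for n
          proof eventually_elim
            fix x assume x: "r \<le> \<bar>x - E\<bar>"
            have "r \<le> cmod (complex_of_real x - Complex E (\<epsilon> n))"
              using x abs_Re_le_cmod[of "complex_of_real x - Complex E (\<epsilon> n)"] by simp
            then show "norm (1 / (complex_of_real x - Complex E (\<epsilon> n))) \<le> 1 / r"
              using r(1) by (simp add: norm_divide frac_le)
          qed
        qed auto
        then show ?thesis using \<epsilon>(1) spectral_measure(4)[OF V] unfolding cauchy_transform_def by simp
      qed
      ultimately show ?thesis by (rule LIMSEQ_unique)
    qed
  qed
  with eq show "ell2_inner (Rep_l2 \<psi>) (resolvent (schroedinger V) z (Rep_l2 \<psi>)) = (\<integral>x. 1 / (complex_of_real x - z) \<partial>?\<mu>)"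
    by (simp add: cauchy_transform_def)
qed

text \<open>Reduces the spectral claims, except for the empty interior, to absolute continuity at
  the unit vectors. The transfer to all vectors goes through null sets, by
  \<open>spectral_measure_null\<close>.\<close>

theorem spectrum_if_delta_ac:
  assumes ac: "\<And>n. absolutely_continuous lborel (spectral_measure V (delta n))"
  defines "S \<equiv> {x. complex_of_real x \<in> op_spectrum (schroedinger V)}"
  shows "purely_ac_spectrum (schroedinger V)" "closed S" "\<And>x. x \<in> S \<Longrightarrow> x islimpt S" "emeasure lebesgue S > 0"
proof -
  have ac': "absolutely_continuous lborel (spectral_measure V \<psi>)" for \<psi>
    unfolding absolutely_continuous_def
  proof
    fix A :: "real set" assume A: "A \<in> null_sets lborel"
    then have Ab: "A \<in> sets borel" by auto
    have "measure (spectral_measure V (delta n)) A = 0" for n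
      using ac[of n] A unfolding absolutely_continuous_def by (auto simp: measure_eq_0_null_sets)
    then have "measure (spectral_measure V \<psi>) A = 0" by (rule spectral_measure_null[OF Ab])
    then show "A \<in> null_sets (spectral_measure V \<psi>)"
      using Ab spectral_measure(1,2)[OF V, of \<psi>] by (intro null_setsI) (auto simp: finite_measure.emeasure_eq_measure)
  qed
  show "purely_ac_spectrum (schroedinger V)"
    unfolding purely_ac_spectrum_def
  proof
    fix f assume "f \<in> ell2"
    then have "Rep_l2 (Abs_l2 f) = f" by (rule Abs_l2_inverse)
    then show "\<exists>\<mu>. is_spectral_measure (schroedinger V) f \<mu> \<and> absolutely_continuous lborel \<mu>"
      using is_spectral_measure_spectral_measure[of "Abs_l2 f"] ac'[of "Abs_l2 f"] by metis
  qed
  have compl: "- S = {x. complex_of_real x \<in> resolvent_set (schroedinger V)}"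
    by (auto simp: S_def op_spectrum_def)
  show cl: "closed S" unfolding closed_def compl by (rule open_real_resolvent)
  show "x islimpt S" if "x \<in> S" for x
  proof (rule ccontr)
    assume "\<not> x islimpt S"
    then obtain r where r: "0 < r" "\<And>y. y \<in> S \<Longrightarrow> dist y x < r \<Longrightarrow> y = x"
      unfolding islimpt_approachable by blast
    \<comment> \<open>The interval consists of the isolated point, null by absolute continuity, and
      of resolvent points, null as well; \<open>resolvent_set_if_null\<close> then makes
      \<open>x\<close> itself a resolvent point.\<close>
    have "measure (spectral_measure V \<psi>) {x - r<..<x + r} = 0" for \<psi>
    proof -
      have "{x} \<in> null_sets (spectral_measure V \<psi>)"
        using ac'[of \<psi>] countable_imp_null_set_lborel[of "{x}"] unfolding absolutely_continuous_def by auto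
      moreover have "- S \<in> null_sets (spectral_measure V \<psi>)"
        unfolding compl by (rule spectral_measure_real_resolvent)
      ultimately have "{x} \<union> - S \<in> null_sets (spectral_measure V \<psi>)" by (rule null_sets.Un)
      moreover have "{x - r<..<x + r} \<subseteq> {x} \<union> - S"
        using r(2) by (auto simp: dist_real_def abs_less_iff)
      moreover have "{x - r<..<x + r} \<in> sets (spectral_measure V \<psi>)" by (simp add: spectral_measure(2)[OF V])
      ultimately have "{x - r<..<x + r} \<in> null_sets (spectral_measure V \<psi>)"
        by (rule_tac null_sets_subset)
      then show ?thesis by (simp add: measure_eq_0_null_sets)
    qed
    from resolvent_set_if_null[OF r(1) this] that show False by (simp add: S_def op_spectrum_def)
  qed
  show "emeasure lebesgue S > 0"
  proof (rule ccontr)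
    assume "\<not> emeasure lebesgue S > 0"
    \<comment> \<open>A null spectrum would leave the spectral measure of \<open>delta 0\<close>
      without mass, against its total mass 1.\<close>
    then have "emeasure lborel S = 0" using cl by simp
    then have "S \<in> null_sets lborel" using cl by (intro null_setsI) auto
    then have "S \<in> null_sets (spectral_measure V (delta 0))" using ac' unfolding absolutely_continuous_def by blast
    moreover have "- S \<in> null_sets (spectral_measure V (delta 0))"
      unfolding compl by (rule spectral_measure_real_resolvent)
    ultimately have "S \<union> - S \<in> null_sets (spectral_measure V (delta 0))" by (rule null_sets.Un)
    then have "measure (spectral_measure V (delta 0)) UNIV = 0" by (simp add: measure_eq_0_null_sets)
    then show False by (simp add: spectral_measure(3)[OF V])
  qed
qed

end

section \<open>Periodic potentials\<close>

text \<open>Solutions of \<open>u (k + 1) + u (k - 1) + W k * u k = z * u k\<close> with prescribed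
  values at 0 and 1; \<open>W 1\<close> is the first potential value to enter. The values at
  \<open>p\<close> and \<open>Suc p\<close> of the solutions started with \<open>1 0\<close> and
  \<open>0 1\<close> are the columns of the monodromy matrix.\<close>

fun sol :: "(nat \<Rightarrow> real) \<Rightarrow> complex \<Rightarrow> complex \<Rightarrow> complex \<Rightarrow> nat \<Rightarrow> complex" where
  "sol W z a b 0 = a"
| "sol W z a b (Suc 0) = b"
| "sol W z a b (Suc (Suc k)) = (z - W (Suc k)) * sol W z a b (Suc k) - sol W z a b k"

lemma sol_linear: "sol W z a b k = a * sol W z 1 0 k + b * sol W z 0 1 k"
  by (induction W z a b k rule: sol.induct) (simp_all add: algebra_simps)

lemma sol_scale: "sol W z (c * a) (c * b) k = c * sol W z a b k"
  by (subst (1 2) sol_linear) (simp add: algebra_simps)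

lemma sol_wronskian: "sol W z 1 0 k * sol W z 0 1 (Suc k) - sol W z 1 0 (Suc k) * sol W z 0 1 k = 1"
  by (induction k) (simp_all add: algebra_simps)

text \<open>Limited to indices up to \<open>N\<close> so that it applies to finite pieces, such as
  one period with an artificial last value in \<open>floquet\<close>.\<close>

lemma sol_unique:
  assumes "\<And>k. Suc (Suc k) \<le> N \<Longrightarrow> u (Suc (Suc k)) = (z - W (Suc k)) * u (Suc k) - u k"
  shows "k \<le> N \<Longrightarrow> u k = sol W z (u 0) (u 1) k"
  by (induction k rule: induct_nat_012) (simp_all add: assms)

lemma tendsto_sol:
  assumes "\<And>k. ((\<lambda>t. W t k) \<longlongrightarrow> W' k) F" "(z \<longlongrightarrow> z') F"
  shows "((\<lambda>t. sol (W t) (z t) a b k) \<longlongrightarrow> sol W' z' a b k) F"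
  by (induction k rule: induct_nat_012) (auto intro!: tendsto_intros assms)

lemma sol_real: "a \<in> \<real> \<Longrightarrow> b \<in> \<real> \<Longrightarrow> sol W (of_real x) a b k \<in> \<real>"
  by (induction k rule: induct_nat_012) auto

lemma sol_poly01: "\<exists>q. (\<forall>z. sol W z 0 1 (Suc k) = poly q z) \<and> degree q = k \<and> q \<noteq> 0"
proof (induction k rule: induct_nat_012)
  case 0
  show ?case by (intro exI[of _ 1]) simp
next
  case 1
  show ?case by (intro exI[of _ "[:- of_real (W 1), 1:]"]) simp
next
  case (ge2 k)
  obtain q r where q: "\<And>z. sol W z 0 1 (Suc (Suc k)) = poly q z" "degree q = Suc k" "q \<noteq> 0"
    and r: "\<And>z. sol W z 0 1 (Suc k) = poly r z" "degree r = k"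
    using ge2 by blast
  define s where "s = [:- of_real (W (Suc (Suc k))), 1:] * q"
  have ds: "degree s = Suc (Suc k)" unfolding s_def using q by (subst degree_mult_eq) auto
  have "degree (s - r) = Suc (Suc k)"
    using degree_add_eq_left[of "- r" s] ds r(2) by simp
  moreover have "sol W z 0 1 (Suc (Suc (Suc k))) = poly (s - r) z" for z
    by (simp only: sol.simps(3)[of W z 0 1 "Suc k"] q(1) r(1)) (simp add: s_def algebra_simps)
  ultimately show ?case by (intro exI[of _ "s - r"]) auto
qed

lemma sol_poly10: "\<exists>q. (\<forall>z. sol W z 1 0 k = poly q z) \<and> degree q \<le> k - 1"
proof (induction k rule: induct_nat_012)
  case 0
  show ?case by (intro exI[of _ 1]) simp
next
  case 1
  show ?case by (intro exI[of _ 0]) simp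
next
  case (ge2 k)
  obtain q r where q: "\<And>z. sol W z 1 0 (Suc k) = poly q z" "degree q \<le> k"
    and r: "\<And>z. sol W z 1 0 k = poly r z" "degree r \<le> k - 1"
    using ge2 by auto
  define s where "s = [:- of_real (W (Suc k)), 1:] * q"
  have "degree s \<le> 1 + k" unfolding s_def using degree_mult_le[of "[:- of_real (W (Suc k)), 1:]" q] q(2) by simp
  then have "degree (s - r) \<le> Suc (Suc k) - 1" using r(2) by (intro degree_diff_le) auto
  moreover have "sol W z 1 0 (Suc (Suc k)) = poly (s - r) z" for z
    by (simp only: sol.simps(3) q(1) r(1)) (simp add: s_def algebra_simps)
  ultimately show ?case by blast
qed

text \<open>The trace of the monodromy matrix.\<close>

definition disc :: "(nat \<Rightarrow> real) \<Rightarrow> nat \<Rightarrow> complex \<Rightarrow> complex" where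
  "disc W p z = sol W z 1 0 p + sol W z 0 1 (Suc p)"

lemma disc_poly:
  assumes "0 < p"
  shows "\<exists>q. (\<forall>z. disc W p z = poly q z) \<and> degree q = p"
proof -
  obtain q where q: "\<And>z. sol W z 0 1 (Suc p) = poly q z" "degree q = p" using sol_poly01[of W p] by blast
  obtain r where r: "\<And>z. sol W z 1 0 p = poly r z" "degree r \<le> p - 1" using sol_poly10[of W p] by blast
  have "degree (r + q) = p" using degree_add_eq_right[of r q] q(2) r(2) assms by simp
  then show ?thesis using q(1) r(1) by (intro exI[of _ "r + q"]) (simp add: disc_def)
qed

text \<open>A polynomial of positive degree takes each value finitely often; for the values 2 and -2
  these points are the candidates for band edges.\<close>

lemma finite_disc_eq:
  assumes "0 < p"
  shows "finite {x. disc W p (of_real x) = c}"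
proof -
  obtain q where q: "\<And>z. disc W p z = poly q z" "degree q = p" using disc_poly[OF assms, of W] by blast
  have "q - [:c:] \<noteq> 0" using q(2) assms by auto
  then have "finite {z. poly (q - [:c:]) z = 0}" by (rule poly_roots_finite)
  then have "finite (complex_of_real -` {z. disc W p z = c})"
    by (intro finite_vimageI) (simp_all add: q(1) inj_of_real)
  then show ?thesis by (simp add: vimage_def)
qed

text \<open>At real energies the discriminant is real, so the real part loses nothing; the same
  holds for \<open>roff\<close>, the off-diagonal entry.\<close>

definition rdisc :: "(nat \<Rightarrow> real) \<Rightarrow> nat \<Rightarrow> real \<Rightarrow> real" where
  "rdisc W p x = Re (disc W p (of_real x))"

definition roff :: "(nat \<Rightarrow> real) \<Rightarrow> nat \<Rightarrow> real \<Rightarrow> real" where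
  "roff W p x = Re (sol W (of_real x) 0 1 p)"

lemma of_real_rdisc: "complex_of_real (rdisc W p x) = disc W p (of_real x)"
  unfolding rdisc_def disc_def by (intro of_real_Re Reals_add sol_real) auto

lemma of_real_roff: "complex_of_real (roff W p x) = sol W (of_real x) 0 1 p"
  unfolding roff_def by (intro of_real_Re sol_real) auto

lemma tendsto_rdisc:
  assumes "\<And>k. ((\<lambda>t. W t k) \<longlongrightarrow> W' k) F" "(x \<longlongrightarrow> x') F"
  shows "((\<lambda>t. rdisc (W t) p (x t)) \<longlongrightarrow> rdisc W' p x') F"
  unfolding rdisc_def disc_def by (intro tendsto_intros tendsto_sol assms)

lemma tendsto_roff:
  assumes "\<And>k. ((\<lambda>t. W t k) \<longlongrightarrow> W' k) F" "(x \<longlongrightarrow> x') F"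
  shows "((\<lambda>t. roff (W t) p (x t)) \<longlongrightarrow> roff W' p x') F"
  unfolding roff_def by (intro tendsto_intros tendsto_sol assms)

lemma isCont_sol: "isCont (\<lambda>z. sol W z a b k) z"
  unfolding isCont_def by (intro tendsto_sol tendsto_const tendsto_ident_at)

lemma isCont_disc: "isCont (disc W p) z"
  unfolding disc_def by (intro continuous_intros isCont_sol)

lemma isCont_rdisc: "isCont (rdisc W p) x"
  unfolding isCont_def by (intro tendsto_rdisc tendsto_const tendsto_ident_at)

lemma isCont_roff: "isCont (roff W p) x"
  unfolding isCont_def by (intro tendsto_roff tendsto_const tendsto_ident_at)

lemma finite_rdisc_eq: "0 < p \<Longrightarrow> finite {x. rdisc W p x = c}"
  using finite_disc_eq[of p W "of_real c"] by (simp add: of_real_rdisc[symmetric])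

lemma rdisc_sq_eq_4: "(rdisc W p x)\<^sup>2 = 4 \<longleftrightarrow> rdisc W p x = 2 \<or> rdisc W p x = -2"
  using power2_eq_iff[of "rdisc W p x" 2] by simp

lemma finite_band_edges: "0 < p \<Longrightarrow> finite {x. (rdisc W p x)\<^sup>2 = 4}"
  unfolding rdisc_sq_eq_4 Collect_disj_eq by (simp add: finite_rdisc_eq)

section \<open>Floquet solutions and the Green function\<close>

lemma l2_tendsto_zero: "(\<lambda>k. Rep_l2 x (n + int k)) \<longlonglongrightarrow> 0"
proof (rule metric_LIMSEQ_I)
  fix e :: real assume e: "0 < e"
  obtain F where F: "finite F" "(norm (x - mult_op (indicator F) x))\<^sup>2 < e\<^sup>2"
    using l2_truncate[of "e\<^sup>2" x] e by auto
  have lt: "norm (x - mult_op (indicator F) x) < e" by (rule power2_less_imp_less[OF F(2)]) (use e in simp)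
  obtain m where m: "\<And>j. j \<in> F \<Longrightarrow> j \<le> m" using bdd_above_finite[OF F(1)] unfolding bdd_above_def by blast
  have "dist (Rep_l2 x (n + int k)) 0 < e" if "nat (m - n + 1) \<le> k" for k
  proof -
    have "n + int k \<notin> F" using m[of "n + int k"] that by linarith
    then have "Rep_l2 (x - mult_op (indicator F) x) (n + int k) = Rep_l2 x (n + int k)"
      by (simp add: Rep_mult_op[OF bounded_range_indicator])
    then show ?thesis using cmod_Rep_le_norm[of "x - mult_op (indicator F) x" "n + int k"] lt by (simp add: dist_norm)
  qed
  then show "\<exists>N. \<forall>k\<ge>N. dist (Rep_l2 x (n + int k)) 0 < e" by blast
qed

lemma green_delta: "green V (delta n) z = Rep_l2 (Res V z (delta n)) n"
  by (simp add: green_def cinner_delta_left)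

text \<open>Sites are renumbered so that \<open>n\<close> becomes index 0; the Green function at
  \<open>n\<close> is then expressed through the monodromy matrix of the period starting
  there.\<close>

definition window :: "(int \<Rightarrow> real) \<Rightarrow> int \<Rightarrow> nat \<Rightarrow> real" where
  "window V n k = V (n + int k)"

locale periodic_potential =
  fixes V :: "int \<Rightarrow> real" and p :: nat
  assumes period: "\<And>n. V (n + int p) = V n" and p_pos: "0 < p"
begin

lemma V_mod: "V n = V (n mod int p)"
proof -
  have "V (m + int k * int p) = V m" for m k
  proof (induction k)
    case (Suc k)
    have "m + int (Suc k) * int p = (m + int k * int p) + int p" by (simp add: algebra_simps)
    then show ?case using Suc period[of "m + int k * int p"] by (simp only:)
  qed simp
  note 1 = this
  have "V (m + j * int p) = V m" for m j
  proof (cases "j \<ge> 0")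
    case True
    then show ?thesis using 1[of m "nat j"] by simp
  next
    case False
    then show ?thesis using 1[of "m + j * int p" "nat (- j)"] by (simp add: algebra_simps)
  qed
  from this[of "n mod int p" "n div int p"] show ?thesis by (simp add: mult.commute)
qed

definition bound :: real where "bound = Max ((\<lambda>n. \<bar>V n\<bar>) ` {0..<int p})"

lemma bounded: "bounded_by V bound"
  unfolding bounded_by_def
proof
  fix n
  have "n mod int p \<in> {0..<int p}" using p_pos by simp
  then have "\<bar>V (n mod int p)\<bar> \<le> bound" unfolding bound_def by (intro Max_ge) auto
  then show "\<bar>V n\<bar> \<le> bound" using V_mod[of n] by simp
qed

abbreviation W :: "int \<Rightarrow> nat \<Rightarrow> real" where "W \<equiv> window V"

lemma W_period: "W n (k + p) = W n k"
  using period[of "n + int k"] by (simp add: window_def add_ac)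

text \<open>
  The solution \<open>u\<close> of \<open>Hu = zu\<close> to the right of \<open>n\<close> that is given by \<open>(H - z)\<^sup>-\<^sup>1 \<delta>\<^sub>n\<close> and
  its translate by \<open>p\<close> both decay, so their Wronskian vanishes and \<open>u\<close> is a Floquet solution with a
  multiplier \<open>\<lambda>\<close> inside the unit disc. The symmetry of the Green function then takes care of
  the left side of \<open>n\<close>.
\<close>

lemma floquet:
  assumes z: "0 < Im z"
  shows "\<exists>l. cmod l < 1 \<and> l\<^sup>2 - disc (W n) p z * l + 1 = 0 \<and>
    (\<forall>k. Rep_l2 (Res V z (delta n)) (n + int (k * p)) = l ^ k * green V (delta n) z) \<and>
    l * sol (W n) z 0 1 p = (l\<^sup>2 - 1) * green V (delta n) z \<and> green V (delta n) z \<noteq> 0"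
proof -
  note inv = Hz_nonreal[OF bounded, of z, OF z[THEN less_imp_neq, symmetric]]
  define v where "v m = Rep_l2 (Res V z (delta m))" for m
  have rec: "v m (j + 1) + v m (j - 1) + (V j - z) * v m j = (if j = m then 1 else 0)" for m j
    using arg_cong[OF Hz_Res[OF inv, of "delta m"], of "\<lambda>x. Rep_l2 x j"]
    unfolding Rep_Hz[OF bounded] v_def by simp
  define u where "u k = v n (n + int k)" for k
  have urec: "u (Suc (Suc k)) = (z - W n (Suc k)) * u (Suc k) - u k" for k
    using rec[of n "n + int (Suc k)"] by (simp add: u_def window_def algebra_simps)
  have u: "u k = sol (W n) z (u 0) (u 1) k" for k by (rule sol_unique[of k]) (rule urec, simp)
  have up: "u (k + p) = sol (W n) z (u p) (u (Suc p)) k" for k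
  proof -
    have "u (Suc (Suc k) + p) = (z - W n (Suc k)) * u (Suc k + p) - u (k + p)" for k
      using urec[of "k + p"] W_period[of n "Suc k"] by simp
    from sol_unique[of k "\<lambda>k. u (k + p)", OF this] show ?thesis by simp
  qed
  \<comment> \<open>The Wronskian of \<open>u\<close> and its translate by \<open>p\<close>,
    constant because both solve the same recursion.\<close>
  define w where "w k = u k * u (Suc k + p) - u (Suc k) * u (k + p)" for k
  have "w (Suc k) = w k" for k
  proof -
    have "u (Suc (Suc (k + p))) = (z - W n (Suc k)) * u (Suc (k + p)) - u (k + p)"
      using urec[of "k + p"] W_period[of n "Suc k"] by simp
    then show ?thesis unfolding w_def add_Suc urec[of k] by (simp only:) (simp add: algebra_simps)
  qed
  then have "w k = w 0" for k by (induction k) auto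
  then have "w = (\<lambda>_. w 0)" by blast
  moreover have "w \<longlonglongrightarrow> 0 * 0 - 0 * 0"
  proof -
    have lim: "(\<lambda>k. u (k + j)) \<longlonglongrightarrow> 0" for j
      using l2_tendsto_zero[of "Res V z (delta n)" "n + int j"] by (simp add: u_def v_def add_ac)
    show ?thesis unfolding w_def
      using lim[of 0] lim[of 1] lim[of p] lim[of "Suc p"] by (intro tendsto_intros) simp_all
  qed
  ultimately have "w 0 = 0" using LIMSEQ_const_iff[of "w 0" 0] by simp
  then have w0: "u 0 * u (Suc p) = u 1 * u p" by (simp add: w_def)
  have G: "u 0 = green V (delta n) z" by (simp add: u_def v_def green_delta)
  have "Res V z (delta n) \<noteq> 0"
  proof
    assume "Res V z (delta n) = 0"
    then have "delta n = 0" using Hz_Res[OF inv, of "delta n"] by (simp add: linear_0[OF linear_Hz])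
    then show False using norm_delta[of n] by simp
  qed
  then have "Im (u 0) > 0" unfolding G Im_green[OF bounded z[THEN less_imp_neq, symmetric]] using z by simp
  then have u0: "u 0 \<noteq> 0" by auto
  define l where "l = u p / u 0"
  have l: "u p = l * u 0" "u (Suc p) = l * u 1"
    using u0 w0 by (simp_all add: l_def field_simps)
  have shift: "u (k + p) = l * u k" for k
    unfolding up unfolding l sol_scale using u[of k] by simp
  have pow: "u (k * p) = l ^ k * u 0" for k
  proof (induction k)
    case (Suc k)
    then show ?case using shift[of "k * p"] by (simp add: add.commute)
  qed simp
  have "cmod l < 1"
  proof (rule ccontr)
    assume "\<not> cmod l < 1"
    then have ge: "cmod (u 0) \<le> cmod (u (k * p))" for k
      unfolding pow norm_mult norm_power using one_le_power[of "cmod l" k] by (simp add: mult_le_cancel_right1)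
    have "(\<lambda>k. u (k * p)) \<longlonglongrightarrow> 0"
    proof (rule LIMSEQ_subseq_LIMSEQ[of u 0 "\<lambda>k. k * p", unfolded comp_def])
      show "u \<longlonglongrightarrow> 0" using l2_tendsto_zero[of "Res V z (delta n)" n] by (simp add: u_def[abs_def] v_def)
      show "strict_mono (\<lambda>k. k * p)" using p_pos by (simp add: strict_mono_def)
    qed
    then have "(\<lambda>k. cmod (u (k * p))) \<longlonglongrightarrow> 0" by (rule tendsto_norm_zero)
    then have "cmod (u 0) \<le> 0" by (rule LIMSEQ_le_const) (use ge in auto)
    with u0 show False by simp
  qed
  \<comment> \<open>\<open>(u 0, u 1)\<close> is an eigenvector of the monodromy matrix with rows
    \<open>(c, s)\<close> and \<open>(c', s')\<close> for the eigenvalue \<open>l\<close>; as the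
    determinant is 1, the characteristic equation is \<open>l^2 - D l + 1 = 0\<close>.\<close>
  define c s c' s' where cs: "c = sol (W n) z 1 0 p" "s = sol (W n) z 0 1 p"
    "c' = sol (W n) z 1 0 (Suc p)" "s' = sol (W n) z 0 1 (Suc p)"
  have det: "c * s' - c' * s = 1" unfolding cs by (rule sol_wronskian)
  have e1: "c * u 0 + s * u 1 = l * u 0" and e2: "c' * u 0 + s' * u 1 = l * u 1"
    using u[of p] u[of "Suc p"] sol_linear[of "W n" z "u 0" "u 1" p] sol_linear[of "W n" z "u 0" "u 1" "Suc p"] l
    by (simp_all add: cs mult.commute)
  have "u 0 * ((c - l) * (s' - l) - s * c') = (s' - l) * (c * u 0 + s * u 1 - l * u 0) - s * (c' * u 0 + s' * u 1 - l * u 1)"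
    by (simp add: algebra_simps)
  then have "(c - l) * (s' - l) - s * c' = 0" using u0 unfolding e1 e2 by simp
  moreover have "(c - l) * (s' - l) - s * c' = l\<^sup>2 - (c + s') * l + (c * s' - c' * s)"
    by (simp add: algebra_simps power2_eq_square)
  ultimately have trace: "l\<^sup>2 - disc (W n) p z * l + 1 = 0" unfolding det by (simp add: disc_def cs)
  \<comment> \<open>Self-adjointness combined with conjugation makes the resolvent kernel symmetric
    without a conjugate, so that decay to the right of \<open>n\<close> carries over to the
    left.\<close>
  have symm: "v m j = v j m" for m j
  proof -
    have conj: "Hz V (cnj z) (cnj_l2 x) = cnj_l2 (Hz V z x)" for x
      by (rule l2_eqI) (simp add: Rep_Hz[OF bounded])
    have "v m j = cinner (cnj_l2 (delta j)) (Res V z (delta m))"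
    proof -
      have "cnj_l2 (delta j) = delta j" by (rule l2_eqI) simp
      then show ?thesis by (simp add: cinner_delta_left v_def)
    qed
    also have "cnj_l2 (delta j) = Hz V (cnj z) (cnj_l2 (Res V z (delta j)))" by (simp add: conj Hz_Res[OF inv])
    also have "cinner \<dots> (Res V z (delta m)) = cinner (cnj_l2 (Res V z (delta j))) (delta m)"
      by (simp add: cinner_Hz[OF bounded] Hz_Res[OF inv])
    also have "\<dots> = cnj (cinner (delta m) (cnj_l2 (Res V z (delta j))))" by (simp add: cinner_cnj)
    also have "\<dots> = v j m" by (simp add: cinner_delta_left v_def)
    finally show ?thesis .
  qed
  have per: "v (m + int p) (j + int p) = v m j" for m j
  proof -
    have V': "V (k + int p) = V k" for k by (rule period)
    have "Res V z (delta m) = shift_op (int p) (Res V z (delta (m + int p)))"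
    proof (rule Res_eqI[OF inv], rule l2_eqI)
      fix k
      show "Rep_l2 (Hz V z (shift_op (int p) (Res V z (delta (m + int p))))) k = Rep_l2 (delta m) k"
        using rec[of "m + int p" "k + int p"] V'[of k] unfolding Rep_Hz[OF bounded] Rep_shift_op v_def[symmetric]
        by (simp add: algebra_simps)
    qed
    then show ?thesis by (simp add: v_def)
  qed
  have left: "v n (n - int p) = l * u 0"
  proof -
    have "v n (n - int p) = v (n - int p) n" by (rule symm)
    also have "\<dots> = v n (n + int p)" using per[of "n - int p" n] by simp
    finally show ?thesis using l(1) by (simp add: u_def)
  qed
  have solve: "a - d = (z - w) * b - c" if "a + c + (w - z) * b = d" for a b c d w :: complex
    using that[symmetric] by (simp add: algebra_simps)
  \<comment> \<open>The kernel on the period from \<open>n - p\<close> up to \<open>n\<close>,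
    followed by the value that continues it as a homogeneous solution. At \<open>n\<close> the
    equation has the source 1, so this value is \<open>u 1 - 1\<close> and not
    \<open>u 1\<close>.\<close>
  define y where "y k = (if k \<le> p then v n (n - int p + int k) else u 1 - 1)" for k
  have "y k = sol (W n) z (y 0) (y 1) k" if "k \<le> Suc p" for k
  proof (rule sol_unique[OF _ that])
    fix k assume k: "Suc (Suc k) \<le> Suc p"
    have Wk: "W n (Suc k) = V (n - int p + int (Suc k))"
      using period[of "n - int p + int (Suc k)"] by (simp add: window_def algebra_simps)
    have r: "v n (n - int p + int (Suc k) + 1) + y k + (W n (Suc k) - z) * y (Suc k) = (if Suc k = p then 1 else 0)"
      using rec[of n "n - int p + int (Suc k)"] k unfolding Wk by (auto simp: y_def algebra_simps)
    show "y (Suc (Suc k)) = (z - W n (Suc k)) * y (Suc k) - y k"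
    proof (cases "Suc k = p")
      case True
      then have e: "n - int p + int (Suc k) + 1 = n + 1" by simp
      have "u 1 + y k + (W n (Suc k) - z) * y (Suc k) = 1"
        using r unfolding e unfolding True by (simp add: u_def)
      from solve[OF this] have "u 1 - 1 = (z - W n (Suc k)) * y (Suc k) - y k" .
      moreover have "y (Suc (Suc k)) = u 1 - 1" using True by (simp add: y_def)
      ultimately show ?thesis by (simp only:)
    next
      case False
      then have "y (Suc (Suc k)) = v n (n - int p + int (Suc k) + 1)" using k by (simp add: y_def algebra_simps)
      moreover have "v n (n - int p + int (Suc k) + 1) + y k + (W n (Suc k) - z) * y (Suc k) = 0"
        using r False by (simp only: if_False)
      from solve[OF this] have "v n (n - int p + int (Suc k) + 1) - 0 = (z - W n (Suc k)) * y (Suc k) - y k" .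
      ultimately show ?thesis by (simp only: diff_0_right)
    qed
  qed
  note ysol = this
  have "y p = u 0" "y (Suc p) = u 1 - 1" "y 0 = l * u 0" using left by (simp_all add: y_def u_def)
  then have f1: "u 0 = c * (l * u 0) + s * y 1" and f2: "u 1 - 1 = c' * (l * u 0) + s' * y 1"
    using ysol[of p] ysol[of "Suc p"] sol_linear[of "W n" z "y 0" "y 1" p] sol_linear[of "W n" z "y 0" "y 1" "Suc p"]
    by (simp_all add: cs mult.commute)
  \<comment> \<open>The first row of the inverse monodromy matrix, \<open>(s', - s)\<close>, sends
    \<open>(u 0, u 1 - 1)\<close> to \<open>y 0 = l * u 0\<close> and the eigenvector
    \<open>(u 0, u 1)\<close> to \<open>u 0 / l\<close>. Comparing the two isolates
    \<open>s\<close>.\<close>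
  have "s' * u 0 - s * (u 1 - 1) = (c * s' - c' * s) * (l * u 0)"
    by (subst f1, subst f2) (simp add: algebra_simps)
  then have g1: "s' * u 0 - s * u 1 + s = l * u 0" unfolding det by (simp add: algebra_simps)
  have "l * (s' * u 0 - s * u 1) = s' * (l * u 0) - s * (l * u 1)" by (simp add: algebra_simps)
  also have "\<dots> = (c * s' - c' * s) * u 0" unfolding e1[symmetric] e2[symmetric] by (simp add: algebra_simps)
  finally have "l * (s' * u 0 - s * u 1) = u 0" unfolding det by simp
  then have "l * s = (l\<^sup>2 - 1) * u 0" using arg_cong[OF g1, of "\<lambda>x. l * x"] by (simp add: algebra_simps power2_eq_square)
  then show ?thesis
    using \<open>cmod l < 1\<close> trace pow u0 unfolding G[symmetric] cs by (intro exI[of _ l]) (simp add: u_def v_def)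
qed

text \<open>Squaring removes the multiplier, because \<open>(l^2 - 1)^2 = l^2 (D^2 - 4)\<close>. The
  result involves only polynomials in \<open>z\<close>, spares the choice of a branch of
  \<open>l\<close> and extends to the real axis.\<close>

lemma green_sq:
  assumes z: "0 < Im z"
  shows "(disc (W n) p z)\<^sup>2 \<noteq> 4" "(green V (delta n) z)\<^sup>2 = (sol (W n) z 0 1 p)\<^sup>2 / ((disc (W n) p z)\<^sup>2 - 4)"
proof -
  obtain l where l: "cmod l < 1" "l\<^sup>2 - disc (W n) p z * l + 1 = 0"
    "l * sol (W n) z 0 1 p = (l\<^sup>2 - 1) * green V (delta n) z"
    using floquet[OF z, of n] by blast
  define D G s where "D = disc (W n) p z" "G = green V (delta n) z" "s = sol (W n) z 0 1 p"
  note d = this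
  have l0: "l \<noteq> 0" using l(2) by auto
  have Dl: "l\<^sup>2 + 1 = D * l" using l(2) by (simp add: d algebra_simps eq_diff_eq add_eq_0_iff)
  have sq: "(l\<^sup>2 - 1)\<^sup>2 = l\<^sup>2 * (D\<^sup>2 - 4)"
  proof -
    have "(l\<^sup>2 - 1)\<^sup>2 = (l\<^sup>2 + 1)\<^sup>2 - 4 * l\<^sup>2" by (simp add: power2_eq_square algebra_simps)
    then show ?thesis unfolding Dl by (simp add: power_mult_distrib algebra_simps)
  qed
  have "l\<^sup>2 \<noteq> 1"
  proof
    assume "l\<^sup>2 = 1"
    then have "cmod l ^ 2 = 1" by (metis norm_one norm_power)
    then show False using power_strict_mono[OF l(1) norm_ge_zero, of 2] by simp
  qed
  then show D4: "(disc (W n) p z)\<^sup>2 \<noteq> 4" using sq by (auto simp: d)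
  have "l\<^sup>2 * s\<^sup>2 = l\<^sup>2 * ((D\<^sup>2 - 4) * G\<^sup>2)"
    using arg_cong[OF l(3), of "\<lambda>x. x\<^sup>2"] by (simp add: power_mult_distrib sq d mult.assoc)
  then have "s\<^sup>2 = (D\<^sup>2 - 4) * G\<^sup>2" using l0 by simp
  then show "(green V (delta n) z)\<^sup>2 = (sol (W n) z 0 1 p)\<^sup>2 / ((disc (W n) p z)\<^sup>2 - 4)"
    using D4 by (simp add: d field_simps)
qed

text \<open>The squared norm of the resolvent vector is \<open>Im G / Im z\<close>, and it dominates
  the contribution of the sites \<open>n + k p\<close>, where the kernel is geometric. When
  \<open>cmod l\<close> tends to 1 the sum grows without bound, which rules out atoms at band
  edges.\<close>

lemma floquet_sum_le:
  assumes z: "0 < Im z"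
  shows "\<exists>l. cmod l < 1 \<and> l\<^sup>2 - disc (W n) p z * l + 1 = 0 \<and>
    (\<forall>K. Im z * Im (green V (delta n) z) * (\<Sum>k<K. (cmod l ^ k)\<^sup>2) \<le> 1)"
proof -
  obtain l where l: "cmod l < 1" "l\<^sup>2 - disc (W n) p z * l + 1 = 0"
    "\<And>k. Rep_l2 (Res V z (delta n)) (n + int (k * p)) = l ^ k * green V (delta n) z" "green V (delta n) z \<noteq> 0"
    using floquet[OF z, of n] by blast
  define G where "G = green V (delta n) z"
  have "Im z * Im G * (\<Sum>k<K. (cmod l ^ k)\<^sup>2) \<le> 1" for K
  proof -
    have "(cmod G)\<^sup>2 * (\<Sum>k<K. (cmod l ^ k)\<^sup>2) = (\<Sum>k<K. (cmod (Rep_l2 (Res V z (delta n)) (n + int (k * p))))\<^sup>2)"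
      unfolding l(3) by (simp add: G_def norm_mult norm_power power_mult_distrib sum_distrib_left mult.commute)
    also have "\<dots> = (\<Sum>m\<in>(\<lambda>k. n + int (k * p)) ` {..<K}. (cmod (Rep_l2 (Res V z (delta n)) m))\<^sup>2)"
      using p_pos by (subst sum.reindex) (auto simp: inj_on_def)
    also have "\<dots> \<le> (norm (Res V z (delta n)))\<^sup>2" by (rule sum_sq_le_norm) simp
    finally have "Im z * ((cmod G)\<^sup>2 * (\<Sum>k<K. (cmod l ^ k)\<^sup>2)) \<le> Im z * (norm (Res V z (delta n)))\<^sup>2"
      using z by (intro mult_left_mono) auto
    also have "\<dots> = Im G" using z by (simp add: G_def Im_green[OF bounded])
    also have "\<dots> \<le> cmod G" using abs_Im_le_cmod[of G] by linarith
    finally have "cmod G * (Im z * cmod G * (\<Sum>k<K. (cmod l ^ k)\<^sup>2)) \<le> cmod G * 1"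
      by (simp add: power2_eq_square mult_ac)
    then have "Im z * cmod G * (\<Sum>k<K. (cmod l ^ k)\<^sup>2) \<le> 1"
      using l(4) by (subst (asm) mult_le_cancel_left_pos) (auto simp: G_def)
    moreover have "Im z * Im G * (\<Sum>k<K. (cmod l ^ k)\<^sup>2) \<le> Im z * cmod G * (\<Sum>k<K. (cmod l ^ k)\<^sup>2)"
      using z abs_Im_le_cmod[of G] by (intro mult_right_mono mult_left_mono sum_nonneg) auto
    ultimately show ?thesis by linarith
  qed
  then show ?thesis using l(1,2) unfolding G_def by blast
qed

end

text \<open>By \<open>green_sq\<close>, \<open>G^2 = s^2 / (D^2 - 4)\<close>. Inside a band the
  boundary value of \<open>G\<close> is therefore imaginary and
  \<open>Im G / pi = \<bar>s\<bar> / (pi * sqrt (4 - D^2))\<close>, with the off-diagonal entry in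
  the numerator; for the zero potential and \<open>p = 1\<close> this is the arcsine density. In
  gaps \<open>max 0\<close> gives the value 0, at band edges division by zero does.\<close>

definition band_density :: "(nat \<Rightarrow> real) \<Rightarrow> nat \<Rightarrow> real \<Rightarrow> real" where
  "band_density W p x = sqrt (max 0 ((roff W p x)\<^sup>2 / (4 - (rdisc W p x)\<^sup>2))) / pi"

lemma band_density_nonneg: "0 \<le> band_density W p x"
  by (simp add: band_density_def)

lemma band_density_eq_0: "4 \<le> (rdisc W p x)\<^sup>2 \<Longrightarrow> band_density W p x = 0"
  by (simp add: band_density_def max_absorb1 divide_nonneg_nonpos)

text \<open>Joint continuity in potential and energy off the band edges serves both the continuity
  of one density in the energy and the convergence of densities under shrinking kicks.\<close>

lemma tendsto_band_density:
  assumes "\<And>k. ((\<lambda>t. W t k) \<longlongrightarrow> W' k) F" "(x \<longlongrightarrow> x') F" "(rdisc W' p x')\<^sup>2 \<noteq> 4"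
  shows "((\<lambda>t. band_density (W t) p (x t)) \<longlongrightarrow> band_density W' p x') F"
  unfolding band_density_def by (intro tendsto_intros tendsto_rdisc tendsto_roff assms) (use assms(3) in auto)

lemma measurable_band_density [measurable]: "band_density W p \<in> borel_measurable borel"
proof -
  have [measurable]: "rdisc W p \<in> borel_measurable borel" "roff W p \<in> borel_measurable borel"
    by (auto intro!: borel_measurable_continuous_onI continuous_at_imp_continuous_on isCont_rdisc isCont_roff)
  show ?thesis unfolding band_density_def by measurable
qed

text \<open>\<open>cmod (g^2) - Re (g^2) = 2 (Im g)^2\<close>, so squaring loses \<open>Im g\<close>
  only up to its sign.\<close>

lemma Im_eq_sqrt_of_square:
  assumes "0 \<le> Im g"
  shows "Im g = sqrt ((cmod (g\<^sup>2) - Re (g\<^sup>2)) / 2)"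
proof -
  have "cmod (g\<^sup>2) - Re (g\<^sup>2) = 2 * (Im g)\<^sup>2"
    unfolding norm_power cmod_power2 by (simp add: power2_eq_square)
  then show ?thesis using assms by simp
qed

context periodic_potential
begin

text \<open>The right side of \<open>green_sq\<close>. It is continuous up to the real axis away
  from band edges and so supplies the boundary values there.\<close>

definition green_square :: "int \<Rightarrow> complex \<Rightarrow> complex" where
  "green_square n z = (sol (W n) z 0 1 p)\<^sup>2 / ((disc (W n) p z)\<^sup>2 - 4)"

definition Im_green_boundary :: "int \<Rightarrow> complex \<Rightarrow> real" where
  "Im_green_boundary n z = sqrt ((cmod (green_square n z) - Re (green_square n z)) / 2)"

lemma Im_green_eq: "0 < Im z \<Longrightarrow> Im (green V (delta n) z) = Im_green_boundary n z"
  unfolding Im_green_boundary_def green_square_def green_sq(2)[symmetric]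
  by (rule Im_eq_sqrt_of_square) (simp add: Im_green[OF bounded])

lemma Im_green_boundary_real: "Im_green_boundary n (of_real x) = pi * band_density (W n) p x"
proof -
  define q where "q = (roff (W n) p x)\<^sup>2 / ((rdisc (W n) p x)\<^sup>2 - 4)"
  have "green_square n (of_real x) = of_real q"
    unfolding green_square_def of_real_roff[symmetric] of_real_rdisc[symmetric] q_def by simp
  then have "Im_green_boundary n (of_real x) = sqrt ((\<bar>q\<bar> - q) / 2)"
    by (simp add: Im_green_boundary_def)
  also have "(\<bar>q\<bar> - q) / 2 = max 0 (- q)" by (auto simp: max_def abs_if)
  also have "- q = (roff (W n) p x)\<^sup>2 / (4 - (rdisc (W n) p x)\<^sup>2)"
    unfolding q_def by (metis minus_diff_eq minus_divide_right)
  finally show ?thesis by (simp add: band_density_def)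
qed

lemma isCont_Im_green_boundary: "(disc (W n) p z)\<^sup>2 \<noteq> 4 \<Longrightarrow> isCont (Im_green_boundary n) z"
proof -
  assume "(disc (W n) p z)\<^sup>2 \<noteq> 4"
  then have "isCont (green_square n) z"
    unfolding green_square_def by (intro continuous_intros isCont_sol isCont_disc) auto
  then show ?thesis unfolding Im_green_boundary_def isCont_def by (intro tendsto_intros) auto
qed

abbreviation \<mu> :: "int \<Rightarrow> real measure" where "\<mu> n \<equiv> spectral_measure V (delta n)"

text \<open>Away from band edges \<open>Im G\<close> stays bounded. At an edge the discriminant is
  \<open>2 s\<close> with \<open>s = 1\<close> or \<open>s = -1\<close>, the multiplier tends to the
  double root \<open>s\<close>, and \<open>floquet_sum_le\<close> yields
  \<open>a * K \<le> 1\<close> for every \<open>K\<close>.\<close>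

lemma no_atom: "measure (\<mu> n) {E} = 0"
proof -
  define \<epsilon> where "\<epsilon> k = inverse (real (Suc k))" for k
  have \<epsilon>: "0 < \<epsilon> k" "\<epsilon> \<longlonglongrightarrow> 0" for k unfolding \<epsilon>_def by (rule inverse_Suc_null)+
  define a where "a = measure (\<mu> n) {E}"
  have z: "0 < Im (Complex E (\<epsilon> k))" for k using \<epsilon>(1) by simp
  have lim: "(\<lambda>k. \<epsilon> k * Im (green V (delta n) (Complex E (\<epsilon> k)))) \<longlonglongrightarrow> a"
    using cauchy_transform_atom[OF spectral_measure(1,2)[OF bounded] \<epsilon>, of "delta n" E]
    unfolding spectral_measure(4)[OF bounded z] a_def .
  have "(\<lambda>k. of_real E + \<i> * of_real (\<epsilon> k)) \<longlonglongrightarrow> of_real E + \<i> * of_real 0" by (intro tendsto_intros \<epsilon>)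
  then have zlim: "(\<lambda>k. Complex E (\<epsilon> k)) \<longlonglongrightarrow> of_real E" by (simp add: Complex_eq)
  show ?thesis
  proof (cases "(disc (W n) p (of_real E))\<^sup>2 = 4")
    case False
    have "(\<lambda>k. Im_green_boundary n (Complex E (\<epsilon> k))) \<longlonglongrightarrow> Im_green_boundary n (of_real E)"
      by (rule isCont_tendsto_compose[OF isCont_Im_green_boundary[OF False] zlim])
    from tendsto_mult[OF \<epsilon>(2) this] have "(\<lambda>k. \<epsilon> k * Im (green V (delta n) (Complex E (\<epsilon> k)))) \<longlonglongrightarrow> 0"
      unfolding Im_green_eq[OF z] by simp
    from LIMSEQ_unique[OF lim this] show ?thesis by (simp add: a_def)
  next
    case True
    obtain s where s: "disc (W n) p (of_real E) = 2 * s" "s\<^sup>2 = 1" "cmod s = 1"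
    proof -
      have "disc (W n) p (of_real E) = 2 \<or> disc (W n) p (of_real E) = - 2"
        using True power2_eq_iff[of "disc (W n) p (of_real E)" 2] by simp
      then show ?thesis using that[of 1] that[of "-1"] by auto
    qed
    have "\<exists>l. \<forall>k. (l k)\<^sup>2 - disc (W n) p (Complex E (\<epsilon> k)) * l k + 1 = 0 \<and> cmod (l k) < 1 \<and>
        (\<forall>K. \<epsilon> k * Im (green V (delta n) (Complex E (\<epsilon> k))) * (\<Sum>j<K. (cmod (l k) ^ j)\<^sup>2) \<le> 1)"
      using floquet_sum_le[OF z, of n] by (intro choice) (simp, blast)
    then obtain l where l: "\<And>k. (l k)\<^sup>2 - disc (W n) p (Complex E (\<epsilon> k)) * l k + 1 = 0" "\<And>k. cmod (l k) < 1"
      and sum: "\<And>k K. \<epsilon> k * Im (green V (delta n) (Complex E (\<epsilon> k))) * (\<Sum>j<K. (cmod (l k) ^ j)\<^sup>2) \<le> 1"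
      by blast
    \<comment> \<open>Modulo the equation for \<open>l k\<close>, \<open>(l k - s)^2\<close> equals
      \<open>(disc - 2 s) * l k\<close>, so the discriminant controls the distance to the double
      root.\<close>
    have bd: "(cmod (l k - s))\<^sup>2 \<le> cmod (disc (W n) p (Complex E (\<epsilon> k)) - 2 * s)" for k
    proof -
      have "(l k - s)\<^sup>2 = ((l k)\<^sup>2 - disc (W n) p (Complex E (\<epsilon> k)) * l k + 1) + (disc (W n) p (Complex E (\<epsilon> k)) - 2 * s) * l k"
        using s(2) by (simp add: power2_diff algebra_simps)
      then have "(l k - s)\<^sup>2 = (disc (W n) p (Complex E (\<epsilon> k)) - 2 * s) * l k" unfolding l(1) by simp
      then have "(cmod (l k - s))\<^sup>2 = cmod (disc (W n) p (Complex E (\<epsilon> k)) - 2 * s) * cmod (l k)"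
        by (metis norm_mult norm_power)
      also have "\<dots> \<le> cmod (disc (W n) p (Complex E (\<epsilon> k)) - 2 * s)"
        using l(2)[of k] by (intro mult_left_le) auto
      finally show ?thesis .
    qed
    have "(\<lambda>k. disc (W n) p (Complex E (\<epsilon> k)) - 2 * s) \<longlonglongrightarrow> disc (W n) p (of_real E) - 2 * s"
      by (intro tendsto_diff tendsto_const isCont_tendsto_compose[OF isCont_disc zlim])
    then have "(\<lambda>k. cmod (disc (W n) p (Complex E (\<epsilon> k)) - 2 * s)) \<longlonglongrightarrow> 0" unfolding s(1) using tendsto_norm_zero by force
    then have "(\<lambda>k. (cmod (l k - s))\<^sup>2) \<longlonglongrightarrow> 0"
      by (rule tendsto_sandwich[OF _ _ tendsto_const, rotated 2]) (use bd in auto)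
    then have "(\<lambda>k. sqrt ((cmod (l k - s))\<^sup>2)) \<longlonglongrightarrow> sqrt 0" by (rule tendsto_real_sqrt)
    then have "(\<lambda>k. l k - s) \<longlonglongrightarrow> 0" by (simp add: tendsto_norm_zero_iff)
    then have "l \<longlonglongrightarrow> s" by (rule LIM_zero_cancel)
    then have "(\<lambda>k. cmod (l k)) \<longlonglongrightarrow> 1" using tendsto_norm[of l s] s(3) by simp
    then have lims: "(\<lambda>k. \<epsilon> k * Im (green V (delta n) (Complex E (\<epsilon> k))) * (\<Sum>j<K. (cmod (l k) ^ j)\<^sup>2)) \<longlonglongrightarrow> a * (\<Sum>j<K. (1 ^ j)\<^sup>2)" for K
      by (intro tendsto_intros lim)
    have "a * (\<Sum>j<K. (1 ^ j)\<^sup>2) \<le> 1" for K :: nat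
      by (rule LIMSEQ_le_const2[OF lims]) (use sum in blast)
    then have aK: "a * real K \<le> 1" for K by simp
    have "a \<le> 0"
    proof (rule ccontr)
      assume "\<not> a \<le> 0"
      then have a: "a > 0" by simp
      obtain K where "1 / a < real K" using reals_Archimedean2 by blast
      then show False using aK[of K] a by (simp add: field_simps)
    qed
    then show ?thesis unfolding a_def by (simp add: antisym)
  qed
qed

text \<open>Between band edges \<open>Im G\<close> extends continuously to the real axis, so the
  limit in the inversion formula may be taken under the integral.\<close>

lemma closed_interval_measure:
  assumes ab: "a < b" and U: "\<And>x. x \<in> {a..b} \<Longrightarrow> (rdisc (W n) p x)\<^sup>2 \<noteq> 4"
  shows "measure (\<mu> n) {a<..<b} = integral {a..b} (band_density (W n) p)"
    "continuous_on {a..b} (band_density (W n) p)"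
proof -
  define \<epsilon> where "\<epsilon> k = inverse (real (Suc k))" for k
  have \<epsilon>: "0 < \<epsilon> k" "\<epsilon> \<longlonglongrightarrow> 0" for k unfolding \<epsilon>_def by (rule inverse_Suc_null)+
  have \<epsilon>1: "\<epsilon> k \<le> 1" for k by (auto simp: \<epsilon>_def inverse_le_1_iff)
  have z: "0 < Im (Complex s (\<epsilon> k))" for s k using \<epsilon>(1) by simp
  have disc4: "(disc (W n) p (of_real x))\<^sup>2 \<noteq> 4" if "x \<in> {a..b}" for x
  proof
    assume "(disc (W n) p (of_real x))\<^sup>2 = 4"
    then have "complex_of_real ((rdisc (W n) p x)\<^sup>2) = of_real 4" by (simp add: of_real_rdisc[symmetric])
    then show False using U[OF that] unfolding of_real_eq_iff by simp
  qed
  show cont: "continuous_on {a..b} (band_density (W n) p)"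
    by (intro continuous_at_imp_continuous_on ballI) (auto simp: isCont_def intro!: tendsto_band_density U)
  let ?H = "Im_green_boundary n"
  have ct: "Im (cauchy_transform (\<mu> n) (Complex s (\<epsilon> k))) = ?H (Complex s (\<epsilon> k))" for s k
    unfolding spectral_measure(4)[OF bounded z] by (rule Im_green_eq[OF z])
  \<comment> \<open>Compactness of this box will provide the dominating constant. Its nonreal points
    are covered by \<open>disc^2 \<noteq> 4\<close> off the real axis.\<close>
  have "continuous_on (cbox (Complex a 0) (Complex b 1)) ?H"
  proof (intro continuous_at_imp_continuous_on ballI isCont_Im_green_boundary)
    fix z assume "z \<in> cbox (Complex a 0) (Complex b 1)"
    then have z: "Re z \<in> {a..b}" "0 \<le> Im z" by (auto simp: in_cbox_complex_iff)
    show "(disc (W n) p z)\<^sup>2 \<noteq> 4"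
    proof (cases "Im z = 0")
      case True
      then have "z = of_real (Re z)" by (simp add: complex_eq_iff)
      then show ?thesis using disc4[OF z(1)] by simp
    qed (use green_sq(1) z in auto)
  qed
  then have "bounded (?H ` cbox (Complex a 0) (Complex b 1))"
    by (intro compact_imp_bounded compact_continuous_image compact_cbox)
  then obtain B where B: "\<And>z. z \<in> cbox (Complex a 0) (Complex b 1) \<Longrightarrow> \<bar>?H z\<bar> \<le> B"
    unfolding bounded_iff by auto
  have "(\<lambda>k. \<integral>s. indicator {a..b} s * ?H (Complex s (\<epsilon> k)) \<partial>lborel) \<longlonglongrightarrow> (\<integral>s. indicator {a..b} s * (pi * band_density (W n) p s) \<partial>lborel)"
  proof (rule integral_dominated_convergence[where w="\<lambda>s. B * indicator {a..b} s"])
    show "(\<lambda>s. indicator {a..b} s * (pi * band_density (W n) p s)) \<in> borel_measurable lborel" by measurable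
    show "(\<lambda>s. indicator {a..b} s * ?H (Complex s (\<epsilon> k))) \<in> borel_measurable lborel" for k
      using integrable_Im_cauchy_transform[OF spectral_measure(1,2)[OF bounded] \<epsilon>(1), of a b "delta n" k]
      unfolding ct by (rule borel_measurable_integrable)
    show "integrable lborel (\<lambda>s. B * indicator {a..b} s)"
      using ab by (intro integrable_mult_right integrable_real_indicator) auto
    show "AE s in lborel. norm (indicator {a..b} s * ?H (Complex s (\<epsilon> k))) \<le> B * indicator {a..b} s" for k
      using B[of "Complex s (\<epsilon> k)" for s] \<epsilon>1[of k] \<epsilon>(1)[of k] by (auto simp: indicator_def in_cbox_complex_iff)
    have "(\<lambda>k. indicator {a..b} s * ?H (Complex s (\<epsilon> k))) \<longlonglongrightarrow> indicator {a..b} s * (pi * band_density (W n) p s)" for s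
    proof (cases "s \<in> {a..b}")
      case True
      have "(\<lambda>k. of_real s + \<i> * of_real (\<epsilon> k)) \<longlonglongrightarrow> of_real s + \<i> * of_real 0" by (intro tendsto_intros \<epsilon>)
      then have "(\<lambda>k. Complex s (\<epsilon> k)) \<longlonglongrightarrow> of_real s" by (simp add: Complex_eq)
      from isCont_tendsto_compose[OF isCont_Im_green_boundary[OF disc4[OF True]] this]
      show ?thesis using True unfolding Im_green_boundary_real by simp
    qed simp
    then show "AE s in lborel. (\<lambda>k. indicator {a..b} s * ?H (Complex s (\<epsilon> k))) \<longlonglongrightarrow> indicator {a..b} s * (pi * band_density (W n) p s)"
      by simp
  qed
  moreover have "(\<lambda>k. \<integral>s. indicator {a..b} s * ?H (Complex s (\<epsilon> k)) \<partial>lborel) \<longlonglongrightarrow> pi * measure (\<mu> n) {a<..<b}"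
    using stieltjes_inversion[OF spectral_measure(1,2)[OF bounded] ab \<epsilon>, of "delta n"] unfolding ct by (simp add: no_atom)
  ultimately have "pi * measure (\<mu> n) {a<..<b} = (\<integral>s. indicator {a..b} s * (pi * band_density (W n) p s) \<partial>lborel)"
    by (rule LIMSEQ_unique[symmetric])
  also have "\<dots> = pi * (\<integral>s. indicator {a..b} s *\<^sub>R band_density (W n) p s \<partial>lborel)"
    by (subst integral_mult_right_zero[symmetric]) (simp add: mult.left_commute)
  also have "(\<integral>s. indicator {a..b} s *\<^sub>R band_density (W n) p s \<partial>lborel) = integral {a..b} (band_density (W n) p)"
    using set_borel_integral_eq_integral(2)[OF borel_integrable_atLeastAtMost'[OF cont]]
    by (simp add: set_lebesgue_integral_def)
  finally show "measure (\<mu> n) {a<..<b} = integral {a..b} (band_density (W n) p)" by simp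
qed

lemma finite_borel_measure_\<mu>: "finite_borel_measure (\<mu> n)"
  using spectral_measure(1,2)[OF bounded] by (simp add: finite_borel_measure_def finite_borel_measure_axioms_def)

lemma measure_half_open: "measure (\<mu> n) {a<..b} = measure (\<mu> n) {a<..<b}"
proof (cases "a < b")
  case True
  interpret finite_borel_measure "\<mu> n" by (rule finite_borel_measure_\<mu>)
  have "{a<..b} = {a<..<b} \<union> {b}" using True by auto
  then show ?thesis using no_atom[of n b] finite_measure_Union[of "{a<..<b}" "{b}"]
    by (simp add: spectral_measure(2)[OF bounded])
qed simp

lemma cdf_derivative:
  assumes E: "(rdisc (W n) p E)\<^sup>2 \<noteq> 4"
  shows "(cdf (\<mu> n) has_vector_derivative band_density (W n) p E) (at E)"
proof -
  interpret finite_borel_measure "\<mu> n" by (rule finite_borel_measure_\<mu>)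
  have "open (- {x. (rdisc (W n) p x)\<^sup>2 = 4})"
    using finite_band_edges[OF p_pos] by (intro open_Compl finite_imp_closed)
  then obtain r where r: "0 < r" "cball E r \<subseteq> - {x. (rdisc (W n) p x)\<^sup>2 = 4}"
    using E open_contains_cball[of "- {x. (rdisc (W n) p x)\<^sup>2 = 4}"] by auto
  have U: "(rdisc (W n) p x)\<^sup>2 \<noteq> 4" if "x \<in> {E - r..E + r}" for x
    using r(2) that by (auto simp: cball_eq_atLeastAtMost)
  have eq: "cdf (\<mu> n) u = cdf (\<mu> n) (E - r) + integral {E - r..u} (band_density (W n) p)" if "u \<in> {E - r..E + r}" for u
  proof (cases "E - r < u")
    case True
    have "cdf (\<mu> n) u - cdf (\<mu> n) (E - r) = measure (\<mu> n) {E - r<..<u}"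
      unfolding cdf_diff_eq[OF True] by (rule measure_half_open)
    also have "\<dots> = integral {E - r..u} (band_density (W n) p)"
      by (rule closed_interval_measure(1)[OF True U]) (use that in auto)
    finally show ?thesis by simp
  qed (use that in auto)
  have cont: "continuous_on {E - r..E + r} (band_density (W n) p)"
    by (rule closed_interval_measure(2)[OF _ U]) (use r in auto)
  have "((\<lambda>u. cdf (\<mu> n) (E - r) + integral {E - r..u} (band_density (W n) p)) has_vector_derivative 0 + band_density (W n) p E) (at E within {E - r..E + r})"
    by (intro has_vector_derivative_add has_vector_derivative_const integral_has_vector_derivative[OF cont]) (use r in auto)
  then have "((\<lambda>u. cdf (\<mu> n) (E - r) + integral {E - r..u} (band_density (W n) p)) has_vector_derivative band_density (W n) p E) (at E within {E - r..E + r})"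
    by simp
  then have "(cdf (\<mu> n) has_vector_derivative band_density (W n) p E) (at E within {E - r..E + r})"
  proof (rule has_vector_derivative_transform[rotated 2])
    show "E \<in> {E - r..E + r}" using r(1) by simp
  qed (rule eq)
  then show ?thesis using r(1) by (simp add: at_within_Icc_at)
qed

text \<open>The density may be unbounded at band edges. The distribution function, however, is
  continuous, as there are no atoms, and differentiable off a finite set; the fundamental theorem of
  calculus with finitely many exceptions then covers every interval.\<close>

theorem spectral_measure_delta:
  "\<mu> n = density lborel (\<lambda>x. ennreal (band_density (W n) p x))"
proof -
  interpret finite_borel_measure "\<mu> n" by (rule finite_borel_measure_\<mu>)
  have emo: "emeasure (\<mu> n) {a<..<b} = emeasure (density lborel (\<lambda>x. ennreal (band_density (W n) p x))) {a<..<b}" for a b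
  proof (cases "a < b")
    case True
    have "(band_density (W n) p has_integral cdf (\<mu> n) b - cdf (\<mu> n) a) {a..b}"
    proof (rule fundamental_theorem_of_calculus_interior_strong[OF finite_band_edges[OF p_pos, of "W n"]])
      show "continuous_on {a..b} (cdf (\<mu> n))"
        by (intro continuous_at_imp_continuous_on ballI) (simp add: isCont_cdf no_atom)
    qed (use True cdf_derivative in auto)
    then have "(band_density (W n) p has_integral measure (\<mu> n) {a<..<b}) {a..b}"
      unfolding cdf_diff_eq[OF True] measure_half_open .
    then have "(\<integral>\<^sup>+x. ennreal (band_density (W n) p x) * indicator {a..b} x \<partial>lborel) = ennreal (measure (\<mu> n) {a<..<b})"
      by (intro nn_integral_has_integral_lebesgue') (auto simp: band_density_nonneg)
    moreover have "AE x in lborel. ennreal (band_density (W n) p x) * indicator {a..b} x = ennreal (band_density (W n) p x) * indicator {a<..<b} x"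
      using AE_lborel_singleton[of a] AE_lborel_singleton[of b] by eventually_elim (auto simp: indicator_def)
    then have "(\<integral>\<^sup>+x. ennreal (band_density (W n) p x) * indicator {a..b} x \<partial>lborel) =
        (\<integral>\<^sup>+x. ennreal (band_density (W n) p x) * indicator {a<..<b} x \<partial>lborel)"
      by (rule nn_integral_cong_AE)
    ultimately show ?thesis by (subst emeasure_density) (auto simp: emeasure_eq_measure)
  qed simp
  show ?thesis
  proof (rule measure_eqI_generator_eq[OF Int_stable_open_intervals _ _ _ _, where A="\<lambda>n. {- real n<..<real n}"])
    show "(\<Union>n. {- real n<..<real n}) = (UNIV :: real set)"
    proof (rule UNIV_eq_I[symmetric])
      fix x :: real
      obtain n where "\<bar>x\<bar> < real n" using reals_Archimedean2 by blast
      then have "x \<in> {- real n<..<real n}" by auto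
      then show "x \<in> (\<Union>n. {- real n<..<real n})" by blast
    qed
  qed (auto simp: borel_real_sigma_sets[symmetric] spectral_measure(2)[OF bounded] emo emeasure_eq_measure simp flip: emo)
qed

lemma nn_integral_band_density: "(\<integral>\<^sup>+x. ennreal (band_density (W n) p x) \<partial>lborel) = 1"
proof -
  interpret finite_measure "\<mu> n" by (rule spectral_measure(1)[OF bounded])
  have "(\<integral>\<^sup>+x. ennreal (band_density (W n) p x) \<partial>lborel) = emeasure (\<mu> n) UNIV"
    unfolding spectral_measure_delta by (subst emeasure_density) auto
  also have "\<dots> = 1" by (simp add: emeasure_eq_measure spectral_measure(3)[OF bounded])
  finally show ?thesis .
qed

lemma integrable_band_density: "integrable lborel (band_density (W n) p)"
  using nn_integral_band_density[of n] by (intro integrableI_nonneg) (auto simp: band_density_nonneg)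

text \<open>Moving the starting site conjugates the monodromy matrix and keeps its trace, so all
  sites share the same bands and gaps.\<close>

lemma disc_W: "disc (W n) p z = disc (W 0) p z"
proof -
  have step: "disc (W (n + 1)) p z = disc (W n) p z" for n
  proof -
    \<comment> \<open>A solution started one site later is extended backwards by one value, read off
      from the recursion.\<close>
    have sh: "sol (W (n + 1)) z a b k = sol (W n) z ((z - W n 1) * a - b) a (Suc k)" for a b k
    proof -
      have "sol (W n) z ((z - W n 1) * a - b) a (Suc k) = sol (W (n + 1)) z a (sol (W n) z ((z - W n 1) * a - b) a 2) k"
        using sol_unique[of k "\<lambda>k. sol (W n) z ((z - W n 1) * a - b) a (Suc k)" z "W (n + 1)"]
        by (simp add: window_def numeral_2_eq_2 add_ac)
      then show ?thesis by (simp add: numeral_2_eq_2)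
    qed
    have 1: "sol (W (n + 1)) z 1 0 p = (z - W n 1) * sol (W n) z 1 0 (Suc p) + sol (W n) z 0 1 (Suc p)"
      unfolding sh by (subst sol_linear) simp
    have 2: "sol (W (n + 1)) z 0 1 (Suc p) = - sol (W n) z 1 0 (Suc (Suc p))"
      unfolding sh by (subst sol_linear) simp
    have "W n (Suc p) = W n 1" using W_period[of n 1] by simp
    then show ?thesis unfolding disc_def 1 2 by (simp add: algebra_simps)
  qed
  show ?thesis
  proof (induction n rule: int_induct[of _ 0])
    case (step2 i)
    then show ?case using step[of "i - 1"] by simp
  qed (use step in auto)
qed

text \<open>Near \<open>E\<close> the densities vanish at every site, by \<open>disc_W\<close>. Null
  at all unit vectors means null for all vectors, hence a resolvent point.\<close>

theorem gap_in_resolvent_set: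
  assumes E: "2 < \<bar>rdisc (W 0) p E\<bar>"
  shows "complex_of_real E \<in> resolvent_set (schroedinger V)"
proof -
  have "\<forall>\<^sub>F x in at E. 2 < \<bar>rdisc (W 0) p x\<bar>"
    by (rule order_tendstoD[OF _ E]) (use isCont_rdisc in \<open>auto intro!: tendsto_intros simp: isCont_def\<close>)
  then obtain r where r: "0 < r" "\<And>x. x \<noteq> E \<Longrightarrow> dist x E < r \<Longrightarrow> 2 < \<bar>rdisc (W 0) p x\<bar>"
    unfolding eventually_at by auto
  have z: "band_density (W n) p x = 0" if "x \<in> {E - r<..<E + r}" for n x
  proof (rule band_density_eq_0)
    have "2 < \<bar>rdisc (W 0) p x\<bar>" using r(2)[of x] E that by (cases "x = E") (auto simp: dist_real_def abs_less_iff)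
    then have "2\<^sup>2 \<le> \<bar>rdisc (W 0) p x\<bar>\<^sup>2" by (intro power_mono) auto
    then show "4 \<le> (rdisc (W n) p x)\<^sup>2" by (simp add: rdisc_def disc_W[of n])
  qed
  have null: "measure (\<mu> n) {E - r<..<E + r} = 0" for n
  proof -
    have "emeasure (\<mu> n) {E - r<..<E + r} = (\<integral>\<^sup>+x. ennreal (band_density (W n) p x) * indicator {E - r<..<E + r} x \<partial>lborel)"
      unfolding spectral_measure_delta by (subst emeasure_density) auto
    also have "\<dots> = (\<integral>\<^sup>+x. 0 \<partial>(lborel :: real measure))"
      by (rule nn_integral_cong) (use z in \<open>auto simp: indicator_def\<close>)
    finally show ?thesis by (simp add: measure_def)
  qed
  show ?thesis
    by (rule resolvent_set_if_null[OF bounded r(1)]) (rule spectral_measure_null[OF bounded _ null], simp)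
qed

end

section \<open>Stability of gaps under uniformly small changes\<close>

lemma Hz_shift:
  assumes V: "bounded_by V M" and inv: "boundedly_invertible (Hz V z) c"
  shows "boundedly_invertible (Hz (\<lambda>n. V (n + a)) z) c"
proof -
  have V': "bounded_by (\<lambda>n. V (n + a)) M" using V by (simp add: bounded_by_def)
  have eq: "Hz (\<lambda>n. V (n + a)) z x = shift_op a (Hz V z (shift_op (- a) x))" for x
    by (rule l2_eqI) (simp add: Rep_Hz[OF V] Rep_Hz[OF V'] algebra_simps)
  have sh: "shift_op a (shift_op (- a) x) = x" "shift_op (- a) (shift_op a x) = x" for a x
    by (rule l2_eqI, simp)+
  show ?thesis
    unfolding boundedly_invertible_def
  proof (intro conjI allI linear_Hz)
    show "surj (Hz (\<lambda>n. V (n + a)) z)"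
    proof (rule surjI)
      show "Hz (\<lambda>n. V (n + a)) z (shift_op a (Res V z (shift_op (- a) x))) = x" for x
        by (simp add: eq sh Hz_Res[OF inv])
    qed
    show "norm x \<le> c * norm (Hz (\<lambda>n. V (n + a)) z x)" for x
    proof -
      have "norm (shift_op (- a) x) \<le> c * norm (Hz V z (shift_op (- a) x))"
        using inv unfolding boundedly_invertible_def by blast
      then show ?thesis by (simp add: eq)
    qed
  qed
qed

text \<open>The tolerance \<open>d\<close> is uniform in the translation \<open>a\<close> because
  translation preserves the bound on the inverse; this later protects the gaps along all orbits at
  once.\<close>

lemma resolvent_persistent:
  assumes V: "bounded_by V M" and fin: "finite Es" and Es: "\<And>E. E \<in> Es \<Longrightarrow> E \<in> resolvent_set (schroedinger V)"
  shows "\<exists>d>0. \<forall>V' M' a. bounded_by V' M' \<longrightarrow> (\<forall>n. \<bar>V' n - V (n + a)\<bar> \<le> d) \<longrightarrow> Es \<subseteq> resolvent_set (schroedinger V')"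
proof -
  obtain c where c: "\<And>E. E \<in> Es \<Longrightarrow> c E > 0 \<and> boundedly_invertible (Hz V E) (c E)"
    using Es unfolding resolvent_set_iff[OF V] by metis
  \<comment> \<open>The choice gives \<open>c E * d \<le> 1 / 2\<close> for each point; the extra 1
    covers an empty \<open>Es\<close>.\<close>
  define d where "d = Min (insert 1 ((\<lambda>E. 1 / (2 * c E)) ` Es))"
  have d: "d > 0" unfolding d_def using fin c by (subst Min_gr_iff) auto
  have "E \<in> resolvent_set (schroedinger V')"
    if E: "E \<in> Es" and V': "bounded_by V' M'" and dist: "\<And>n. \<bar>V' n - V (n + a)\<bar> \<le> d" for E V' M' a
  proof -
    have "d \<le> 1 / (2 * c E)" unfolding d_def using fin E by (intro Min_le) auto
    then have cd: "c E * d \<le> 1 / 2" using c[OF E] by (simp add: field_simps)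
    have sV: "bounded_by (\<lambda>n. V (n + a)) M" using V by (simp add: bounded_by_def)
    have "boundedly_invertible (Hz V' E) (c E / (1 - c E * d))"
      by (rule Hz_perturb[OF sV V' Hz_shift[OF V]]) (use c[OF E] cd dist in auto)
    then show ?thesis unfolding resolvent_set_iff[OF V'] using c[OF E] cd by (intro exI[of _ "c E / (1 - c E * d)"]) auto
  qed
  then show ?thesis using d by blast
qed

section \<open>Opening gaps\<close>

text \<open>One site per period \<open>q\<close> is changed, so that over a period the change enters
  a single step of the recursion.\<close>

definition kick :: "real \<Rightarrow> nat \<Rightarrow> (int \<Rightarrow> real) \<Rightarrow> int \<Rightarrow> real" where
  "kick t q V n = V n + (if int q dvd n then t else 0)"

context periodic_potential
begin

lemma periodic_multiple: "0 < N \<Longrightarrow> periodic_potential V (N * p)"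
proof
  fix n assume "0 < N"
  show "V (n + int (N * p)) = V n"
  proof -
    have "(n + int (N * p)) mod int p = n mod int p" by simp
    then show ?thesis by (metis V_mod)
  qed
qed (use p_pos in simp)

lemma periodic_kick:
  assumes "0 < N"
  shows "periodic_potential (kick t (N * p) V) (N * p)"
proof
  fix n
  interpret q: periodic_potential V "N * p" by (rule periodic_multiple[OF assms])
  show "kick t (N * p) V (n + int (N * p)) = kick t (N * p) V n" 
    using q.period[of n] by (simp add: kick_def del: of_nat_mult)
qed (use assms p_pos in simp)

lemma sol_block:
  "sol (W n) z a b (k + p) = sol (W n) z (sol (W n) z a b p) (sol (W n) z a b (Suc p)) k"
  using sol_unique[of k "\<lambda>k. sol (W n) z a b (k + p)" z "W n"] W_period[of n "Suc j" for j]
  by simp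

text \<open>Cayley-Hamilton for a matrix of determinant 1 and trace \<open>2 cos \<theta>\<close>:
  the \<open>N\<close>-th power of the monodromy matrix is \<open>q N\<close> times the matrix minus
  \<open>q (N - 1)\<close> times the identity, with the Chebyshev values
  \<open>q j = sin (j \<theta>) / sin \<theta>\<close>. A real argument of \<open>q\<close> admits
  \<open>q (-1) = -1\<close> at \<open>N = 0\<close>.\<close>

lemma sol_power:
  assumes th: "rdisc (W 0) p E = 2 * cos \<theta>" "sin \<theta> \<noteq> 0"
  defines "q j \<equiv> complex_of_real (sin (j * \<theta>) / sin \<theta>)"
  shows "sol (W 0) (of_real E) a b (N * p) = q (real N) * sol (W 0) (of_real E) a b p - q (real N - 1) * a \<and>
    sol (W 0) (of_real E) a b (Suc (N * p)) = q (real N) * sol (W 0) (of_real E) a b (Suc p) - q (real N - 1) * b"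
proof (induction N arbitrary: a b)
  case 0
  have "q (- 1) = - 1" using th(2) by (simp add: q_def)
  then show ?case by (simp add: q_def)
next
  case (Suc N)
  let ?s = "\<lambda>a b k. sol (W 0) (of_real E) a b k"
  define a' b' where "a' = ?s a b p" and "b' = ?s a b (Suc p)"
  have lin: "?s x y k = x * ?s 1 0 k + y * ?s 0 1 k" for x y k by (rule sol_linear)
  have det: "?s 1 0 p * ?s 0 1 (Suc p) - ?s 1 0 (Suc p) * ?s 0 1 p = 1" by (rule sol_wronskian)
  have tr: "?s 1 0 p + ?s 0 1 (Suc p) = of_real (2 * cos \<theta>)"
    using of_real_rdisc[of "W 0" p E] unfolding th(1) disc_def by simp
  have ch1: "?s a' b' p = of_real (2 * cos \<theta>) * a' - a"
  proof -
    have "?s a' b' p = (?s 1 0 p + ?s 0 1 (Suc p)) * a' - (?s 1 0 p * ?s 0 1 (Suc p) - ?s 1 0 (Suc p) * ?s 0 1 p) * a"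
      unfolding a'_def b'_def lin[of "?s a b p" "?s a b (Suc p)"] unfolding lin[of a b] by (simp only: algebra_simps)
    then show ?thesis unfolding det tr by simp
  qed
  have ch2: "?s a' b' (Suc p) = of_real (2 * cos \<theta>) * b' - b"
  proof -
    have "?s a' b' (Suc p) = (?s 1 0 p + ?s 0 1 (Suc p)) * b' - (?s 1 0 p * ?s 0 1 (Suc p) - ?s 1 0 (Suc p) * ?s 0 1 p) * b"
      unfolding a'_def b'_def lin[of "?s a b p" "?s a b (Suc p)"] unfolding lin[of a b] by (simp only: algebra_simps)
    then show ?thesis unfolding det tr by simp
  qed
  have rec: "q (real (Suc N)) = of_real (2 * cos \<theta>) * q (real N) - q (real N - 1)"
  proof -
    have "sin (real (Suc N) * \<theta>) = 2 * cos \<theta> * sin (real N * \<theta>) - sin ((real N - 1) * \<theta>)"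
      by (simp add: sin_add sin_diff distrib_right left_diff_distrib)
    then have "sin (real (Suc N) * \<theta>) / sin \<theta> = 2 * cos \<theta> * (sin (real N * \<theta>) / sin \<theta>) - sin ((real N - 1) * \<theta>) / sin \<theta>"
      by (simp add: diff_divide_distrib)
    then show ?thesis unfolding q_def by (simp only: of_real_mult of_real_diff)
  qed
  have "?s a b (Suc N * p) = ?s a' b' (N * p)" "?s a b (Suc (Suc N * p)) = ?s a' b' (Suc (N * p))"
    using sol_block[of 0 "of_real E" a b "N * p"] sol_block[of 0 "of_real E" a b "Suc (N * p)"]
    by (simp_all add: a'_def b'_def add.commute)
  then show ?case
    using Suc[of a' b'] unfolding ch1 ch2 rec by (simp add: a'_def[symmetric] b'_def[symmetric] algebra_simps)
qed

text \<open>In the window at 0 the kicked site among the indices \<open>1..N p\<close> is the last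
  one. It enters only the last step of the recursion, so the discriminant changes by
  \<open>- t\<close> times the off-diagonal entry of the long period.\<close>

lemma rdisc_kick:
  assumes th: "rdisc (W 0) p E = 2 * cos \<theta>" "sin \<theta> \<noteq> 0" and N: "0 < N"
  shows "rdisc (window (kick t (N * p) V) 0) (N * p) E =
    2 * cos (real N * \<theta>) - t * (sin (real N * \<theta>) / sin \<theta>) * roff (W 0) p E"
proof -
  let ?W = "window (kick t (N * p) V) 0"
  let ?s = "\<lambda>a b k. sol (W 0) (of_real E) a b k"
  obtain m where m: "N * p = Suc m" using N p_pos by (metis Suc_pred' nat_0_less_mult_iff)
  have W': "?W k = W 0 k" if "0 < k" "k < N * p" for k
    using that zdvd_imp_le[of "int (N * p)" "int k"] by (auto simp: window_def kick_def simp del: of_nat_mult)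
  have same: "sol ?W (of_real E) a b k = ?s a b k" if "k \<le> N * p" for a b k
    using that
  proof (induction k rule: induct_nat_012)
    case (ge2 k)
    then show ?case using W'[of "Suc k"] by simp
  qed auto
  have last: "?W (N * p) = W 0 (N * p) + t" by (simp add: window_def kick_def)
  have "sol ?W (of_real E) 0 1 (Suc (N * p)) = ?s 0 1 (Suc (N * p)) - t * ?s 0 1 (N * p)"
    using same[of "N * p" 0 1] same[of m 0 1] last unfolding m by (simp add: algebra_simps)
  then have d: "disc ?W (N * p) (of_real E) = disc (W 0) (N * p) (of_real E) - t * ?s 0 1 (N * p)"
    by (simp add: disc_def same)
  define q where "q j = complex_of_real (sin (j * \<theta>) / sin \<theta>)" for j
  note pw = sol_power[OF th, folded q_def]
  have "disc (W 0) (N * p) (of_real E) = q (real N) * disc (W 0) p (of_real E) - 2 * q (real N - 1)"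
  proof -
    have "sol (W 0) (of_real E) 1 0 (N * p) = q (real N) * sol (W 0) (of_real E) 1 0 p - q (real N - 1)"
      "sol (W 0) (of_real E) 0 1 (Suc (N * p)) = q (real N) * sol (W 0) (of_real E) 0 1 (Suc p) - q (real N - 1)"
      using pw[of 1 0 N] pw[of 0 1 N] by simp_all
    then show ?thesis unfolding disc_def by (simp only:) (simp add: algebra_simps)
  qed
  also have "\<dots> = of_real (2 * cos \<theta> * (sin (real N * \<theta>) / sin \<theta>) - 2 * (sin ((real N - 1) * \<theta>) / sin \<theta>))"
    unfolding of_real_rdisc[symmetric] th(1) q_def by simp
  also have "2 * cos \<theta> * (sin (real N * \<theta>) / sin \<theta>) - 2 * (sin ((real N - 1) * \<theta>) / sin \<theta>) = 2 * cos (real N * \<theta>)"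
    using th(2) by (simp add: sin_diff left_diff_distrib field_simps)
  finally have "disc ?W (N * p) (of_real E) = of_real (2 * cos (real N * \<theta>) - t * (sin (real N * \<theta>) / sin \<theta>) * roff (W 0) p E)"
    unfolding d using pw[of 0 1 N] by (simp add: q_def of_real_roff)
  then show ?thesis unfolding rdisc_def by simp
qed

text \<open>If the off-diagonal entry vanished, the diagonal entries would be real with product 1,
  and their sum would have modulus at least 2.\<close>

lemma roff_nonzero:
  assumes "\<bar>rdisc (W 0) p E\<bar> < 2"
  shows "roff (W 0) p E \<noteq> 0"
proof
  assume 0: "roff (W 0) p E = 0"
  define x y where "x = Re (sol (W 0) (of_real E) 1 0 p)" and "y = Re (sol (W 0) (of_real E) 0 1 (Suc p))"
  have xy: "complex_of_real x = sol (W 0) (of_real E) 1 0 p" "complex_of_real y = sol (W 0) (of_real E) 0 1 (Suc p)"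
    unfolding x_def y_def by (intro of_real_Re sol_real; simp)+
  have "complex_of_real (x * y) = 1"
    using sol_wronskian[of "W 0" "of_real E" p] 
    unfolding xy[symmetric] of_real_roff[of "W 0" p E, symmetric] 0 by simp
  then have "x * y = 1" by (metis of_real_eq_1_iff)
  moreover have "rdisc (W 0) p E = x + y" by (simp add: rdisc_def disc_def xy[symmetric] x_def[symmetric])
  moreover have "(x + y)\<^sup>2 = (x - y)\<^sup>2 + 4 * (x * y)" by (simp add: power2_eq_square algebra_simps)
  ultimately have "2\<^sup>2 \<le> \<bar>rdisc (W 0) p E\<bar>\<^sup>2" by simp
  then show False using assms power2_le_imp_le[of 2 "\<bar>rdisc (W 0) p E\<bar>"] by simp
qed

text \<open>
  Inside a band write the discriminant as \<open>2 cos \<theta>\<close>. The kicked discriminant is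
  \<open>2 (cos N\<theta> - \<kappa> sin N\<theta>)\<close> with \<open>\<kappa> \<noteq> 0\<close>, which has modulus \<open>2 sqrt (1 + \<kappa>\<^sup>2) > 2\<close> wherever
  \<open>sin N\<theta> = - \<kappa> cos N\<theta>\<close>.
\<close>

lemma kick_opens_gap:
  assumes ab: "a < b" and band: "\<And>E. a < E \<Longrightarrow> E < b \<Longrightarrow> complex_of_real E \<notin> resolvent_set (schroedinger V)"
  shows "\<exists>N0. \<forall>N\<ge>N0. \<forall>t. t \<noteq> 0 \<longrightarrow> 0 < N \<longrightarrow>
    (\<exists>E. a < E \<and> E < b \<and> 2 < \<bar>rdisc (window (kick t (N * p) V) 0) (N * p) E\<bar>)"
proof -
  let ?D = "rdisc (W 0) p"
  have le2: "\<bar>?D E\<bar> \<le> 2" if "a < E" "E < b" for E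
    using gap_in_resolvent_set[of E] band[OF that] by force
  \<comment> \<open>Band edges are removed to keep the discriminant strictly between -2 and 2, where
    \<open>\<theta>\<close> is continuous and \<open>sin \<theta>\<close> positive.\<close>
  define U where "U = {a<..<b} - {x. (?D x)\<^sup>2 = 4}"
  have finU: "finite {x. (?D x)\<^sup>2 = 4}" by (rule finite_band_edges[OF p_pos])
  have "open U" unfolding U_def using finU by (intro open_Diff finite_imp_closed) auto
  moreover have "U \<noteq> {}"
    unfolding U_def using infinite_Ioo[OF ab] finU by (metis Diff_eq_empty_iff finite_subset)
  ultimately obtain x r where r: "0 < r" "cball x r \<subseteq> U" by (meson all_not_in_conv open_contains_cball)
  \<comment> \<open>A second point with a different discriminant forces \<open>\<theta>\<close> to
    move; it exists because level sets are finite.\<close>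
  have "{x<..<x + r} - {y. ?D y = ?D x} \<noteq> {}"
    using infinite_Ioo[of x "x + r"] r(1) finite_rdisc_eq[OF p_pos, of "W 0" "?D x"]
    by (metis Diff_eq_empty_iff finite_subset less_add_same_cancel1)
  then obtain y where "y \<in> {x<..<x + r} - {y. ?D y = ?D x}" by blast
  then have y: "x < y" "y < x + r" "?D y \<noteq> ?D x" by auto
  have I: "a < E \<and> E < b \<and> \<bar>?D E\<bar> < 2" if "E \<in> {x..y}" for E
  proof -
    have "E \<in> cball x r" using that y by (simp add: dist_real_def)
    then have E: "a < E" "E < b" "(?D E)\<^sup>2 \<noteq> 4" using r(2) by (auto simp: U_def)
    then have "\<bar>?D E\<bar> \<noteq> 2" by (metis four_x_squared mult_2 numeral_Bit0 one_add_one power2_abs power2_eq_square mult_2_right)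
    then show ?thesis using E le2[of E] by simp
  qed
  define \<theta> where "\<theta> E = arccos (?D E / 2)" for E
  have \<theta>: "?D E = 2 * cos (\<theta> E)" "0 < sin (\<theta> E)" if "E \<in> {x..y}" for E
  proof -
    have "-1 < ?D E / 2" "?D E / 2 < 1" using I[OF that] by auto
    then show "?D E = 2 * cos (\<theta> E)" "0 < sin (\<theta> E)"
      unfolding \<theta>_def using arccos_lt_bounded[of "?D E / 2"] by (auto intro: sin_gt_zero)
  qed
  have contD: "continuous_on {x..y} ?D" by (intro continuous_at_imp_continuous_on ballI isCont_rdisc)
  have cont\<theta>: "continuous_on {x..y} \<theta>"
    unfolding \<theta>_def
  proof (intro continuous_intros contD ballI)
    show "- 1 \<le> ?D E / 2 \<and> ?D E / 2 \<le> 1" if "E \<in> {x..y}" for E using I[OF that] by auto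
  qed auto
  have \<theta>xy: "\<theta> x \<noteq> \<theta> y" using \<theta>(1)[of x] \<theta>(1)[of y] y by auto
  \<comment> \<open>Chosen so that \<open>N \<theta>\<close> sweeps an interval of length at least
    \<open>2 pi\<close> and so passes two consecutive multiples of pi.\<close>
  define N0 where "N0 = nat \<lceil>2 * pi / \<bar>\<theta> y - \<theta> x\<bar>\<rceil>"
  have "\<exists>E. a < E \<and> E < b \<and> 2 < \<bar>rdisc (window (kick t (N * p) V) 0) (N * p) E\<bar>"
    if N: "N0 \<le> N" and t: "t \<noteq> 0" and Npos: "0 < N" for N t
  proof -
    define \<kappa> where "\<kappa> E = t * roff (W 0) p E / (2 * sin (\<theta> E))" for E
    define X where "X E = real N * \<theta> E" for E
    have contX: "continuous_on {x..y} X" unfolding X_def by (intro continuous_intros cont\<theta>)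
    have cont\<kappa>: "continuous_on {x..y} \<kappa>"
      unfolding \<kappa>_def using \<theta>(2)
      by (intro continuous_intros cont\<theta> continuous_at_imp_continuous_on ballI isCont_roff) force
    have \<kappa>0: "\<kappa> E \<noteq> 0" if "E \<in> {x..y}" for E
      using t roff_nonzero[of E] I[OF that] \<theta>(2)[OF that] by (simp add: \<kappa>_def)
    have hit: "\<exists>E\<in>{x..y}. f E = v" if "continuous_on {x..y} f" "E1 \<in> {x..y}" "E2 \<in> {x..y}" "f E1 \<le> v" "v \<le> f E2"
      for f :: "real \<Rightarrow> real" and v E1 E2
    proof -
      have "connected (f ` {x..y})" by (intro connected_continuous_image that connected_Icc)
      then have "v \<in> f ` {x..y}" by (rule connectedD_interval) (use that in auto)
      then show ?thesis by blast
    qed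
    have "2 * pi / \<bar>\<theta> y - \<theta> x\<bar> \<le> real N" using N unfolding N0_def by linarith
    then have "2 * pi \<le> real N * \<bar>\<theta> y - \<theta> x\<bar>" using \<theta>xy by (simp add: field_simps)
    also have "\<dots> = \<bar>X y - X x\<bar>" by (simp add: X_def abs_mult right_diff_distrib[symmetric])
    finally have big: "2 * pi \<le> \<bar>X y - X x\<bar>" .
    define lo where "lo = min (X x) (X y)"
    define hi where "hi = max (X x) (X y)"
    have lohi: "lo + 2 * pi \<le> hi" using big by (auto simp: lo_def hi_def)
    have hitX: "\<exists>E\<in>{x..y}. X E = v" if "lo \<le> v" "v \<le> hi" for v
      using hit[OF contX, of x y v] hit[OF contX, of y x v] that y(1) by (auto simp: lo_def hi_def min_def max_def split: if_splits)
    define m where "m = \<lceil>lo / pi\<rceil>"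
    have "lo / pi \<le> of_int m" "of_int m < lo / pi + 1" unfolding m_def by linarith+
    then have m: "lo \<le> of_int m * pi" "of_int m * pi \<le> lo + pi" using pi_gt_zero by (simp_all add: field_simps)
    obtain E1 where E1: "E1 \<in> {x..y}" "X E1 = of_int m * pi"
      using hitX[of "of_int m * pi"] m lohi pi_gt_zero by force
    obtain E2 where E2: "E2 \<in> {x..y}" "X E2 = of_int m * pi + pi"
      using hitX[of "of_int m * pi + pi"] m lohi pi_gt_zero by force
    \<comment> \<open>Between these multiples of pi \<open>cos\<close> changes its sign, while
      \<open>\<kappa>\<close>, continuous and without zeros, keeps its own; hence \<open>g\<close>
      takes opposite signs at \<open>E1\<close> and \<open>E2\<close> and has a zero.\<close>
    define g where "g E = sin (X E) + \<kappa> E * cos (X E)" for E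
    have contg: "continuous_on {x..y} g" unfolding g_def by (intro continuous_intros contX cont\<kappa>)
    have s0: "sin (of_int m * pi) = 0" using sin_integer_2pi[of m] by (simp add: sin_zero_iff_int2)
    have c0: "cos (of_int m * pi) \<noteq> 0" using sin_cos_squared_add[of "of_int m * pi"] s0 by auto
    have gE: "g E1 = \<kappa> E1 * cos (of_int m * pi)" "g E2 = - \<kappa> E2 * cos (of_int m * pi)"
      unfolding g_def E1 E2 using s0 by (simp_all add: sin_add cos_add)
    have "0 < \<kappa> E1 * \<kappa> E2"
    proof (rule ccontr)
      assume "\<not> 0 < \<kappa> E1 * \<kappa> E2"
      then have "\<kappa> E1 \<le> 0 \<and> 0 \<le> \<kappa> E2 \<or> \<kappa> E2 \<le> 0 \<and> 0 \<le> \<kappa> E1"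
        by (auto simp: not_less mult_le_0_iff)
      then obtain E where "E \<in> {x..y}" "\<kappa> E = 0"
        using hit[OF cont\<kappa> E1(1) E2(1), of 0] hit[OF cont\<kappa> E2(1) E1(1), of 0] by blast
      then show False using \<kappa>0 by blast
    qed
    then have "0 < (\<kappa> E1 * \<kappa> E2) * (cos (of_int m * pi))\<^sup>2" using c0 by simp
    then have "g E1 * g E2 < 0" unfolding gE by (simp add: power2_eq_square mult_ac)
    then have "g E1 \<le> 0 \<and> 0 \<le> g E2 \<or> g E2 \<le> 0 \<and> 0 \<le> g E1" by (auto simp: mult_less_0_iff)
    then obtain E where E: "E \<in> {x..y}" "g E = 0"
      using hit[OF contg E1(1) E2(1), of 0] hit[OF contg E2(1) E1(1), of 0] by blast
    have sE: "sin (X E) = - \<kappa> E * cos (X E)" using E(2) by (simp add: g_def)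
    have "(cos (X E))\<^sup>2 * (1 + (\<kappa> E)\<^sup>2) = 1"
      using sin_cos_squared_add[of "X E"] unfolding sE by (simp add: power2_eq_square algebra_simps)
    then have "(cos (X E) * (1 + (\<kappa> E)\<^sup>2))\<^sup>2 = 1 + (\<kappa> E)\<^sup>2"
      by (simp add: power_mult_distrib power2_eq_square[of "1 + (\<kappa> E)\<^sup>2"] mult.assoc[symmetric])
    moreover have "0 < (\<kappa> E)\<^sup>2" using \<kappa>0[OF E(1)] by simp
    ultimately have "1\<^sup>2 < \<bar>cos (X E) * (1 + (\<kappa> E)\<^sup>2)\<bar>\<^sup>2" by simp
    then have gt1: "1 < \<bar>cos (X E) * (1 + (\<kappa> E)\<^sup>2)\<bar>" by (rule power2_less_imp_less) simp
    have "rdisc (window (kick t (N * p) V) 0) (N * p) E = 2 * cos (X E) - t * (sin (X E) / sin (\<theta> E)) * roff (W 0) p E"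
      using rdisc_kick[OF \<theta>(1)[OF E(1)] _ Npos, of t] \<theta>(2)[OF E(1)] by (simp add: X_def)
    also have "t * (sin (X E) / sin (\<theta> E)) * roff (W 0) p E = 2 * (\<kappa> E * sin (X E))" by (simp add: \<kappa>_def)
    also have "2 * cos (X E) - 2 * (\<kappa> E * sin (X E)) = 2 * (cos (X E) * (1 + (\<kappa> E)\<^sup>2))"
      unfolding sE by (simp add: power2_eq_square algebra_simps)
    finally have "2 < \<bar>rdisc (window (kick t (N * p) V) 0) (N * p) E\<bar>" using gt1 by simp
    then show ?thesis using I[OF E(1)] by blast
  qed
  then show ?thesis by blast
qed

end

section \<open>Small kicks: closeness in L1 and gaps in finitely many intervals\<close>

lemma (in periodic_potential) window_mod: "W n = W (n mod int p)"
proof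
  fix k
  have "(n + int k) mod int p = (n mod int p + int k) mod int p" by (simp add: mod_add_left_eq)
  then show "W n k = W (n mod int p) k" unfolding window_def by (metis V_mod)
qed

text \<open>The formulas for the periods \<open>p\<close> and \<open>N * p\<close> look different,
  but both give the density of the same spectral measure.\<close>

lemma (in periodic_potential) band_density_multiple:
  assumes "0 < N"
  shows "AE x in lborel. band_density (W n) (N * p) x = band_density (W n) p x"
proof -
  interpret q: periodic_potential V "N * p" by (rule periodic_multiple[OF assms])
  have "density lborel (\<lambda>x. ennreal (band_density (W n) (N * p) x)) = density lborel (\<lambda>x. ennreal (band_density (W n) p x))"
    using spectral_measure_delta[of n] q.spectral_measure_delta[of n] by simp
  then have "AE x in lborel. ennreal (band_density (W n) (N * p) x) = ennreal (band_density (W n) p x)"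
    by (subst sigma_finite_measure.density_unique_iff[OF sigma_finite_lborel, symmetric]) auto
  then show ?thesis by eventually_elim (simp add: band_density_nonneg)
qed

text \<open>Scheffe: the densities are nonnegative and of equal mass, so convergence almost
  everywhere suffices. It holds off the finitely many band edges for the period
  \<open>N * p\<close>, where the density depends continuously on the potential.\<close>

lemma (in periodic_potential) kick_L1:
  assumes N: "0 < N" and t: "t \<longlonglongrightarrow> 0"
  shows "(\<lambda>k. \<integral>\<^sup>+x. ennreal (norm (band_density (window (kick (t k) (N * p) V) n) (N * p) x - band_density (W n) p x)) \<partial>lborel)
    \<longlonglongrightarrow> 0"
proof (rule Scheffe_lemma2)
  interpret q: periodic_potential V "N * p" by (rule periodic_multiple[OF N])
  interpret K: periodic_potential "kick (t k) (N * p) V" "N * p" for k by (rule periodic_kick[OF N])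
  show "band_density (window (kick (t k) (N * p) V) n) (N * p) \<in> borel_measurable lborel" for k by simp
  show "integrable lborel (band_density (W n) p)" by (rule integrable_band_density)
  show "(\<integral>\<^sup>+x. ennreal (norm (band_density (window (kick (t k) (N * p) V) n) (N * p) x)) \<partial>lborel)
      \<le> (\<integral>\<^sup>+x. ennreal (norm (band_density (W n) p x)) \<partial>lborel)" for k
    using K.nn_integral_band_density[of k n] nn_integral_band_density[of n] by (simp add: band_density_nonneg)
  have kick: "(\<lambda>k. window (kick (t k) (N * p) V) n j) \<longlonglongrightarrow> W n j" for j
  proof -
    have "(\<lambda>k. if int (N * p) dvd n + int j then t k else 0) \<longlonglongrightarrow> 0"
      using t by (cases "int (N * p) dvd n + int j") (simp_all del: of_nat_mult)
    from tendsto_add[OF tendsto_const this] show ?thesis unfolding window_def kick_def by simp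
  qed
  have "{x. (rdisc (W n) (N * p) x)\<^sup>2 = 4} \<in> null_sets lborel"
    using finite_band_edges[OF q.p_pos] by (rule finite_imp_null_set_lborel)
  from AE_not_in[OF this] have "AE x in lborel. (rdisc (W n) (N * p) x)\<^sup>2 \<noteq> 4" by simp
  with band_density_multiple[OF N, of n]
  show "AE x in lborel. (\<lambda>k. band_density (window (kick (t k) (N * p) V) n) (N * p) x) \<longlonglongrightarrow> band_density (W n) p x"
  proof eventually_elim
    fix x assume x: "band_density (W n) (N * p) x = band_density (W n) p x" "(rdisc (W n) (N * p) x)\<^sup>2 \<noteq> 4"
    show "(\<lambda>k. band_density (window (kick (t k) (N * p) V) n) (N * p) x) \<longlonglongrightarrow> band_density (W n) p x"
      unfolding x(1)[symmetric] by (rule tendsto_band_density[OF kick tendsto_const x(2)])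
  qed
qed

text \<open>Either the interval already meets the resolvent set of \<open>V\<close>, and that point
  survives small kicks, or it lies in the spectrum and \<open>kick_opens_gap\<close>
  applies.\<close>

lemma (in periodic_potential) kick_gap:
  assumes ab: "a < b" and t: "\<And>k. 0 < t k" "t \<longlonglongrightarrow> 0"
  shows "\<exists>N0. \<forall>N\<ge>N0. 0 < N \<longrightarrow> (\<forall>\<^sub>F k in sequentially.
    \<exists>E. a < E \<and> E < b \<and> complex_of_real E \<in> resolvent_set (schroedinger (kick (t k) (N * p) V)))"
proof (cases "\<exists>E. a < E \<and> E < b \<and> complex_of_real E \<in> resolvent_set (schroedinger V)")
  case True
  then obtain E where E: "a < E" "E < b" "complex_of_real E \<in> resolvent_set (schroedinger V)" by blast
  obtain d where d: "0 < d" "\<And>V' M' a. bounded_by V' M' \<Longrightarrow> (\<And>n. \<bar>V' n - V (n + a)\<bar> \<le> d) \<Longrightarrow>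
      {complex_of_real E} \<subseteq> resolvent_set (schroedinger V')"
    using resolvent_persistent[OF bounded, of "{complex_of_real E}"] E(3) by auto
  have "\<forall>\<^sub>F k in sequentially. \<exists>E. a < E \<and> E < b \<and> complex_of_real E \<in> resolvent_set (schroedinger (kick (t k) (N * p) V))"
    if N: "0 < N" for N
  proof -
    interpret K: periodic_potential "kick (t k) (N * p) V" "N * p" for k by (rule periodic_kick[OF N])
    have "\<forall>\<^sub>F k in sequentially. t k < d" by (rule order_tendstoD(2)[OF t(2) d(1)])
    then show ?thesis
    proof eventually_elim
      fix k assume k: "t k < d"
      have "{complex_of_real E} \<subseteq> resolvent_set (schroedinger (kick (t k) (N * p) V))"
        by (rule d(2)[OF K.bounded, where a=0]) (use k t(1)[of k] d(1) in \<open>auto simp: kick_def\<close>)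
      then show "\<exists>E. a < E \<and> E < b \<and> complex_of_real E \<in> resolvent_set (schroedinger (kick (t k) (N * p) V))"
        using E(1,2) by blast
    qed
  qed
  then show ?thesis by blast
next
  case False
  then obtain N0 where N0: "\<And>N s. N0 \<le> N \<Longrightarrow> s \<noteq> 0 \<Longrightarrow> 0 < N \<Longrightarrow>
      \<exists>E. a < E \<and> E < b \<and> 2 < \<bar>rdisc (window (kick s (N * p) V) 0) (N * p) E\<bar>"
    using kick_opens_gap[OF ab] by blast
  have "\<exists>E. a < E \<and> E < b \<and> complex_of_real E \<in> resolvent_set (schroedinger (kick (t k) (N * p) V))"
    if N: "N0 \<le> N" "0 < N" for N k
  proof -
    interpret K: periodic_potential "kick (t k) (N * p) V" "N * p" by (rule periodic_kick[OF N(2)])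
    show ?thesis using N0[OF N(1) _ N(2), of "t k"] t(1)[of k] K.gap_in_resolvent_set by force
  qed
  then show ?thesis by (intro exI[of _ N0]) (auto intro: always_eventually)
qed

text \<open>The order of the quantifiers matters: the threshold \<open>N0\<close> comes first, then
  \<open>N\<close> is dictated by an available quotient, and only then is \<open>t\<close> made
  small. Uniformity over all sites reduces to the residues modulo \<open>N * p\<close>.\<close>

theorem (in periodic_potential) kick_step:
  assumes J: "finite J" "\<And>j. j \<in> J \<Longrightarrow> a j < b j" and eta: "0 < (\<eta> :: real)"
  shows "\<exists>N0. \<forall>N\<ge>N0. 0 < N \<longrightarrow> (\<forall>d>0. \<exists>t. 0 < t \<and> t \<le> d \<and>
    (\<forall>n. (\<integral>\<^sup>+x. ennreal (norm (band_density (window (kick t (N * p) V) n) (N * p) x - band_density (W n) p x)) \<partial>lborel) \<le> ennreal \<eta>) \<and>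
    (\<forall>j\<in>J. \<exists>E. a j < E \<and> E < b j \<and> complex_of_real E \<in> resolvent_set (schroedinger (kick t (N * p) V))))"
proof -
  define t where "t k = inverse (real (Suc k))" for k
  have t: "0 < t k" "t \<longlonglongrightarrow> 0" for k unfolding t_def by (rule inverse_Suc_null)+
  have "\<forall>j\<in>J. \<exists>N0. \<forall>N\<ge>N0. 0 < N \<longrightarrow> (\<forall>\<^sub>F k in sequentially.
    \<exists>E. a j < E \<and> E < b j \<and> complex_of_real E \<in> resolvent_set (schroedinger (kick (t k) (N * p) V)))"
    using kick_gap[OF J(2) t] by blast
  from bchoice[OF this] obtain N1 where N1: "\<forall>j\<in>J. \<forall>N\<ge>N1 j. 0 < N \<longrightarrow> (\<forall>\<^sub>F k in sequentially.
    \<exists>E. a j < E \<and> E < b j \<and> complex_of_real E \<in> resolvent_set (schroedinger (kick (t k) (N * p) V)))"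
    by blast
  \<comment> \<open>The sum is a common upper bound of the finitely many thresholds.\<close>
  define N0 where "N0 = sum N1 J"
  have "\<exists>s. 0 < s \<and> s \<le> d \<and>
    (\<forall>n. (\<integral>\<^sup>+x. ennreal (norm (band_density (window (kick s (N * p) V) n) (N * p) x - band_density (W n) p x)) \<partial>lborel) \<le> ennreal \<eta>) \<and>
    (\<forall>j\<in>J. \<exists>E. a j < E \<and> E < b j \<and> complex_of_real E \<in> resolvent_set (schroedinger (kick s (N * p) V)))"
    if N: "N0 \<le> N" "0 < N" and d: "0 < d" for N d
  proof -
    let ?q = "N * p"
    let ?I = "\<lambda>k n. \<integral>\<^sup>+x. ennreal (norm (band_density (window (kick (t k) ?q V) n) ?q x - band_density (W n) p x)) \<partial>lborel"
    have "N1 j \<le> N" if "j \<in> J" for j using member_le_sum[OF that, of N1] J(1) N(1) by (simp add: N0_def)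
    then have 1: "\<forall>\<^sub>F k in sequentially. \<forall>j\<in>J. \<exists>E. a j < E \<and> E < b j \<and>
        complex_of_real E \<in> resolvent_set (schroedinger (kick (t k) ?q V))"
      using N1 N(2) by (intro eventually_ball_finite J(1)) blast
    have "\<forall>\<^sub>F k in sequentially. ?I k n < ennreal \<eta>" for n
      by (rule order_tendstoD(2)[OF kick_L1[OF N(2) t(2)]]) (use eta in simp)
    then have 2: "\<forall>\<^sub>F k in sequentially. \<forall>n\<in>{0..<int ?q}. ?I k n < ennreal \<eta>"
      by (intro eventually_ball_finite) auto
    have 3: "\<forall>\<^sub>F k in sequentially. t k < d" by (rule order_tendstoD(2)[OF t(2) d])
    obtain k where k: "\<forall>j\<in>J. \<exists>E. a j < E \<and> E < b j \<and> complex_of_real E \<in> resolvent_set (schroedinger (kick (t k) ?q V))"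
      "\<forall>n\<in>{0..<int ?q}. ?I k n < ennreal \<eta>" "t k < d"
      using eventually_happens'[OF sequentially_bot eventually_conj[OF 1 eventually_conj[OF 2 3]]] by blast
    interpret q: periodic_potential V ?q by (rule periodic_multiple[OF N(2)])
    interpret K: periodic_potential "kick (t k) ?q V" ?q by (rule periodic_kick[OF N(2)])
    have "?I k n \<le> ennreal \<eta>" for n
    proof -
      have "n mod int ?q \<in> {0..<int ?q}" using q.p_pos by (simp del: of_nat_mult)
      then have "?I k (n mod int ?q) < ennreal \<eta>" using k(2) by blast
      then show ?thesis using q.window_mod[of n] K.window_mod[of n] by (simp only:)
    qed
    then show ?thesis using k(1,3) t(1)[of k] by (intro exI[of _ "t k"]) auto
  qed
  then show ?thesis by blast
qed

section \<open>Limit-periodic potentials\<close>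

text \<open>The second resolvent identity: the difference carries two resolvent factors, each at
  most \<open>1 / \<bar>Im z\<bar>\<close>.\<close>

lemma green_potential_diff_le:
  assumes V: "bounded_by V M" and V': "bounded_by V' M'" and z: "Im z \<noteq> 0" and d: "\<And>n. \<bar>V n - V' n\<bar> \<le> d"
  shows "cmod (green V' \<psi> z - green V \<psi> z) \<le> d * (norm \<psi>)\<^sup>2 / (Im z)\<^sup>2"
proof -
  note inv = Hz_nonreal[OF V z]
  note inv' = Hz_nonreal[OF V' z]
  have d0: "0 \<le> d" using d[of 0] by linarith
  define \<phi> where "\<phi> = Res V z \<psi>"
  have "Res V' z \<psi> = Res V' z (mult_op (\<lambda>n. of_real (V n - V' n)) \<phi>) + \<phi>"
  proof -
    have "\<psi> = mult_op (\<lambda>n. of_real (V n - V' n)) \<phi> + Hz V' z \<phi>"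
      using Hz_diff[OF V' V, where z=z and z'=z and x=\<phi>] by (simp add: \<phi>_def Hz_Res[OF inv] add.commute)
    then have "Res V' z \<psi> = Res V' z (mult_op (\<lambda>n. of_real (V n - V' n)) \<phi> + Hz V' z \<phi>)" by simp
    then show ?thesis by (simp add: Res_add[OF inv'] Res_Hz[OF inv'])
  qed
  then have "green V' \<psi> z - green V \<psi> z = cinner \<psi> (Res V' z (mult_op (\<lambda>n. of_real (V n - V' n)) \<phi>))"
    by (simp add: green_def \<phi>_def cinner_add_right)
  also have "cmod \<dots> \<le> norm \<psi> * norm (Res V' z (mult_op (\<lambda>n. of_real (V n - V' n)) \<phi>))" by (rule cmod_cinner_le)
  also have "\<dots> \<le> norm \<psi> * (1 / \<bar>Im z\<bar> * (d * (1 / \<bar>Im z\<bar> * norm \<psi>)))"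
  proof (intro mult_left_mono order.trans[OF norm_Res_le[OF inv']])
    have "norm (mult_op (\<lambda>n. of_real (V n - V' n)) \<phi>) \<le> d * norm \<phi>"
      by (rule norm_mult_op_le) (use d in \<open>simp add: norm_of_real del: of_real_diff\<close>)
    also have "\<dots> \<le> d * (1 / \<bar>Im z\<bar> * norm \<psi>)" unfolding \<phi>_def by (intro mult_left_mono norm_Res_le[OF inv] d0)
    finally show "norm (mult_op (\<lambda>n. of_real (V n - V' n)) \<phi>) \<le> d * (1 / \<bar>Im z\<bar> * norm \<psi>)" .
  qed auto
  also have "\<dots> = d * (norm \<psi>)\<^sup>2 / (Im z)\<^sup>2" by (simp add: power2_eq_square)
  finally show ?thesis .
qed

text \<open>Summable L1 increments force convergence almost everywhere below an integrable majorant,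
  namely \<open>F 0\<close> plus the sum of the increments. Testing against bounded complex
  functions is what the Cauchy kernel requires.\<close>

lemma L1_limit_density:
  fixes F :: "nat \<Rightarrow> real \<Rightarrow> real"
  assumes int: "\<And>k. integrable lborel (F k)" and nonneg: "\<And>k x. 0 \<le> F k x"
    and diff: "\<And>k. (\<integral>\<^sup>+x. ennreal (norm (F (Suc k) x - F k x)) \<partial>lborel) \<le> ennreal ((1 / 2) ^ k)"
  shows "\<exists>f. integrable lborel f \<and> (\<forall>x. 0 \<le> f x) \<and>
    (\<forall>g :: real \<Rightarrow> complex. g \<in> borel_measurable borel \<longrightarrow> (\<exists>B. \<forall>x. cmod (g x) \<le> B) \<longrightarrow>
      (\<lambda>k. \<integral>x. F k x *\<^sub>R g x \<partial>lborel) \<longlonglongrightarrow> (\<integral>x. f x *\<^sub>R g x \<partial>lborel))"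
proof -
  have m [measurable]: "F k \<in> borel_measurable borel" for k using borel_measurable_integrable[OF int[of k]] by simp
  define h where "h k x = norm (F (Suc k) x - F k x)" for k x
  have hint: "integrable lborel (h k)" for k unfolding h_def by (intro integrable_norm Bochner_Integration.integrable_diff int)
  have hI: "(\<integral>x. h k x \<partial>lborel) \<le> (1 / 2) ^ k" for k
  proof -
    have "ennreal (\<integral>x. h k x \<partial>lborel) = (\<integral>\<^sup>+x. ennreal (h k x) \<partial>lborel)"
      by (rule nn_integral_eq_integral[OF hint, symmetric]) (simp add: h_def)
    also have "\<dots> \<le> ennreal ((1 / 2) ^ k)" unfolding h_def by (rule diff)
    finally show ?thesis by (simp add: ennreal_le_iff)
  qed
  have geo: "summable (\<lambda>k. (1 / 2 :: real) ^ k)" by (rule summable_geometric) simp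
  have AEs: "AE x in lborel. summable (\<lambda>k. h k x)"
  proof -
    have hm [measurable]: "h k \<in> borel_measurable lborel" for k using hint[of k] by simp
    have "(\<integral>\<^sup>+x. (\<Sum>k. ennreal (h k x)) \<partial>lborel) = (\<Sum>k. \<integral>\<^sup>+x. ennreal (h k x) \<partial>lborel)"
      by (rule nn_integral_suminf) measurable
    also have "\<dots> \<le> (\<Sum>k. ennreal ((1 / 2) ^ k))" unfolding h_def by (intro suminf_le diff) auto
    also have "(\<Sum>k. ennreal ((1 / 2) ^ k)) = ennreal (\<Sum>k. (1 / 2) ^ k)"
      by (rule suminf_ennreal2[OF _ geo]) simp
    finally have "(\<integral>\<^sup>+x. (\<Sum>k. ennreal (h k x)) \<partial>lborel) < \<infinity>"
      unfolding infinity_ennreal_def by (rule le_less_trans) (rule ennreal_less_top)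
    from nn_integral_PInf_AE[OF _ less_imp_neq[OF this]]
    have "AE x in lborel. (\<Sum>k. ennreal (h k x)) \<noteq> \<infinity>" by measurable
    then show ?thesis
    proof eventually_elim
      fix x assume "(\<Sum>k. ennreal (h k x)) \<noteq> \<infinity>"
      then show "summable (\<lambda>k. h k x)" by (intro summable_suminf_not_top) (simp_all add: h_def)
    qed
  qed
  define w where "w x = F 0 x + (\<Sum>k. h k x)" for x
  have "integrable lborel (\<lambda>x. \<Sum>k. h k x)"
  proof (rule integrable_suminf[OF hint])
    show "AE x in lborel. summable (\<lambda>k. norm (h k x))" using AEs by (simp add: h_def)
    show "summable (\<lambda>k. \<integral>x. norm (h k x) \<partial>lborel)"
      by (rule summable_comparison_test'[OF geo, of 0]) (use hI in \<open>auto simp: h_def intro!: abs_leI\<close>)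
  qed
  then have wint: "integrable lborel w" unfolding w_def by (intro Bochner_Integration.integrable_add int)
  have tele: "F k x = F 0 x + (\<Sum>i<k. F (Suc i) x - F i x)" for k x
    using sum_lessThan_telescope[of "\<lambda>k. F k x" k] by simp
  \<comment> \<open>The maximum with 0 keeps \<open>f\<close> nonnegative on the null set where the
    limit may fail to exist.\<close>
  define f where "f x = max 0 (lim (\<lambda>k. F k x))" for x
  have fm [measurable]: "f \<in> borel_measurable borel" unfolding f_def by measurable
  have conv: "(\<lambda>k. F k x) \<longlonglongrightarrow> f x" and bound: "F k x \<le> w x" if s: "summable (\<lambda>k. h k x)" for x k
  proof -
    have "summable (\<lambda>i. F (Suc i) x - F i x)" by (rule summable_norm_cancel) (use s in \<open>simp add: h_def\<close>)
    then have "(\<lambda>k. F 0 x + (\<Sum>i<k. F (Suc i) x - F i x)) \<longlonglongrightarrow> F 0 x + (\<Sum>i. F (Suc i) x - F i x)"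
      by (intro tendsto_intros summable_LIMSEQ)
    then have L: "(\<lambda>k. F k x) \<longlonglongrightarrow> F 0 x + (\<Sum>i. F (Suc i) x - F i x)" unfolding tele[symmetric] .
    moreover have "0 \<le> F 0 x + (\<Sum>i. F (Suc i) x - F i x)" by (rule LIMSEQ_le_const[OF L]) (use nonneg in auto)
    ultimately show "(\<lambda>k. F k x) \<longlonglongrightarrow> f x" by (simp add: f_def limI max_absorb2)
    have "F k x \<le> F 0 x + (\<Sum>i<k. h i x)" unfolding tele[of k] h_def by (intro add_left_mono sum_mono) auto
    also have "\<dots> \<le> w x" unfolding w_def by (intro add_left_mono sum_le_suminf s) (auto simp: h_def)
    finally show "F k x \<le> w x" .
  qed
  have fint: "integrable lborel f"
  proof (rule Bochner_Integration.integrable_bound[OF wint])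
    show "AE x in lborel. norm (f x) \<le> norm (w x)"
      using AEs
    proof eventually_elim
      fix x assume s: "summable (\<lambda>k. h k x)"
      have "f x \<le> w x" by (rule LIMSEQ_le_const2[OF conv[OF s]]) (use bound[OF s] in auto)
      then show "norm (f x) \<le> norm (w x)" by (simp add: f_def)
    qed
  qed simp
  have "(\<lambda>k. \<integral>x. F k x *\<^sub>R g x \<partial>lborel) \<longlonglongrightarrow> (\<integral>x. f x *\<^sub>R g x \<partial>lborel)"
    if [measurable]: "g \<in> borel_measurable borel" and B: "\<And>x. cmod (g x) \<le> B" for g :: "real \<Rightarrow> complex" and B
  proof (rule integral_dominated_convergence[where w="\<lambda>x. w x * B"])
    show "integrable lborel (\<lambda>x. w x * B)" using wint by (rule integrable_mult_left)
    show "AE x in lborel. (\<lambda>k. F k x *\<^sub>R g x) \<longlonglongrightarrow> f x *\<^sub>R g x"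
      using AEs by eventually_elim (intro tendsto_intros conv)
    show "AE x in lborel. norm (F k x *\<^sub>R g x) \<le> w x * B" for k
      using AEs
    proof eventually_elim
      fix x assume s: "summable (\<lambda>k. h k x)"
      have "F k x * cmod (g x) \<le> w x * B"
        using bound[OF s, of k] nonneg[of k x] B[of x] by (intro mult_mono) auto
      then show "norm (F k x *\<^sub>R g x) \<le> w x * B" using nonneg[of k x] by simp
    qed
  qed simp_all
  then show ?thesis using fint by (intro exI[of _ f]) (auto simp: f_def)
qed

text \<open>\<open>a k\<close> stands for the residue of a point at stage \<open>k\<close>;
  condition \<open>a\<close> expresses that residues at consecutive stages are compatible. Uniform
  convergence of the potentials identifies the limit of the Green functions, L1 convergence that of
  their integral representations, so the limiting density is that of \<open>V\<close>.\<close>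

theorem limit_periodic_ac_cantor:
  fixes V :: "int \<Rightarrow> real" and c :: "nat \<Rightarrow> int \<Rightarrow> real" and p :: "nat \<Rightarrow> nat" and a :: "nat \<Rightarrow> int"
  assumes per: "\<And>k. periodic_potential (c k) (p k)"
    and a: "\<And>k n. c k (n + a (Suc k)) = c k (n + a k)"
    and V: "\<And>k n. \<bar>V n - c k (n + a k)\<bar> \<le> d k" and d: "d \<longlonglongrightarrow> 0"
    and L1: "\<And>k n. (\<integral>\<^sup>+x. ennreal (norm (band_density (window (c (Suc k)) n) (p (Suc k)) x - band_density (window (c k) n) (p k) x)) \<partial>lborel)
      \<le> ennreal ((1 / 2) ^ k)"
    and gaps: "\<And>(k::nat) (j::int). \<bar>j\<bar> \<le> 4 ^ k \<Longrightarrow>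
      \<exists>E. of_int j / 2 ^ k < E \<and> E < (of_int j + 1) / 2 ^ k \<and> complex_of_real E \<in> resolvent_set (schroedinger V)"
  shows "(\<exists>S. op_spectrum (schroedinger V) = complex_of_real ` S \<and> cantor_set S \<and> emeasure lebesgue S > 0) \<and>
    purely_ac_spectrum (schroedinger V)"
proof -
  define Vk where "Vk k n = c k (n + a k)" for k n
  interpret c: periodic_potential "c k" "p k" for k by (rule per)
  have perV: "periodic_potential (Vk k) (p k)" for k
  proof
    show "Vk k (n + int (p k)) = Vk k n" for n using c.period[of k "n + a k"] by (simp add: Vk_def add_ac)
  qed (rule c.p_pos)
  interpret Vk: periodic_potential "Vk k" "p k" for k by (rule perV)
  have win: "window (Vk k) n = window (c k) (n + a k)" for k n by (rule ext) (simp add: window_def Vk_def add_ac)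
  define M where "M = Vk.bound 0 + d 0"
  have bV: "bounded_by V M"
    unfolding bounded_by_def
  proof
    fix n
    show "\<bar>V n\<bar> \<le> M" using V[of n 0] bounded_byD[OF Vk.bounded, of 0 n] by (simp add: M_def Vk_def)
  qed
  have ac: "absolutely_continuous lborel (spectral_measure V (delta n))" for n
  proof -
    define F where "F k = band_density (window (Vk k) n) (p k)" for k
    have "(\<integral>\<^sup>+x. ennreal (norm (F (Suc k) x - F k x)) \<partial>lborel) \<le> ennreal ((1 / 2) ^ k)" for k
    proof -
      \<comment> \<open>Both stages are thereby read at the same site, as the L1 hypothesis
        requires.\<close>
      have "window (c k) (n + a (Suc k)) = window (c k) (n + a k)"
        using a[of k "n + int j" for j] by (intro ext) (simp add: window_def add_ac)
      then show ?thesis using L1[of k "n + a (Suc k)"] by (simp add: F_def win)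
    qed
    then obtain f where f: "integrable lborel f" "\<And>x. 0 \<le> f x"
      and lim: "\<And>g. g \<in> borel_measurable borel \<Longrightarrow> (\<exists>B. \<forall>x. cmod (g x) \<le> B) \<Longrightarrow>
        (\<lambda>k. \<integral>x. F k x *\<^sub>R g x \<partial>lborel) \<longlonglongrightarrow> (\<integral>x. f x *\<^sub>R g x \<partial>lborel)"
      using L1_limit_density[of F] Vk.integrable_band_density[of _ n] band_density_nonneg unfolding F_def by blast
    define \<nu> where "\<nu> = density lborel (\<lambda>x. ennreal (f x))"
    have fm [measurable]: "f \<in> borel_measurable borel" using borel_measurable_integrable[OF f(1)] by simp
    have "spectral_measure V (delta n) = \<nu>"
    proof (rule cauchy_transform_unique)
      show "finite_measure (spectral_measure V (delta n))" "sets (spectral_measure V (delta n)) = sets borel"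
        by (rule spectral_measure[OF bV])+
      show "sets \<nu> = sets borel" by (simp add: \<nu>_def)
      show "finite_measure \<nu>"
      proof (rule finite_measureI)
        have "emeasure \<nu> (space \<nu>) = (\<integral>\<^sup>+x. ennreal (f x) \<partial>lborel)"
          unfolding \<nu>_def by (subst emeasure_density) auto
        also have "\<dots> = ennreal (\<integral>x. f x \<partial>lborel)" by (rule nn_integral_eq_integral[OF f(1)]) (simp add: f(2))
        finally show "emeasure \<nu> (space \<nu>) \<noteq> \<infinity>" by simp
      qed
      fix z :: complex assume z: "0 < Im z"
      let ?g = "\<lambda>x. 1 / (complex_of_real x - z)"
      have "(\<lambda>k. green (Vk k) (delta n) z) \<longlonglongrightarrow> green V (delta n) z"
      proof (rule LIM_zero_cancel, rule Lim_null_comparison)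
        show "\<forall>\<^sub>F k in sequentially. norm (green (Vk k) (delta n) z - green V (delta n) z) \<le> d k * (norm (delta n))\<^sup>2 / (Im z)\<^sup>2"
          using z V by (intro always_eventually allI green_potential_diff_le[OF bV Vk.bounded]) (auto simp: Vk_def)
        have "(\<lambda>k. d k * (norm (delta n))\<^sup>2 / (Im z)\<^sup>2) \<longlonglongrightarrow> 0 * (norm (delta n))\<^sup>2 / (Im z)\<^sup>2"
          by (intro tendsto_intros d) (use z in auto)
        then show "(\<lambda>k. d k * (norm (delta n))\<^sup>2 / (Im z)\<^sup>2) \<longlonglongrightarrow> 0" by simp
      qed
      moreover have "green (Vk k) (delta n) z = (\<integral>x. F k x *\<^sub>R ?g x \<partial>lborel)" for k
        unfolding spectral_measure(4)[OF Vk.bounded z, symmetric] cauchy_transform_def Vk.spectral_measure_delta F_def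
        by (rule integral_density) (auto simp: band_density_nonneg)
      moreover have "(\<lambda>k. \<integral>x. F k x *\<^sub>R ?g x \<partial>lborel) \<longlonglongrightarrow> (\<integral>x. f x *\<^sub>R ?g x \<partial>lborel)"
        by (rule lim) (use norm_cauchy_kernel_le[of z] z in auto)
      moreover have "(\<integral>x. f x *\<^sub>R ?g x \<partial>lborel) = cauchy_transform \<nu> z"
        unfolding cauchy_transform_def \<nu>_def by (rule integral_density[symmetric]) (auto simp: f(2))
      ultimately show "cauchy_transform (spectral_measure V (delta n)) z = cauchy_transform \<nu> z"
        unfolding spectral_measure(4)[OF bV z] by (simp add: LIMSEQ_unique)
    qed
    then show ?thesis unfolding \<nu>_def by (simp add: absolutely_continuousI_density)
  qed
  note spec = spectrum_if_delta_ac[OF bV ac]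
  let ?S = "{x. complex_of_real x \<in> op_spectrum (schroedinger V)}"
  have "interior ?S = {}"
  proof (rule ccontr)
    assume "interior ?S \<noteq> {}"
    then obtain x where "x \<in> interior ?S" by blast
    then obtain r where r: "0 < r" "ball x r \<subseteq> ?S" unfolding mem_interior by blast
    \<comment> \<open>\<open>k\<close> must make the dyadic intervals shorter than \<open>r\<close>
      and, through \<open>\<bar>x\<bar> + 1 < 2 ^ k\<close>, put the index \<open>j\<close> of the
      one around \<open>x\<close> within the range \<open>4 ^ k\<close> of the hypothesis.\<close>
    obtain k1 where k1: "1 / r < 2 ^ k1" using real_arch_pow[of 2 "1 / r"] by auto
    obtain k2 where k2: "\<bar>x\<bar> + 1 < 2 ^ k2" using real_arch_pow[of 2 "\<bar>x\<bar> + 1"] by auto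
    define k where "k = max k1 k2"
    have k: "1 / r < 2 ^ k" "\<bar>x\<bar> + 1 < 2 ^ k"
    proof -
      have "(2::real) ^ k1 \<le> 2 ^ k" "(2::real) ^ k2 \<le> 2 ^ k" by (auto intro!: power_increasing simp: k_def)
      then show "1 / r < 2 ^ k" "\<bar>x\<bar> + 1 < 2 ^ k" using k1 k2 by linarith+
    qed
    define j where "j = \<lfloor>x * 2 ^ k\<rfloor>"
    have j: "of_int j \<le> x * 2 ^ k" "x * 2 ^ k < of_int j + 1" unfolding j_def by linarith+
    have one: "(1::real) \<le> 2 ^ k" by simp
    have "\<bar>real_of_int j\<bar> \<le> \<bar>x * 2 ^ k\<bar> + 1" using j by linarith
    also have "\<dots> \<le> (\<bar>x\<bar> + 1) * 2 ^ k" using one by (simp add: abs_mult distrib_right)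
    also have "\<dots> \<le> 2 ^ k * 2 ^ k" using k(2) by (intro mult_right_mono) auto
    also have "\<dots> = 4 ^ k" by (simp flip: power_mult_distrib)
    finally have "real_of_int \<bar>j\<bar> \<le> real_of_int (4 ^ k)" by simp
    then have "\<bar>j\<bar> \<le> 4 ^ k" unfolding of_int_le_iff .
    from gaps[OF this] obtain E where E: "of_int j / 2 ^ k < E" "E < (of_int j + 1) / 2 ^ k"
      "complex_of_real E \<in> resolvent_set (schroedinger V)" by blast
    have "of_int j / 2 ^ k \<le> x" "x < (of_int j + 1) / 2 ^ k" using j by (simp_all add: field_simps)
    then have "\<bar>E - x\<bar> < 1 / 2 ^ k" using E(1,2) by (simp add: add_divide_distrib abs_less_iff)
    also have "\<dots> < r" using k(1) r(1) by (simp add: field_simps)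
    finally have "E \<in> ball x r" by (simp add: dist_real_def abs_minus_commute)
    then have "E \<in> ?S" using r(2) by blast
    then show False using E(3) by (simp add: op_spectrum_def)
  qed
  then have "cantor_set ?S" unfolding cantor_set_def using spec by blast
  then show ?thesis using spec op_spectrum_real[OF bV] by blast
qed

section \<open>Procyclic translations\<close>

lemma int_iterate_translation:
  fixes n :: int
  assumes "group G" "\<omega>0 \<in> carrier G" and T: "\<And>\<omega>. \<omega> \<in> carrier G \<Longrightarrow> T \<omega> = \<omega> \<otimes>\<^bsub>G\<^esub> \<omega>0"
    and \<omega>: "\<omega> \<in> carrier G"
  shows "int_iterate (carrier G) T n \<omega> = \<omega> \<otimes>\<^bsub>G\<^esub> (\<omega>0 [^]\<^bsub>G\<^esub> n)"
proof -
  interpret group G by fact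
  note [simp] = assms(2) \<omega>
  have pos: "(T ^^ k) \<omega> = \<omega> \<otimes>\<^bsub>G\<^esub> (\<omega>0 [^]\<^bsub>G\<^esub> k)" for k :: nat
    by (induction k) (simp_all add: T m_assoc)
  have inj: "inj_on T (carrier G)" by (auto intro!: inj_onI simp: T)
  have inv: "inv_into (carrier G) T x = x \<otimes>\<^bsub>G\<^esub> (m_inv G \<omega>0)" if "x \<in> carrier G" for x
    using that by (intro inv_into_f_eq[OF inj]) (auto simp: T m_assoc)
  have neg: "(inv_into (carrier G) T ^^ k) \<omega> = \<omega> \<otimes>\<^bsub>G\<^esub> (m_inv G \<omega>0 [^]\<^bsub>G\<^esub> k)" for k :: nat
    by (induction k) (simp_all add: inv m_assoc)
  show ?thesis
  proof (cases "0 \<le> n")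
    case True then show ?thesis unfolding int_iterate_def int_pow_def2 using pos by simp
  next
    case False
    then show ?thesis
      unfolding int_iterate_def int_pow_def2 using neg[of "nat (- n)"] nat_pow_inv[OF assms(2), of "nat (- n)"] by simp
  qed
qed

text \<open>What the construction uses of the group and of \<open>T\<close>:
  \<open>r i \<omega>\<close> is the residue of \<open>\<omega>\<close> modulo \<open>P i\<close>,
  advanced by 1 under \<open>T\<close>; cylinders are open, moduli can be refined arbitrarily far,
  and functions of one residue approximate all continuous ones.\<close>

locale odometer =
  fixes X :: "'a topology" and T :: "'a \<Rightarrow> 'a" and I :: "'i set"
    and P :: "'i \<Rightarrow> nat" and r :: "'i \<Rightarrow> 'a \<Rightarrow> nat"
  assumes compact: "compact_space X"
    and iterate_closed: "\<And>\<omega> n. \<omega> \<in> topspace X \<Longrightarrow> int_iterate (topspace X) T n \<omega> \<in> topspace X"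
    and period_pos: "\<And>i. i \<in> I \<Longrightarrow> 0 < P i"
    and digit_iterate: "\<And>i \<omega> n. i \<in> I \<Longrightarrow> \<omega> \<in> topspace X \<Longrightarrow>
      int (r i (int_iterate (topspace X) T n \<omega>)) = (int (r i \<omega>) + n) mod int (P i)"
    and digit_open: "\<And>i k. i \<in> I \<Longrightarrow> openin X {\<omega> \<in> topspace X. r i \<omega> = k}"
    and refine: "\<And>i N. i \<in> I \<Longrightarrow> \<exists>j\<in>I. P i dvd P j \<and> N * P i \<le> P j \<and> (\<forall>\<omega>\<in>topspace X. r i \<omega> = r j \<omega> mod P i)"
    and digit_approximation: "\<And>f \<epsilon>. continuous_map X euclideanreal f \<Longrightarrow> 0 < \<epsilon> \<Longrightarrow>
      \<exists>i\<in>I. \<exists>c. \<forall>\<omega>\<in>topspace X. \<bar>f \<omega> - c (r i \<omega>)\<bar> < \<epsilon>"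

lemma odometer_procyclic:
  fixes G :: "('a, 'm) monoid_scheme" and I :: "'i set" and A :: "'i \<Rightarrow> 'b monoid"
  assumes pc: "procyclic_group G X I lei A \<phi>"
    and inf: "infinite (carrier G)" and tr: "translation G T" and mn: "minimal X T"
  shows "\<exists>P r. odometer X T I P r"
proof -
  have "group G" and X: "topspace X = carrier G" and cp: "compact_space X" and hd: "Hausdorff_space X"
    and sys: "inverse_system I lei A \<phi>" and fin: "\<And>i. i \<in> I \<Longrightarrow> finite (carrier (A i))"
    using pc unfolding procyclic_group_def topological_group_def by blast+
  interpret G: group G by fact
  obtain h where h: "h \<in> iso G (inverse_limit_group I lei A \<phi>)"
      and hh: "homeomorphic_map X (inverse_limit_topology I lei A \<phi>) h"
    using pc unfolding procyclic_group_def by blast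
  obtain w where w: "w \<in> carrier G" and T: "\<And>\<omega>. \<omega> \<in> carrier G \<Longrightarrow> T \<omega> = \<omega> \<otimes>\<^bsub>G\<^esub> w"
    using tr unfolding translation_def by blast
  have it: "int_iterate (topspace X) T n \<omega> = \<omega> \<otimes>\<^bsub>G\<^esub> (w [^]\<^bsub>G\<^esub> n)" if "\<omega> \<in> carrier G" for \<omega> n
    unfolding X by (rule int_iterate_translation[OF \<open>group G\<close> w T that])
  have I: "I \<noteq> {}" and directed: "\<And>i j. i \<in> I \<Longrightarrow> j \<in> I \<Longrightarrow> \<exists>k\<in>I. lei i k \<and> lei j k"
    and lei_trans: "\<And>i j k. i \<in> I \<Longrightarrow> j \<in> I \<Longrightarrow> k \<in> I \<Longrightarrow> lei i j \<Longrightarrow> lei j k \<Longrightarrow> lei i k"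
    and grp: "\<And>i. i \<in> I \<Longrightarrow> group (A i)"
    and \<phi>: "\<And>i j. i \<in> I \<Longrightarrow> j \<in> I \<Longrightarrow> lei i j \<Longrightarrow> \<phi> i j \<in> hom (A j) (A i)"
    using sys unfolding inverse_system_def by blast+
  have hL: "h x \<in> carrier (inverse_limit_group I lei A \<phi>)" if "x \<in> carrier G" for x
    using h that unfolding iso_def hom_def by blast
  have h_inj: "inj_on h (carrier G)" using h unfolding iso_def bij_betw_def by blast
  have h_PiE: "h x \<in> (\<Pi>\<^sub>E i\<in>I. carrier (A i))" if "x \<in> carrier G" for x
    using hL[OF that] by (simp add: inverse_limit_group_def)
  have h_bond: "\<phi> i j (h x j) = h x i" if "x \<in> carrier G" "i \<in> I" "j \<in> I" "lei i j" for x i j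
    using hL[OF that(1)] that by (simp add: inverse_limit_group_def)
  have h_mult: "h (x \<otimes>\<^bsub>G\<^esub> y) = (\<lambda>i\<in>I. h x i \<otimes>\<^bsub>A i\<^esub> h y i)" if "x \<in> carrier G" "y \<in> carrier G" for x y
    using h that unfolding iso_def by (auto simp: hom_def inverse_limit_group_def)
  have h_hom: "(\<lambda>x. h x i) \<in> hom G (A i)" if "i \<in> I" for i
    using that h_PiE by (intro homI) (auto simp: h_mult PiE_iff)
  \<comment> \<open>The coordinates of the translation element. By density of the orbit
    \<open>g i\<close> generates the image of the group in \<open>A i\<close>, though not
    necessarily all of \<open>A i\<close>; hence the modulus is the order of
    \<open>g i\<close>.\<close>
  define g where "g i = h w i" for i
  have g: "g i \<in> carrier (A i)" if "i \<in> I" for i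
    using h_PiE[OF w] that unfolding g_def by (auto simp: PiE_iff)
  have h_pow: "h (w [^]\<^bsub>G\<^esub> (n::int)) i = g i [^]\<^bsub>A i\<^esub> n" if "i \<in> I" for i n
    unfolding g_def by (rule hom_int_pow[OF h_hom w \<open>group G\<close> grp]) (rule that)+
  define P where "P i = group.ord (A i) (g i)" for i
  have P_pos: "0 < P i" if "i \<in> I" for i
    using group.ord_ge_1[OF grp fin g] that unfolding P_def by (simp add: Suc_le_eq)
  have h_open: "openin X {x \<in> topspace X. h x i \<in> S}" if "i \<in> I" "S \<subseteq> carrier (A i)" for i S
  proof -
    have "continuous_map X (inverse_limit_topology I lei A \<phi>) h"
      using hh by (rule homeomorphic_imp_continuous_map)
    then have "continuous_map X (discrete_topology (carrier (A i))) (\<lambda>x. h x i)"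
      using that(1) unfolding inverse_limit_topology_def continuous_map_in_subtopology continuous_map_componentwise by blast
    from openin_continuous_map_preimage[OF this, of S] that(2) show ?thesis by simp
  qed
  \<comment> \<open>Coordinate cylinders are open, so the dense orbit of the identity meets the
    cylinder of \<open>x\<close>.\<close>
  have power: "\<exists>n::int. h x i = g i [^]\<^bsub>A i\<^esub> n" if x: "x \<in> carrier G" and i: "i \<in> I" for x i
  proof -
    let ?U = "{y \<in> topspace X. h y i \<in> {h x i}}"
    have U: "openin X ?U" using h_PiE[OF x] i by (intro h_open) (auto simp: PiE_iff)
    have "x \<in> X closure_of range (\<lambda>n. int_iterate (topspace X) T n \<one>\<^bsub>G\<^esub>)"
      using mn x unfolding minimal_def X by simp
    then have "\<exists>y \<in> range (\<lambda>n. int_iterate (topspace X) T n \<one>\<^bsub>G\<^esub>). y \<in> ?U"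
      unfolding in_closure_of using U x X by (metis (no_types, lifting) mem_Collect_eq singletonI)
    then obtain n where "int_iterate (topspace X) T n \<one>\<^bsub>G\<^esub> \<in> ?U" by blast
    then have "h (w [^]\<^bsub>G\<^esub> n) i = h x i" using w by (simp add: it)
    then show ?thesis using h_pow[OF i] by metis
  qed
  \<comment> \<open>A discrete logarithm to the base \<open>g i\<close>, normalised to lie below
    \<open>P i\<close>.\<close>
  define e where "e i a = (SOME k::nat. k < P i \<and> a = g i [^]\<^bsub>A i\<^esub> int k)" for i a
  define r where "r i x = e i (h x i)" for i x
  have r: "r i x < P i \<and> h x i = g i [^]\<^bsub>A i\<^esub> int (r i x)" if x: "x \<in> carrier G" and i: "i \<in> I" for x i
  proof -
    obtain n :: int where n: "h x i = g i [^]\<^bsub>A i\<^esub> n" using power[OF x i] by blast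
    have "\<exists>k::nat. k < P i \<and> h x i = g i [^]\<^bsub>A i\<^esub> int k"
    proof (intro exI conjI)
      show "nat (n mod int (P i)) < P i" using P_pos[OF i] by (simp add: nat_less_iff)
      have "g i [^]\<^bsub>A i\<^esub> n = g i [^]\<^bsub>A i\<^esub> (n mod int (P i))"
        unfolding group.int_pow_eq[OF grp[OF i] g[OF i]] P_def[symmetric]
        by (metis dvd_minus_mod dvd_minus_iff minus_diff_eq)
      then show "h x i = g i [^]\<^bsub>A i\<^esub> int (nat (n mod int (P i)))"
        using n P_pos[OF i] by simp
    qed
    then show ?thesis unfolding r_def e_def by (rule someI_ex)
  qed
  have r_unique: "int (r i x) = m mod int (P i)" if x: "x \<in> carrier G" and i: "i \<in> I" and m: "h x i = g i [^]\<^bsub>A i\<^esub> (m::int)" for x i m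
  proof -
    have "g i [^]\<^bsub>A i\<^esub> int (r i x) = g i [^]\<^bsub>A i\<^esub> m" using r[OF x i] m by simp
    then have "int (P i) dvd m - int (r i x)"
      unfolding group.int_pow_eq[OF grp[OF i] g[OF i]] P_def[symmetric] .
    then have "m mod int (P i) = int (r i x) mod int (P i)" by (simp add: mod_eq_dvd_iff)
    then show ?thesis using r[OF x i] by simp
  qed
  have bond: "P i dvd P j \<and> (\<forall>x\<in>carrier G. r i x = r j x mod P i)" if i: "i \<in> I" and j: "j \<in> I" and ij: "lei i j" for i j
  proof
    have "\<phi> i j (g j) = g i" unfolding g_def by (rule h_bond[OF w i j ij])
    then have \<phi>_pow: "\<phi> i j (g j [^]\<^bsub>A j\<^esub> n) = g i [^]\<^bsub>A i\<^esub> n" for n :: int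
      using hom_int_pow[OF \<phi>[OF i j ij] g[OF j] grp[OF j] grp[OF i]] by simp
    have "\<phi> i j (\<one>\<^bsub>A j\<^esub>) = \<one>\<^bsub>A i\<^esub>" by (rule hom_one[OF \<phi>[OF i j ij] grp[OF j] grp[OF i]])
    moreover have "g j [^]\<^bsub>A j\<^esub> int (P j) = \<one>\<^bsub>A j\<^esub>"
      unfolding group.int_pow_eq_id[OF grp[OF j] g[OF j]] P_def by simp
    ultimately have "g i [^]\<^bsub>A i\<^esub> int (P j) = \<one>\<^bsub>A i\<^esub>" using \<phi>_pow[of "int (P j)"] by simp
    then show "P i dvd P j" unfolding group.int_pow_eq_id[OF grp[OF i] g[OF i]] P_def[symmetric] by simp
    show "\<forall>x\<in>carrier G. r i x = r j x mod P i"
    proof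
      fix x assume x: "x \<in> carrier G"
      have "h x i = g i [^]\<^bsub>A i\<^esub> int (r j x)"
        using h_bond[OF x i j ij] r[OF x j] \<phi>_pow[of "int (r j x)"] by simp
      from r_unique[OF x i this] have "int (r i x) = int (r j x mod P i)" by (simp add: zmod_int)
      then show "r i x = r j x mod P i" by simp
    qed
  qed
  have upper: "\<exists>k\<in>I. \<forall>i\<in>F. lei i k" if "finite F" "F \<subseteq> I" for F
    using that
  proof (induction F rule: finite_induct)
    case empty then show ?case using I by blast
  next
    case (insert j F)
    then obtain k where k: "k \<in> I" "\<forall>i\<in>F. lei i k" by blast
    obtain l where l: "l \<in> I" "lei j l" "lei k l" using directed[of j k] insert.prems k(1) by blast
    then have "\<forall>i\<in>F. lei i l" using k insert.prems lei_trans[of _ k l] by blast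
    then show ?case using l by blast
  qed
  \<comment> \<open>Bounded orders would let a factorial annihilate every coordinate of
    \<open>w\<close>; the orbit of the identity would be finite, hence closed, and by density all of
    the infinite group.\<close>
  have unbounded: "\<exists>j\<in>I. lei i j \<and> B \<le> P j" if i: "i \<in> I" for i B
  proof (rule ccontr)
    assume "\<not> ?thesis"
    then have B: "P j < B" if "j \<in> I" "lei i j" for j using that by (meson not_le)
    have dvd: "P j dvd fact B" if j: "j \<in> I" for j
    proof -
      obtain k where k: "k \<in> I" "lei i k" "lei j k" using directed[OF i j] by blast
      have "P k dvd fact B" using P_pos[OF k(1)] B[OF k(1,2)] by (intro dvd_fact) auto
      then show ?thesis using bond[OF j k(1,3)] by (meson dvd_trans)
    qed
    have "h (w [^]\<^bsub>G\<^esub> int (fact B)) j = h (w [^]\<^bsub>G\<^esub> (0::int)) j" if j: "j \<in> I" for j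
    proof -
      have "g j [^]\<^bsub>A j\<^esub> int (fact B) = \<one>\<^bsub>A j\<^esub>"
        unfolding group.int_pow_eq_id[OF grp[OF j] g[OF j]] P_def[symmetric] int_dvd_int_iff by (rule dvd[OF j])
      then show ?thesis unfolding h_pow[OF j] by simp
    qed
    then have "h (w [^]\<^bsub>G\<^esub> int (fact B)) = h (w [^]\<^bsub>G\<^esub> (0::int))"
      using w by (intro PiE_ext[OF h_PiE h_PiE]) auto
    then have 1: "w [^]\<^bsub>G\<^esub> int (fact B) = \<one>\<^bsub>G\<^esub>"
      using inj_onD[OF h_inj] w by simp
    let ?O = "range (\<lambda>n. int_iterate (topspace X) T n \<one>\<^bsub>G\<^esub>)"
    have "?O \<subseteq> (\<lambda>n. w [^]\<^bsub>G\<^esub> n) ` {0..<int (fact B)}"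
    proof (rule image_subsetI)
      fix n :: int
      have "int (G.ord w) dvd int (fact B)" using 1 G.int_pow_eq_id[OF w] by simp
      then have "w [^]\<^bsub>G\<^esub> n = w [^]\<^bsub>G\<^esub> (n mod int (fact B))"
        unfolding G.int_pow_eq[OF w] by (metis dvd_minus_mod dvd_minus_iff minus_diff_eq dvd_trans)
      moreover have "n mod int (fact B) \<in> {0..<int (fact B)}" by simp
      ultimately show "int_iterate (topspace X) T n \<one>\<^bsub>G\<^esub> \<in> (\<lambda>n. w [^]\<^bsub>G\<^esub> n) ` {0..<int (fact B)}"
        using w by (simp add: it)
    qed
    then have fin: "finite ?O" by (rule finite_subset) simp
    have "?O \<subseteq> carrier G" using w by (intro image_subsetI) (simp add: it)
    then have "closedin X ?O" unfolding X[symmetric] by (rule closedin_Hausdorff_finite[OF hd _ fin])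
    then have "X closure_of ?O = ?O" by (rule closure_of_closedin)
    moreover have "X closure_of ?O = topspace X" using mn X unfolding minimal_def by blast
    ultimately have "?O = topspace X" by (rule trans[OF sym])
    then show False using fin inf X by simp
  qed
  have "odometer X T I P r"
  proof
    show "compact_space X" by fact
    show "int_iterate (topspace X) T n \<omega> \<in> topspace X" if "\<omega> \<in> topspace X" for \<omega> n
      using that w it[of \<omega> n] unfolding X by simp
    show "0 < P i" if "i \<in> I" for i using that by (rule P_pos)
    show "int (r i (int_iterate (topspace X) T n \<omega>)) = (int (r i \<omega>) + n) mod int (P i)"
      if i: "i \<in> I" and \<omega>: "\<omega> \<in> topspace X" for i \<omega> n
    proof (rule r_unique[OF _ i])
      have \<omega>': "\<omega> \<in> carrier G" using \<omega> X by simp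
      show "int_iterate (topspace X) T n \<omega> \<in> carrier G" using \<omega>' w by (simp add: it)
      show "h (int_iterate (topspace X) T n \<omega>) i = g i [^]\<^bsub>A i\<^esub> (int (r i \<omega>) + n)"
        using \<omega>' w i r[OF \<omega>' i] by (simp add: it h_mult h_pow group.int_pow_mult[OF grp g])
    qed
    show "openin X {\<omega> \<in> topspace X. r i \<omega> = k}" if i: "i \<in> I" for i k
    proof -
      have "{\<omega> \<in> topspace X. r i \<omega> = k} = {x \<in> topspace X. h x i \<in> {a \<in> carrier (A i). e i a = k}}"
        using h_PiE i by (auto simp: r_def X PiE_iff)
      then show ?thesis using h_open[OF i, of "{a \<in> carrier (A i). e i a = k}"] by simp
    qed
    show "\<exists>j\<in>I. P i dvd P j \<and> N * P i \<le> P j \<and> (\<forall>\<omega>\<in>topspace X. r i \<omega> = r j \<omega> mod P i)" if "i \<in> I" for i N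
      using unbounded[OF that, of "N * P i"] bond[OF that] unfolding X by blast
    show "\<exists>i\<in>I. \<exists>c. \<forall>\<omega>\<in>topspace X. \<bar>f \<omega> - c (r i \<omega>)\<bar> < \<epsilon>"
      if f: "continuous_map X euclideanreal f" and \<epsilon>: "0 < \<epsilon>" for f \<epsilon>
    proof -
      \<comment> \<open>A basic neighbourhood in the product restricts finitely many coordinates;
        directedness provides one index whose coordinate determines them all.\<close>
      have "\<exists>i\<in>I. \<forall>y\<in>topspace X. h y i = h x i \<longrightarrow> \<bar>f y - f x\<bar> < \<epsilon> / 2" if x: "x \<in> topspace X" for x
      proof -
        define U where "U = {y \<in> topspace X. f y \<in> ball (f x) (\<epsilon> / 2)}"
        have "openin X U" unfolding U_def by (rule openin_continuous_map_preimage[OF f]) (simp add: open_openin[symmetric])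
        moreover have "U \<subseteq> topspace X" by (auto simp: U_def)
        ultimately have "openin (inverse_limit_topology I lei A \<phi>) (h ` U)"
          using homeomorphic_map_openness[OF hh] by blast
        then obtain W where W: "openin (product_topology (\<lambda>i. discrete_topology (carrier (A i))) I) W"
            and hU: "h ` U = W \<inter> carrier (inverse_limit_group I lei A \<phi>)"
          unfolding inverse_limit_topology_def openin_subtopology by blast
        have "x \<in> U" using x \<epsilon> by (simp add: U_def)
        then have "h x \<in> W" using hU by blast
        then obtain B where B: "finite {i \<in> I. B i \<noteq> topspace (discrete_topology (carrier (A i)))}"
            "h x \<in> Pi\<^sub>E I B" "Pi\<^sub>E I B \<subseteq> W"
          using bspec[OF iffD1[OF openin_product_topology_alt W] \<open>h x \<in> W\<close>] by (elim exE conjE) (rule that)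
        obtain k where k: "k \<in> I" "\<forall>i\<in>{i \<in> I. B i \<noteq> carrier (A i)}. lei i k"
          using upper[OF B(1)] by auto
        show ?thesis
        proof (intro bexI[OF _ k(1)] ballI impI)
          fix y assume y: "y \<in> topspace X" and eq: "h y k = h x k"
          have "h y i \<in> B i" if i: "i \<in> I" for i
          proof (cases "B i = carrier (A i)")
            case True then show ?thesis using h_PiE[of y] y X i by (auto simp: PiE_iff)
          next
            case False
            then have "lei i k" using k i by blast
            then have "h y i = h x i" using h_bond[of y i k] h_bond[of x i k] x y X i k(1) eq by simp
            then show ?thesis using B(2) i by (auto simp: PiE_iff)
          qed
          moreover have "h y \<in> extensional I" using h_PiE[of y] y X by (auto simp: PiE_iff)
          ultimately have "h y \<in> Pi\<^sub>E I B" by (simp add: PiE_iff)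
          then have "h y \<in> h ` U" using hU B(3) hL[of y] y X by blast
          then obtain u where "u \<in> U" "h y = h u" by blast
          then have "y \<in> U" using inj_onD[OF h_inj, of y u] y \<open>U \<subseteq> topspace X\<close> X by auto
          then show "\<bar>f y - f x\<bar> < \<epsilon> / 2" by (simp add: U_def dist_real_def abs_minus_commute)
        qed
      qed
      then have "\<forall>x\<in>topspace X. \<exists>i. i \<in> I \<and> (\<forall>y\<in>topspace X. h y i = h x i \<longrightarrow> \<bar>f y - f x\<bar> < \<epsilon> / 2)"
        by blast
      from bchoice[OF this] obtain \<iota> where \<iota>': "\<forall>x\<in>topspace X. \<iota> x \<in> I \<and>
        (\<forall>y\<in>topspace X. h y (\<iota> x) = h x (\<iota> x) \<longrightarrow> \<bar>f y - f x\<bar> < \<epsilon> / 2)" ..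
      have \<iota>: "\<And>x. x \<in> topspace X \<Longrightarrow> \<iota> x \<in> I"
        "\<And>x y. x \<in> topspace X \<Longrightarrow> y \<in> topspace X \<Longrightarrow> h y (\<iota> x) = h x (\<iota> x) \<Longrightarrow> \<bar>f y - f x\<bar> < \<epsilon> / 2"
        using \<iota>' by simp_all
      \<comment> \<open>Compactness leaves finitely many cylinders, and a common upper index
        \<open>k\<close> makes \<open>f\<close> nearly constant on its own cylinders: two errors of
        \<open>\<epsilon> / 2\<close> add up.\<close>
      define V where "V x = {y \<in> topspace X. h y (\<iota> x) \<in> {h x (\<iota> x)}}" for x
      have V: "openin X (V x)" if "x \<in> topspace X" for x
        unfolding V_def using \<iota>(1)[OF that] h_PiE[of x] that X by (intro h_open) (auto simp: PiE_iff)
      have "topspace X \<subseteq> \<Union>(V ` topspace X)" by (auto simp: V_def)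
      then have "\<exists>\<F>. finite \<F> \<and> \<F> \<subseteq> V ` topspace X \<and> topspace X \<subseteq> \<Union>\<F>"
        using cp unfolding compact_space_def by (intro compactinD) (auto dest: V)
      then obtain \<F> where \<F>: "finite \<F>" "\<F> \<subseteq> V ` topspace X" "topspace X \<subseteq> \<Union>\<F>" by blast
      obtain F where F: "finite F" "F \<subseteq> topspace X" "\<F> = V ` F"
        using finite_subset_image[OF \<F>(1,2)] by blast
      obtain k where k: "k \<in> I" "\<forall>i\<in>\<iota> ` F. lei i k"
        using upper[of "\<iota> ` F"] F \<iota>(1) by blast
      have close: "\<bar>f x - f y\<bar> < \<epsilon>" if x: "x \<in> topspace X" and y: "y \<in> topspace X" and eq: "r k x = r k y" for x y
      proof -
        obtain z where z: "z \<in> F" "x \<in> V z" using \<F>(3) F(3) x by blast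
        then have z': "z \<in> topspace X" "lei (\<iota> z) k" "\<iota> z \<in> I" using F(2) k(2) \<iota>(1) by auto
        have "h x k = h y k" using r[of x k] r[of y k] x y X k(1) eq by simp
        then have "h y (\<iota> z) = h x (\<iota> z)"
          using h_bond[of y "\<iota> z" k] h_bond[of x "\<iota> z" k] x y X z' k(1) by simp
        moreover have "h x (\<iota> z) = h z (\<iota> z)" using z by (simp add: V_def)
        ultimately have "\<bar>f x - f z\<bar> < \<epsilon> / 2" "\<bar>f y - f z\<bar> < \<epsilon> / 2" using \<iota>(2)[OF z'(1)] x y by auto
        then show ?thesis by linarith
      qed
      \<comment> \<open>Any value of \<open>f\<close> on the cylinder will do.\<close>
      define c where "c n = f (SOME y. y \<in> topspace X \<and> r k y = n)" for n
      have "\<bar>f x - c (r k x)\<bar> < \<epsilon>" if x: "x \<in> topspace X" for x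
      proof -
        have "\<exists>y. y \<in> topspace X \<and> r k y = r k x" using x by blast
        from someI_ex[OF this] show ?thesis unfolding c_def by (intro close[OF x]) auto
      qed
      then show ?thesis using k(1) by blast
    qed
  qed
  then show ?thesis by blast
qed

section \<open>Construction of the sampling function\<close>

lemma nested_approximation_limit:
  fixes x d :: "nat \<Rightarrow> real"
  assumes x: "\<And>k. \<bar>x (Suc k) - x k\<bar> \<le> d k / 2" and d: "\<And>k. d (Suc k) \<le> d k / 2" "\<And>k. 0 < d k" and d0: "d \<longlonglongrightarrow> 0"
  shows "\<exists>l. \<forall>k. \<bar>l - x k\<bar> \<le> d k"
proof -
  \<comment> \<open>The intervals of radius \<open>d k\<close> around \<open>x k\<close> are nested:
    a move of at most \<open>d k / 2\<close> leaves room for the next radius, itself at most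
    \<open>d k / 2\<close>.\<close>
  have step: "x k - d k \<le> x (Suc k) - d (Suc k) \<and> x (Suc k) + d (Suc k) \<le> x k + d k" for k
    using x[of k] d(1)[of k] by (intro conjI) linarith+
  have "(\<lambda>k. - 2 * d k) \<longlonglongrightarrow> - 2 * 0" by (intro tendsto_intros d0)
  then have "(\<lambda>k. (x k - d k) - (x k + d k)) \<longlonglongrightarrow> 0" by (simp add: algebra_simps)
  moreover have "x k - d k \<le> x k + d k" for k using d(2)[of k] by linarith
  ultimately obtain l where l: "\<forall>k. x k - d k \<le> l" "\<forall>k. l \<le> x k + d k"
    using nested_sequence_unique[of "\<lambda>k. x k - d k" "\<lambda>k. x k + d k"] step by blast
  have "\<bar>l - x k\<bar> \<le> d k" for k using l(1)[THEN spec, of k] l(2)[THEN spec, of k] by linarith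
  then show ?thesis by blast
qed

lemma halving_tendsto_0:
  fixes d :: "nat \<Rightarrow> real"
  assumes d: "\<And>k. d (Suc k) \<le> d k / 2" "\<And>k. 0 < d k"
  shows "d \<longlonglongrightarrow> 0"
proof -
  have b: "d k \<le> d 0 * (1 / 2) ^ k" for k
  proof (induction k)
    case (Suc k)
    then show ?case using d(1)[of k] by simp
  qed simp
  have "(\<lambda>k. d 0 * (1 / 2) ^ k) \<longlonglongrightarrow> d 0 * 0" by (intro tendsto_intros LIMSEQ_power_zero) simp
  then have lim: "(\<lambda>k. d 0 * (1 / 2) ^ k) \<longlonglongrightarrow> 0" by simp
  show ?thesis
    by (rule tendsto_sandwich[OF _ _ tendsto_const lim]) (use b less_imp_le[OF d(2)] in \<open>auto intro!: always_eventually\<close>)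
qed

context odometer
begin

text \<open>A state is a quotient, a periodic sequence over it and a tolerance. Halving keeps the
  sum of all later changes within \<open>d'\<close>, and the last clause lets every bounded
  potential within \<open>d'\<close> of a translate of \<open>C'\<close> keep the gaps, so the limit
  inherits them.\<close>

definition refinement_step :: "nat \<Rightarrow> 'i \<times> (int \<Rightarrow> real) \<times> real \<Rightarrow> 'i \<times> (int \<Rightarrow> real) \<times> real \<Rightarrow> bool" where
  "refinement_step k = (\<lambda>(i, C, d) (i', C', d').
     (\<forall>\<omega>\<in>topspace X. r i \<omega> = r i' \<omega> mod P i) \<and>
     (\<forall>n. \<bar>C' n - C n\<bar> \<le> d / 2) \<and> d' \<le> d / 2 \<and>
     (\<forall>n. (\<integral>\<^sup>+x. ennreal (norm (band_density (window C' n) (P i') x - band_density (window C n) (P i) x)) \<partial>lborel)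
        \<le> ennreal ((1 / 2) ^ k)) \<and>
     (\<forall>j::int. \<bar>j\<bar> \<le> 4 ^ k \<longrightarrow> (\<exists>E. of_int j / 2 ^ k < E \<and> E < (of_int j + 1) / 2 ^ k \<and>
        (\<forall>V M a. bounded_by V M \<longrightarrow> (\<forall>n. \<bar>V n - C' (n + a)\<bar> \<le> d') \<longrightarrow>
           complex_of_real E \<in> resolvent_set (schroedinger V)))))"

text \<open>\<open>kick_step\<close> provides the threshold \<open>N0\<close>, \<open>refine\<close>
  a quotient of period \<open>N * P i\<close> with \<open>N \<ge> N0\<close>, and
  \<open>resolvent_persistent\<close> the tolerance that protects the new gaps.\<close>

lemma refinement_step_exists:
  assumes i: "i \<in> I" and C: "periodic_potential C (P i)" and d: "0 < (d::real)"
  shows "\<exists>i' C' d'. i' \<in> I \<and> periodic_potential C' (P i') \<and> 0 < d' \<and> refinement_step k (i, C, d) (i', C', d')"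
proof -
  interpret C: periodic_potential C "P i" by fact
  \<comment> \<open>Indices of intervals of length \<open>1 / 2 ^ k\<close> reaching beyond modulus
    \<open>2 ^ k\<close>; as \<open>k\<close> grows, every nonempty open set of energies contains
    such an interval.\<close>
  define J where "J = {- ((4::int) ^ k) .. 4 ^ k}"
  have "finite J" "(of_int j / 2 ^ k :: real) < (of_int j + 1) / 2 ^ k" "(0::real) < (1 / 2) ^ k" for j :: int
    by (simp_all add: J_def divide_strict_right_mono)
  from C.kick_step[where a = "\<lambda>j. of_int j / 2 ^ k" and b = "\<lambda>j. (of_int j + 1) / 2 ^ k", OF this] obtain N0 where N0: "\<forall>N\<ge>N0. 0 < N \<longrightarrow> (\<forall>d>0. \<exists>t. 0 < t \<and> t \<le> d \<and>
    (\<forall>n. (\<integral>\<^sup>+x. ennreal (norm (band_density (window (kick t (N * P i) C) n) (N * P i) x - band_density (window C n) (P i) x)) \<partial>lborel) \<le> ennreal ((1 / 2) ^ k)) \<and>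
    (\<forall>j\<in>J. \<exists>E. of_int j / 2 ^ k < E \<and> E < (of_int j + 1) / 2 ^ k \<and> complex_of_real E \<in> resolvent_set (schroedinger (kick t (N * P i) C))))"
    by (elim exE) (rule that)
  obtain i' where i': "i' \<in> I" "P i dvd P i'" "N0 * P i \<le> P i'" "\<forall>\<omega>\<in>topspace X. r i \<omega> = r i' \<omega> mod P i"
    using refine[OF i, of N0] by blast
  define N where "N = P i' div P i"
  have NP: "N * P i = P i'" using i'(2) by (simp add: N_def)
  have "0 < N" using NP period_pos[OF i'(1)] by (cases N) simp_all
  have "N0 \<le> N" using i'(3) period_pos[OF i] unfolding NP[symmetric] by simp
  have "0 < d / 2" using d by simp
  from N0[rule_format, OF \<open>N0 \<le> N\<close> \<open>0 < N\<close> this] obtain t where t: "0 < t" "t \<le> d / 2"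
    and L1: "\<forall>n. (\<integral>\<^sup>+x. ennreal (norm (band_density (window (kick t (N * P i) C) n) (N * P i) x - band_density (window C n) (P i) x)) \<partial>lborel) \<le> ennreal ((1 / 2) ^ k)"
    and gaps: "\<forall>j\<in>J. \<exists>E. of_int j / 2 ^ k < E \<and> E < (of_int j + 1) / 2 ^ k \<and> complex_of_real E \<in> resolvent_set (schroedinger (kick t (N * P i) C))"
    by (elim exE conjE) (rule that)
  define C' where "C' = kick t (P i') C"
  have C': "periodic_potential C' (P i')" using C.periodic_kick[OF \<open>0 < N\<close>, of t] unfolding NP C'_def .
  from bchoice[OF gaps[unfolded NP C'_def[symmetric]]] obtain E :: "int \<Rightarrow> real" where E:
    "\<And>j. j \<in> J \<Longrightarrow> of_int j / 2 ^ k < E j \<and> E j < (of_int j + 1) / 2 ^ k \<and> complex_of_real (E j) \<in> resolvent_set (schroedinger C')"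
    by blast
  have "\<exists>d>0. \<forall>V M a. bounded_by V M \<longrightarrow> (\<forall>n. \<bar>V n - C' (n + a)\<bar> \<le> d) \<longrightarrow>
      (\<lambda>j. complex_of_real (E j)) ` J \<subseteq> resolvent_set (schroedinger V)"
    using E \<open>finite J\<close> by (intro resolvent_persistent[OF periodic_potential.bounded[OF C']]) blast+
  then obtain d1 where d1: "0 < d1" "\<And>V M a. bounded_by V M \<Longrightarrow> (\<forall>n. \<bar>V n - C' (n + a)\<bar> \<le> d1) \<Longrightarrow>
      (\<lambda>j. complex_of_real (E j)) ` J \<subseteq> resolvent_set (schroedinger V)" by blast
  define d' where "d' = min d1 (d / 2)"
  have gap: "\<exists>E. of_int j / 2 ^ k < E \<and> E < (of_int j + 1) / 2 ^ k \<and>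
      (\<forall>V M a. bounded_by V M \<longrightarrow> (\<forall>n. \<bar>V n - C' (n + a)\<bar> \<le> d') \<longrightarrow> complex_of_real E \<in> resolvent_set (schroedinger V))"
    if j: "\<bar>j\<bar> \<le> 4 ^ k" for j :: int
  proof (intro exI[of _ "E j"] conjI allI impI)
    have jJ: "j \<in> J" using j by (auto simp: J_def abs_le_iff)
    show "of_int j / 2 ^ k < E j" "E j < (of_int j + 1) / 2 ^ k" using E[OF jJ] by blast+
    fix V M a assume "bounded_by V M" "\<forall>n. \<bar>V n - C' (n + a)\<bar> \<le> d'"
    moreover from this have "\<forall>n. \<bar>V n - C' (n + a)\<bar> \<le> d1" by (simp add: d'_def)
    ultimately have "(\<lambda>j. complex_of_real (E j)) ` J \<subseteq> resolvent_set (schroedinger V)" by (intro d1(2))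
    then show "complex_of_real (E j) \<in> resolvent_set (schroedinger V)" using jJ by blast
  qed
  have "refinement_step k (i, C, d) (i', C', d')"
    unfolding refinement_step_def prod.case
  proof (intro conjI)
    show "\<forall>n. \<bar>C' n - C n\<bar> \<le> d / 2" using t d by (simp add: C'_def kick_def)
    show "d' \<le> d / 2" by (simp add: d'_def)
  qed (use i'(4) L1[unfolded NP C'_def[symmetric]] gap in \<open>blast+\<close>)
  moreover have "0 < d'" using d1(1) d by (simp add: d'_def)
  ultimately show ?thesis using i'(1) C' by blast
qed

lemma refinement_sequence:
  assumes i0: "i0 \<in> I" and C0: "periodic_potential C0 (P i0)" and d0: "0 < d0"
  shows "\<exists>i C d. C 0 = C0 \<and> i 0 = i0 \<and> d 0 = d0 \<and> (\<forall>k. i k \<in> I \<and> periodic_potential (C k) (P (i k)) \<and> 0 < d k \<and>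
    refinement_step k (i k, C k, d k) (i (Suc k), C (Suc k), d (Suc k)))"
proof -
  \<comment> \<open>The clause for \<open>k = 0\<close> builds the prescribed starting state into
    the invariant.\<close>
  let ?Q = "\<lambda>k (i, C, d). i \<in> I \<and> periodic_potential C (P i) \<and> 0 < d \<and> (k = (0::nat) \<longrightarrow> (i, C, d) = (i0, C0, d0))"
  have "\<exists>s. \<forall>k. ?Q k (s k) \<and> refinement_step k (s k) (s (Suc k))"
  proof (rule dependent_nat_choice)
    show "\<exists>s. ?Q 0 s" by (rule exI[of _ "(i0, C0, d0)"]) (use assms in simp)
    fix s k assume "?Q k s"
    moreover obtain i C d where s: "s = (i, C, d)" by (cases s)
    ultimately have "i \<in> I" "periodic_potential C (P i)" "0 < d" by simp_all
    from refinement_step_exists[OF this, of k] obtain i' C' d' where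
      "i' \<in> I" "periodic_potential C' (P i')" "0 < d'" "refinement_step k (i, C, d) (i', C', d')" by blast
    then have "?Q (Suc k) (i', C', d') \<and> refinement_step k s (i', C', d')" by (simp add: s)
    then show "\<exists>s'. ?Q (Suc k) s' \<and> refinement_step k s s'" by (rule exI)
  qed
  then obtain s where s: "\<forall>k. ?Q k (s k) \<and> refinement_step k (s k) (s (Suc k))" ..
  show ?thesis
  proof (intro exI[of _ "\<lambda>k. fst (s k)"] exI[of _ "\<lambda>k. fst (snd (s k))"] exI[of _ "\<lambda>k. snd (snd (s k))"] conjI allI)
    show "fst (snd (s 0)) = C0" "fst (s 0) = i0" "snd (snd (s 0)) = d0"
      using s[THEN spec, of 0] by (simp_all add: split_beta)
    fix k
    show "fst (s k) \<in> I" "periodic_potential (fst (snd (s k))) (P (fst (s k)))" "0 < snd (snd (s k))"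
      using s[THEN spec, of k] by (simp_all add: split_beta)
    show "refinement_step k (fst (s k), fst (snd (s k)), snd (snd (s k))) (fst (s (Suc k)), fst (snd (s (Suc k))), snd (snd (s (Suc k))))"
      using s[THEN spec, of k] by simp
  qed
qed

theorem approximation_by_ac_cantor:
  assumes f: "continuous_map X euclideanreal f" and \<epsilon>: "0 < \<epsilon>"
  shows "\<exists>g. continuous_map X euclideanreal g \<and> g \<in> extensional (topspace X) \<and> (\<forall>\<omega>\<in>topspace X. \<bar>f \<omega> - g \<omega>\<bar> \<le> \<epsilon>) \<and>
    (\<forall>\<omega>\<in>topspace X. (\<exists>S. op_spectrum (H_op X T g \<omega>) = complex_of_real ` S \<and> cantor_set S \<and> emeasure lebesgue S > 0) \<and>
       purely_ac_spectrum (H_op X T g \<omega>))"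
proof -
  obtain i0 c0 where i0: "i0 \<in> I" and c0: "\<forall>\<omega>\<in>topspace X. \<bar>f \<omega> - c0 (r i0 \<omega>)\<bar> < \<epsilon> / 2"
    using digit_approximation[OF f, of "\<epsilon> / 2"] \<epsilon> by auto
  have r_less: "r j \<omega> < P j" if "j \<in> I" "\<omega> \<in> topspace X" for j \<omega>
  proof -
    have "int (r j \<omega>) = int (r j \<omega>) mod int (P j)"
      using digit_iterate[OF that, of 0] by (simp add: int_iterate_def)
    also have "\<dots> < int (P j)" using period_pos[OF that(1)] by simp
    finally show ?thesis by simp
  qed
  have "periodic_potential (\<lambda>n. c0 (nat (n mod int (P i0)))) (P i0)"
    by standard (use period_pos[OF i0] in simp_all)
  from refinement_sequence[OF i0 this, of "\<epsilon> / 2"] \<epsilon> obtain i C d where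
    C0: "C 0 = (\<lambda>n. c0 (nat (n mod int (P i0))))" and i_0: "i 0 = i0" and d_0: "d 0 = \<epsilon> / 2" and
    seq: "\<forall>k. i k \<in> I \<and> periodic_potential (C k) (P (i k)) \<and> 0 < d k \<and>
    refinement_step k (i k, C k, d k) (i (Suc k), C (Suc k), d (Suc k))" by auto
  have i: "i k \<in> I" and C: "periodic_potential (C k) (P (i k))" and d_pos: "0 < d k" for k
    using seq by blast+
  have digits: "\<forall>\<omega>\<in>topspace X. r (i k) \<omega> = r (i (Suc k)) \<omega> mod P (i k)"
    and C_step: "\<forall>n. \<bar>C (Suc k) n - C k n\<bar> \<le> d k / 2" and d_step: "d (Suc k) \<le> d k / 2"
    and L1: "\<forall>n. (\<integral>\<^sup>+x. ennreal (norm (band_density (window (C (Suc k)) n) (P (i (Suc k))) x - band_density (window (C k) n) (P (i k)) x)) \<partial>lborel)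
        \<le> ennreal ((1 / 2) ^ k)"
    and gaps: "\<forall>j::int. \<bar>j\<bar> \<le> 4 ^ k \<longrightarrow> (\<exists>E. of_int j / 2 ^ k < E \<and> E < (of_int j + 1) / 2 ^ k \<and>
        (\<forall>V M a. bounded_by V M \<longrightarrow> (\<forall>n. \<bar>V n - C (Suc k) (n + a)\<bar> \<le> d (Suc k)) \<longrightarrow>
           complex_of_real E \<in> resolvent_set (schroedinger V)))" for k
    using seq[THEN spec, of k] unfolding refinement_step_def prod.case by blast+
  have d_lim: "d \<longlonglongrightarrow> 0" by (rule halving_tendsto_0[where d = d, OF d_step d_pos])
  \<comment> \<open>Residues are compatible modulo \<open>P (i k)\<close>, so passing to the next
    quotient does not change the value read from \<open>C k\<close>.\<close>
  have C_digit: "C k (n + int (r (i (Suc k)) \<omega>)) = C k (n + int (r (i k) \<omega>))" if "\<omega> \<in> topspace X" for k n \<omega>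
  proof -
    have "(n + int (r (i (Suc k)) \<omega>)) mod int (P (i k)) = (n + int (r (i k) \<omega>)) mod int (P (i k))"
      using digits[of k] that by (simp add: zmod_int mod_add_right_eq)
    then show ?thesis using periodic_potential.V_mod[OF C] by metis
  qed
  \<comment> \<open>The limit is taken pointwise on the group, reading each stage at the residue of
    the point; \<open>restrict\<close> makes it an element of the function space.\<close>
  define g where "g = restrict (\<lambda>\<omega>. SOME l. \<forall>k. \<bar>l - C k (int (r (i k) \<omega>))\<bar> \<le> d k) (topspace X)"
  have g: "\<bar>g \<omega> - C k (int (r (i k) \<omega>))\<bar> \<le> d k" if \<omega>: "\<omega> \<in> topspace X" for \<omega> k
  proof -
    have "\<exists>l. \<forall>k. \<bar>l - C k (int (r (i k) \<omega>))\<bar> \<le> d k"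
    proof (rule nested_approximation_limit[where d = d, OF _ d_step d_pos d_lim])
      fix k show "\<bar>C (Suc k) (int (r (i (Suc k)) \<omega>)) - C k (int (r (i k) \<omega>))\<bar> \<le> d k / 2"
        using C_digit[OF \<omega>, of k 0] C_step[of k, THEN spec, of "int (r (i (Suc k)) \<omega>)"] by simp
    qed
    from someI_ex[OF this] show ?thesis unfolding g_def using \<omega> by simp
  qed
  \<comment> \<open>On a cylinder of stage \<open>k\<close> the function \<open>g\<close> varies by
    at most \<open>2 * d k\<close>, and cylinders are open.\<close>
  have cont: "continuous_map X euclideanreal g"
  proof -
    have "continuous_map X Met_TC.mtopology g"
      unfolding Met_TC.continuous_map_to_metric
    proof (intro ballI allI impI)
      fix \<omega> and \<eta> :: real assume \<omega>: "\<omega> \<in> topspace X" and \<eta>: "0 < \<eta>"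
      have "\<forall>\<^sub>F k in sequentially. d k < \<eta> / 2" using \<eta> by (intro order_tendstoD(2)[OF d_lim]) simp
      then obtain k where k: "d k < \<eta> / 2" unfolding eventually_sequentially by blast
      let ?U = "{\<omega>' \<in> topspace X. r (i k) \<omega>' = r (i k) \<omega>}"
      show "\<exists>U. openin X U \<and> \<omega> \<in> U \<and> (\<forall>y\<in>U. g y \<in> Met_TC.mball (g \<omega>) \<eta>)"
      proof (intro exI[of _ ?U] conjI ballI)
        show "openin X ?U" by (rule digit_open[OF i])
        show "\<omega> \<in> ?U" using \<omega> by simp
        fix y assume "y \<in> ?U"
        then have "\<bar>g y - C k (int (r (i k) \<omega>))\<bar> \<le> d k" using g[of y k] by simp
        then have "\<bar>g \<omega> - g y\<bar> < \<eta>" using g[OF \<omega>, of k] k by linarith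
        then show "g y \<in> Met_TC.mball (g \<omega>) \<eta>" by (simp add: dist_real_def)
      qed
    qed
    then show ?thesis by simp
  qed
  have close: "\<bar>f \<omega> - g \<omega>\<bar> \<le> \<epsilon>" if \<omega>: "\<omega> \<in> topspace X" for \<omega>
  proof -
    have "C 0 (int (r (i 0) \<omega>)) = c0 (r i0 \<omega>)"
      unfolding C0 i_0 using r_less[OF i0 \<omega>] by simp
    then have "\<bar>g \<omega> - c0 (r i0 \<omega>)\<bar> \<le> \<epsilon> / 2" using g[OF \<omega>, of 0] d_0 by simp
    moreover have "\<bar>f \<omega> - c0 (r i0 \<omega>)\<bar> < \<epsilon> / 2" using c0 \<omega> by blast
    ultimately show ?thesis by linarith
  qed
  have spec: "(\<exists>S. op_spectrum (H_op X T g \<omega>) = complex_of_real ` S \<and> cantor_set S \<and> emeasure lebesgue S > 0) \<and>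
       purely_ac_spectrum (H_op X T g \<omega>)" if \<omega>: "\<omega> \<in> topspace X" for \<omega>
  proof -
    define V where "V n = g (int_iterate (topspace X) T n \<omega>)" for n
    \<comment> \<open>Along the orbit of \<open>\<omega>\<close> the stage \<open>k\<close>
      potential is \<open>C k\<close> translated by the residue of \<open>\<omega>\<close>, so the
      point enters through translations alone.\<close>
    have V: "\<bar>V n - C k (n + int (r (i k) \<omega>))\<bar> \<le> d k" for k n
    proof -
      have "C k (int (r (i k) (int_iterate (topspace X) T n \<omega>))) = C k (n + int (r (i k) \<omega>))"
        unfolding digit_iterate[OF i \<omega>] periodic_potential.V_mod[OF C, of _ "n + int (r (i k) \<omega>)"] by (simp add: add.commute)
      then show ?thesis using g[OF iterate_closed[OF \<omega>], of n k] unfolding V_def by simp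
    qed
    have bV: "bounded_by V (periodic_potential.bound (C 0) (P (i 0)) + d 0)"
      unfolding bounded_by_def
    proof
      fix n show "\<bar>V n\<bar> \<le> periodic_potential.bound (C 0) (P (i 0)) + d 0"
        using V[of n 0] bounded_byD[OF periodic_potential.bounded[OF C], of 0 "n + int (r (i 0) \<omega>)"] by linarith
    qed
    have "(\<exists>S. op_spectrum (schroedinger V) = complex_of_real ` S \<and> cantor_set S \<and> emeasure lebesgue S > 0) \<and>
       purely_ac_spectrum (schroedinger V)"
    proof (rule limit_periodic_ac_cantor[where c = C and p = "\<lambda>k. P (i k)" and a = "\<lambda>k. int (r (i k) \<omega>)" and d = d])
      show "periodic_potential (C k) (P (i k))" for k by (rule C)
      show "C k (n + int (r (i (Suc k)) \<omega>)) = C k (n + int (r (i k) \<omega>))" for k n by (rule C_digit[OF \<omega>])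
      show "\<bar>V n - C k (n + int (r (i k) \<omega>))\<bar> \<le> d k" for k n by (rule V)
      show "d \<longlonglongrightarrow> 0" by (rule d_lim)
      show "(\<integral>\<^sup>+x. ennreal (norm (band_density (window (C (Suc k)) n) (P (i (Suc k))) x - band_density (window (C k) n) (P (i k)) x)) \<partial>lborel)
        \<le> ennreal ((1 / 2) ^ k)" for k n using L1[of k] by blast
      fix k :: nat and j :: int assume "\<bar>j\<bar> \<le> 4 ^ k"
      then obtain E where E: "of_int j / 2 ^ k < E" "E < (of_int j + 1) / 2 ^ k"
        "\<forall>V M a. bounded_by V M \<longrightarrow> (\<forall>n. \<bar>V n - C (Suc k) (n + a)\<bar> \<le> d (Suc k)) \<longrightarrow>
           complex_of_real E \<in> resolvent_set (schroedinger V)" using gaps[of k] by blast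
      have "complex_of_real E \<in> resolvent_set (schroedinger V)"
        using E(3) bV V[of _ "Suc k"] by blast
      then show "\<exists>E. of_int j / 2 ^ k < E \<and> E < (of_int j + 1) / 2 ^ k \<and> complex_of_real E \<in> resolvent_set (schroedinger V)"
        using E(1,2) by blast
    qed
    then show ?thesis unfolding H_op_def V_def .
  qed
  show ?thesis
  proof (intro exI[of _ g] conjI)
    show "g \<in> extensional (topspace X)" by (simp add: g_def)
  qed (use cont close spec in blast)+
qed

end

theorem theorem2p7:
  fixes G :: "('a, 'm) monoid_scheme"
    and X :: "'a topology"
    and I :: "'i set"
    and lei :: "'i \<Rightarrow> 'i \<Rightarrow> bool"
    and A :: "'i \<Rightarrow> 'b monoid"
    and \<phi> :: "'i \<Rightarrow> 'i \<Rightarrow> 'b \<Rightarrow> 'b"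
    and T :: "'a \<Rightarrow> 'a"
  assumes "procyclic_group G X I lei A \<phi>"
    and "infinite (carrier G)"
    and "translation G T"
    and "minimal X T"
  shows "\<exists>D. dense_in_C X D \<and>
           (\<forall>f\<in>D. \<forall>\<omega>\<in>carrier G.
              (\<exists>S. op_spectrum (H_op X T f \<omega>) = complex_of_real ` S \<and>
                   cantor_set S \<and> emeasure lebesgue S > 0) \<and>
              purely_ac_spectrum (H_op X T f \<omega>))"
proof -
  obtain P :: "'i \<Rightarrow> nat" and r :: "'i \<Rightarrow> 'a \<Rightarrow> nat" where "odometer X T I P r"
    using odometer_procyclic[OF assms] by blast
  then interpret odometer X T I P r .
  have X: "topspace X = carrier G" using assms(1) by (simp add: procyclic_group_def topological_group_def)
  define R where "R g \<longleftrightarrow> (\<forall>\<omega>\<in>carrier G. (\<exists>S. op_spectrum (H_op X T g \<omega>) = complex_of_real ` S \<and>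
    cantor_set S \<and> emeasure lebesgue S > 0) \<and> purely_ac_spectrum (H_op X T g \<omega>))" for g
  have "compactin X (topspace X)" using compact by (simp add: compact_space_def)
  then have M: "mspace (C_real X) = {f. f \<in> extensional (topspace X) \<and> continuous_map X euclideanreal f}"
    by (subst compactin_mspace_cfunspace) auto
  \<comment> \<open>The largest candidate: all continuous functions with the property. Density is
    then the existence of one of them near each \<open>f\<close>.\<close>
  define D where "D = {f \<in> mspace (C_real X). R f}"
  interpret C: Metric_space "mspace (C_real X)" "mdist (C_real X)" by (rule Metric_space_mspace_mdist)
  have "dense_in_C X D"
    unfolding dense_in_C_def mtopology_of_def C.metric_closure_of
  proof (intro conjI equalityI subsetI CollectI allI impI)
    show "f \<in> mspace (C_real X)" if "f \<in> D" for f using that by (simp add: D_def)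
    show "f \<in> mspace (C_real X)" if "f \<in> {f \<in> mspace (C_real X). \<forall>e>0. \<exists>g\<in>D. g \<in> C.mball f e}" for f
      using that by blast
    fix f assume f: "f \<in> mspace (C_real X)"
    then show "f \<in> mspace (C_real X)" .
    fix e :: real assume e: "0 < e"
    have "continuous_map X euclideanreal f" using f unfolding M by blast
    from approximation_by_ac_cantor[OF this, of "e / 2"] e obtain g where
      g: "continuous_map X euclideanreal g" "g \<in> extensional (topspace X)" "\<forall>\<omega>\<in>topspace X. \<bar>f \<omega> - g \<omega>\<bar> \<le> e / 2" "R g"
      unfolding R_def X[symmetric] by auto
    have gM: "g \<in> mspace (C_real X)" unfolding M using g by blast
    have "mdist (C_real X) f g \<le> e / 2"
      using e g(3) by (intro mdist_cfunspace_le) (auto simp: dist_real_def)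
    then have "g \<in> C.mball f e" using e f gM unfolding C.in_mball by auto
    moreover have "g \<in> D" unfolding D_def using gM g(4) by blast
    ultimately show "\<exists>g\<in>D. g \<in> C.mball f e" by blast
  qed
  moreover have "\<forall>f\<in>D. R f" by (simp add: D_def)
  ultimately show ?thesis unfolding R_def by blast
qed

end
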